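(* Let $p$ be a prime and let $G$ be a pro-$p$ group with a closed normal subgroup $N$ that is a free pro-$p$ group of at most countable rank and such that $G/N\simeq\mathbb{Z}_p$. Let $g\in G$ be such that $gN$ topologically generates $G/N$. Put $S=\mathbb{F}_p[\![G]\!]$, $R=\mathbb{F}_p[\![N]\!]$, let $\sigma$ be the automorphism $x\mapsto g^{-1}xg$ and let $\delta=\sigma-\operatorname{id}$. Then $S$ is isomorphic to the right skew power series ring $R[\![s;\sigma,\delta]\!]$.
   Context: Let $R$ be a complete topological ring, $\sigma$ a continuous automorphism of $R$ and $\delta=\sigma-\operatorname{id}$, so that $\delta$ is additive and $\delta(ab)=\delta(a)b+\sigma(a)\delta(b)$. The right skew power series ring $R[\![s;\sigma,\delta]\!]$ consists of the topological abelian group of formal power series $\sum_{i\ge0}s^ia_i$ ($a_i\in R$) with multiplication $$\Big(\sum_{i\ge0}s^ia_i\Big)\Big(\sum_{j\ge0}s^jb_j\Big)=\sum_{m\ge0}s^m\Big(\sum_{n=0}^m\sum_{k\ge n}\binom{k}{n}\delta^{k-n}(\sigma^n(a_{m-n}))b_k\Big);$$ it exists provided that all the infinite inner sums converge, and then satisfies $as=s\sigma(a)+\delta(a)$ for $a\in R$. In the proposition, $R=\mathbb{F}_p[\![N]\!]\subseteq S$, $\sigma$ restricts to $R$ because $N$ is normal, and $R$ carries the filtration $R_k=R\cap I_G^k$, where $I_G$ is the augmentation ideal of $S$. The assertion includes the existence of the skew power series ring. *)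

theory Defs
  imports
    "HOL-Analysis.Analysis"
    "HOL-Algebra.Ideal_Product"
    "HOL-Algebra.QuotRing"
    "HOL-Number_Theory.Residues"
begin

section \<open>Topological groups\<close>

definition topological_group :: "('a, 'm) monoid_scheme \<Rightarrow> 'a topology \<Rightarrow> bool" where
  "topological_group G T \<longleftrightarrow>
     group G \<and> topspace T = carrier G \<and>
     continuous_map (prod_topology T T) T (\<lambda>(x, y). x \<otimes>\<^bsub>G\<^esub> y) \<and>
     continuous_map T T (\<lambda>x. inv\<^bsub>G\<^esub> x)"

definition profinite_group :: "('a, 'm) monoid_scheme \<Rightarrow> 'a topology \<Rightarrow> bool" where
  "profinite_group G T \<longleftrightarrow>
     topological_group G T \<and> compact_space T \<and> Hausdorff_space T \<and>
     (\<forall>V. openin T V \<and> \<one>\<^bsub>G\<^esub> \<in> V \<longrightarrow> (\<exists>U. subgroup U G \<and> openin T U \<and> U \<subseteq> V))"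

definition open_normal_subgroups :: "('a, 'm) monoid_scheme \<Rightarrow> 'a topology \<Rightarrow> 'a set set" where
  "open_normal_subgroups G T = {U. U \<lhd> G \<and> openin T U}"

definition pro_p_group :: "nat \<Rightarrow> ('a, 'm) monoid_scheme \<Rightarrow> 'a topology \<Rightarrow> bool" where
  "pro_p_group p G T \<longleftrightarrow>
     profinite_group G T \<and>
     (\<forall>U \<in> open_normal_subgroups G T. \<exists>n. card (rcosets\<^bsub>G\<^esub> U) = p ^ n)"

definition isomorphic_topological_groups ::
    "('a, 'm) monoid_scheme \<Rightarrow> 'a topology \<Rightarrow> ('b, 'n) monoid_scheme \<Rightarrow> 'b topology \<Rightarrow> bool" where
  "isomorphic_topological_groups G TG H TH \<longleftrightarrow>
     (\<exists>f. f \<in> iso G H \<and> homeomorphic_map TG TH f)"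

definition quotient_group_topology ::
    "('a, 'm) monoid_scheme \<Rightarrow> 'a topology \<Rightarrow> 'a set \<Rightarrow> 'a set topology" where
  "quotient_group_topology G T N =
     topology (\<lambda>V. V \<subseteq> carrier (G Mod N) \<and> openin T {x \<in> topspace T. N #>\<^bsub>G\<^esub> x \<in> V})"

lemma openin_quotient_group_topology:
  "openin (quotient_group_topology G T N) V \<longleftrightarrow>
     V \<subseteq> carrier (G Mod N) \<and> openin T {x \<in> topspace T. N #>\<^bsub>G\<^esub> x \<in> V}"
proof -
  have "istopology (\<lambda>V. V \<subseteq> carrier (G Mod N) \<and> openin T {x \<in> topspace T. N #>\<^bsub>G\<^esub> x \<in> V})"
    unfolding istopology_def
  proof (intro conjI allI impI)
    fix V W
    assume "V \<subseteq> carrier (G Mod N) \<and> openin T {x \<in> topspace T. N #>\<^bsub>G\<^esub> x \<in> V}"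
      and "W \<subseteq> carrier (G Mod N) \<and> openin T {x \<in> topspace T. N #>\<^bsub>G\<^esub> x \<in> W}"
    moreover have "{x \<in> topspace T. N #>\<^bsub>G\<^esub> x \<in> V \<inter> W} =
        {x \<in> topspace T. N #>\<^bsub>G\<^esub> x \<in> V} \<inter> {x \<in> topspace T. N #>\<^bsub>G\<^esub> x \<in> W}"
      by auto
    ultimately show "V \<inter> W \<subseteq> carrier (G Mod N)"
      and "openin T {x \<in> topspace T. N #>\<^bsub>G\<^esub> x \<in> V \<inter> W}"
      by auto
  next
    fix K
    assume K: "\<forall>V\<in>K. V \<subseteq> carrier (G Mod N) \<and> openin T {x \<in> topspace T. N #>\<^bsub>G\<^esub> x \<in> V}"
    show "\<Union>K \<subseteq> carrier (G Mod N)" using K by blast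
    have "{x \<in> topspace T. N #>\<^bsub>G\<^esub> x \<in> \<Union>K} = (\<Union>V\<in>K. {x \<in> topspace T. N #>\<^bsub>G\<^esub> x \<in> V})"
      by auto
    then show "openin T {x \<in> topspace T. N #>\<^bsub>G\<^esub> x \<in> \<Union>K}"
      using K by auto
  qed
  then show ?thesis
    by (simp add: quotient_group_topology_def topology_inverse')
qed

definition topologically_generates ::
    "('a, 'm) monoid_scheme \<Rightarrow> 'a topology \<Rightarrow> 'a set \<Rightarrow> bool" where
  "topologically_generates G T X \<longleftrightarrow>
     X \<subseteq> carrier G \<and> Abstract_Topology.closure_of T (generate G X) = carrier G"


section \<open>The additive group of p-adic integers\<close>

text \<open>The inverse limit of the groups \<open>\<int>/p\<^sup>k\<close>, with residues in \<open>{0..<p\<^sup>k}\<close>.\<close>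

definition padic_int_group :: "nat \<Rightarrow> (nat \<Rightarrow> int) monoid" where
  "padic_int_group p =
     \<lparr>carrier = {a. \<forall>k. a k \<in> {0..<int p ^ k} \<and> a (Suc k) mod int p ^ k = a k},
      mult = (\<lambda>a b k. (a k + b k) mod int p ^ k),
      one = (\<lambda>_. 0)\<rparr>"

definition padic_int_topology :: "nat \<Rightarrow> (nat \<Rightarrow> int) topology" where
  "padic_int_topology p =
     subtopology (product_topology (\<lambda>_. discrete_topology UNIV) UNIV) (carrier (padic_int_group p))"


section \<open>Free pro-p groups\<close>

definition converges_to_one ::
    "('b, 'm) monoid_scheme \<Rightarrow> 'b topology \<Rightarrow> 'x set \<Rightarrow> ('x \<Rightarrow> 'b) \<Rightarrow> bool" where
  "converges_to_one H T X f \<longleftrightarrow>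
     f \<in> X \<rightarrow> carrier H \<and>
     (\<forall>V. openin T V \<and> \<one>\<^bsub>H\<^esub> \<in> V \<longrightarrow> finite {x \<in> X. f x \<notin> V})"

text \<open>
  Freeness on a set of generators converging to 1, for countable sets of generators.
  A definition in HOL cannot quantify over test groups on all types. Carriers in
  \<^typ>\<open>nat set\<close> suffice: if \<open>f\<close> converges to 1 on a countable set, then the closed
  subgroup generated by its image is a second countable pro-p group, hence has at most
  the cardinality of the continuum; and uniqueness already follows from uniqueness for
  finite test groups.
\<close>

definition countable_free_pro_p_basis ::
    "nat \<Rightarrow> ('a, 'm) monoid_scheme \<Rightarrow> 'a topology \<Rightarrow> 'a set \<Rightarrow> bool" where
  "countable_free_pro_p_basis p F T X \<longleftrightarrow>
     countable X \<and> converges_to_one F T X (\<lambda>x. x) \<and>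
     (\<forall>(H :: nat set monoid) TH f.
        pro_p_group p H TH \<and> converges_to_one H TH X f \<longrightarrow>
        (\<exists>!h. h \<in> extensional (carrier F) \<and> h \<in> hom F H \<and> continuous_map T TH h \<and>
              (\<forall>x\<in>X. h x = f x)))"

definition free_pro_p_group_countable_rank ::
    "nat \<Rightarrow> ('a, 'm) monoid_scheme \<Rightarrow> 'a topology \<Rightarrow> bool" where
  "free_pro_p_group_countable_rank p F T \<longleftrightarrow>
     pro_p_group p F T \<and> (\<exists>X. countable_free_pro_p_basis p F T X)"


section \<open>Group rings and completed group rings\<close>

text \<open>Only meant for finite \<open>H\<close>.\<close>

definition group_ring :: "('k, 'c) ring_scheme \<Rightarrow> ('h, 'm) monoid_scheme \<Rightarrow> ('h \<Rightarrow> 'k) ring" where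
  "group_ring K H =
     \<lparr>carrier = carrier H \<rightarrow>\<^sub>E carrier K,
      mult = (\<lambda>x y. \<lambda>h\<in>carrier H.
                \<Oplus>\<^bsub>K\<^esub>u\<in>carrier H. x u \<otimes>\<^bsub>K\<^esub> y (inv\<^bsub>H\<^esub> u \<otimes>\<^bsub>H\<^esub> h)),
      one = (\<lambda>h\<in>carrier H. if h = \<one>\<^bsub>H\<^esub> then \<one>\<^bsub>K\<^esub> else \<zero>\<^bsub>K\<^esub>),
      zero = (\<lambda>h\<in>carrier H. \<zero>\<^bsub>K\<^esub>),
      add = (\<lambda>x y. \<lambda>h\<in>carrier H. x h \<oplus>\<^bsub>K\<^esub> y h)\<rparr>"

text \<open>The linear extension of a map \<open>H \<rightarrow> H'\<close>.\<close>

definition group_ring_map ::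
    "('k, 'c) ring_scheme \<Rightarrow> ('h, 'm) monoid_scheme \<Rightarrow> ('i, 'n) monoid_scheme \<Rightarrow>
     ('h \<Rightarrow> 'i) \<Rightarrow> ('h \<Rightarrow> 'k) \<Rightarrow> 'i \<Rightarrow> 'k" where
  "group_ring_map K H H' f x =
     (\<lambda>h'\<in>carrier H'. \<Oplus>\<^bsub>K\<^esub>h\<in>{h \<in> carrier H. f h = h'}. x h)"

text \<open>
  The inverse limit of the group rings \<open>K[G/U]\<close> over the open normal subgroups \<open>U\<close>;
  \<open>x U C\<close> is the coefficient of the coset \<open>C\<close> in the image of \<open>x\<close> in \<open>K[G/U]\<close>, and
  for \<open>U \<subseteq> V\<close> the projection \<open>G/U \<rightarrow> G/V\<close> is \<open>C \<mapsto> VC\<close>.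
\<close>

definition completed_group_ring ::
    "('k, 'c) ring_scheme \<Rightarrow> ('a, 'm) monoid_scheme \<Rightarrow> 'a topology \<Rightarrow>
     ('a set \<Rightarrow> 'a set \<Rightarrow> 'k) ring" where
  "completed_group_ring K G T =
     \<lparr>carrier = {x \<in> (\<Pi>\<^sub>E U\<in>open_normal_subgroups G T. carrier (group_ring K (G Mod U))).
                  \<forall>U \<in> open_normal_subgroups G T. \<forall>V \<in> open_normal_subgroups G T. U \<subseteq> V \<longrightarrow>
                    x V = group_ring_map K (G Mod U) (G Mod V) (\<lambda>C. V <#>\<^bsub>G\<^esub> C) (x U)},
      mult = (\<lambda>x y. \<lambda>U\<in>open_normal_subgroups G T. x U \<otimes>\<^bsub>group_ring K (G Mod U)\<^esub> y U),
      one = (\<lambda>U\<in>open_normal_subgroups G T. \<one>\<^bsub>group_ring K (G Mod U)\<^esub>),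
      zero = (\<lambda>U\<in>open_normal_subgroups G T. \<zero>\<^bsub>group_ring K (G Mod U)\<^esub>),
      add = (\<lambda>x y. \<lambda>U\<in>open_normal_subgroups G T. x U \<oplus>\<^bsub>group_ring K (G Mod U)\<^esub> y U)\<rparr>"

text \<open>The inverse limit topology, for discrete \<open>K\<close>.\<close>

definition completed_group_ring_topology ::
    "('k, 'c) ring_scheme \<Rightarrow> ('a, 'm) monoid_scheme \<Rightarrow> 'a topology \<Rightarrow>
     ('a set \<Rightarrow> 'a set \<Rightarrow> 'k) topology" where
  "completed_group_ring_topology K G T =
     subtopology
       (product_topology (\<lambda>U. discrete_topology (carrier (group_ring K (G Mod U))))
          (open_normal_subgroups G T))
       (carrier (completed_group_ring K G T))"

definition group_element ::
    "('k, 'c) ring_scheme \<Rightarrow> ('a, 'm) monoid_scheme \<Rightarrow> 'a topology \<Rightarrow> 'a \<Rightarrow>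
     'a set \<Rightarrow> 'a set \<Rightarrow> 'k" where
  "group_element K G T g =
     (\<lambda>U\<in>open_normal_subgroups G T. \<lambda>C\<in>carrier (G Mod U).
        if C = U #>\<^bsub>G\<^esub> g then \<one>\<^bsub>K\<^esub> else \<zero>\<^bsub>K\<^esub>)"

text \<open>
  The augmentation \<open>K[[G]] \<rightarrow> K\<close> is the component at \<open>U = G\<close>: the group \<open>G/G\<close> has the
  single element \<^term>\<open>carrier G\<close>.
\<close>

definition augmentation_ideal ::
    "('k, 'c) ring_scheme \<Rightarrow> ('a, 'm) monoid_scheme \<Rightarrow> 'a topology \<Rightarrow>
     ('a set \<Rightarrow> 'a set \<Rightarrow> 'k) set" where
  "augmentation_ideal K G T =
     {x \<in> carrier (completed_group_ring K G T). x (carrier G) (carrier G) = \<zero>\<^bsub>K\<^esub>}"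

text \<open>
  Powers of the augmentation ideal are taken in the category of compact rings, i.e. they
  are the closures of the algebraic powers. If \<open>G\<close> is topologically finitely generated
  and \<open>K\<close> is finite, the algebraic powers are already closed.
\<close>

definition augmentation_power ::
    "('k, 'c) ring_scheme \<Rightarrow> ('a, 'm) monoid_scheme \<Rightarrow> 'a topology \<Rightarrow> nat \<Rightarrow>
     ('a set \<Rightarrow> 'a set \<Rightarrow> 'k) set" where
  "augmentation_power K G T k =
     Abstract_Topology.closure_of (completed_group_ring_topology K G T)
       (augmentation_ideal K G T [^]\<^bsub>ideals_set (completed_group_ring K G T)\<^esub> k)"

text \<open>
  The canonical map \<open>K[[N]] \<rightarrow> K[[G]]\<close> for a closed normal subgroup \<open>N\<close>, induced by
  \<open>N/(N \<inter> U) \<rightarrow> G/U\<close>, \<open>D \<mapsto> UD\<close>. It is injective, and \<open>K[[N]]\<close> is identified with its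
  image, as a subring of \<open>K[[G]]\<close>.
\<close>

definition completed_group_ring_embedding ::
    "('k, 'c) ring_scheme \<Rightarrow> ('a, 'm) monoid_scheme \<Rightarrow> 'a topology \<Rightarrow> 'a set \<Rightarrow>
     ('a set \<Rightarrow> 'a set \<Rightarrow> 'k) \<Rightarrow> 'a set \<Rightarrow> 'a set \<Rightarrow> 'k" where
  "completed_group_ring_embedding K G T N x =
     (\<lambda>U\<in>open_normal_subgroups G T.
        group_ring_map K (G\<lparr>carrier := N\<rparr> Mod (N \<inter> U)) (G Mod U) (\<lambda>D. U <#>\<^bsub>G\<^esub> D) (x (N \<inter> U)))"

definition completed_subgroup_ring ::
    "('k, 'c) ring_scheme \<Rightarrow> ('a, 'm) monoid_scheme \<Rightarrow> 'a topology \<Rightarrow> 'a set \<Rightarrow>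
     ('a set \<Rightarrow> 'a set \<Rightarrow> 'k) ring" where
  "completed_subgroup_ring K G T N =
     (completed_group_ring K G T)
       \<lparr>carrier := completed_group_ring_embedding K G T N `
                    carrier (completed_group_ring K (G\<lparr>carrier := N\<rparr>) (subtopology T N))\<rparr>"


section \<open>Topological rings\<close>

definition topological_ring :: "('r, 'm) ring_scheme \<Rightarrow> 'r topology \<Rightarrow> bool" where
  "topological_ring R T \<longleftrightarrow>
     ring R \<and> topspace T = carrier R \<and>
     continuous_map (prod_topology T T) T (\<lambda>(x, y). x \<oplus>\<^bsub>R\<^esub> y) \<and>
     continuous_map T T (\<lambda>x. \<ominus>\<^bsub>R\<^esub> x) \<and>
     continuous_map (prod_topology T T) T (\<lambda>(x, y). x \<otimes>\<^bsub>R\<^esub> y)"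

definition ring_cauchy_filter :: "('r, 'm) ring_scheme \<Rightarrow> 'r topology \<Rightarrow> 'r filter \<Rightarrow> bool" where
  "ring_cauchy_filter R T F \<longleftrightarrow>
     (\<forall>V. openin T V \<and> \<zero>\<^bsub>R\<^esub> \<in> V \<longrightarrow>
        (\<exists>M \<subseteq> carrier R. eventually (\<lambda>x. x \<in> M) F \<and> (\<forall>x\<in>M. \<forall>y\<in>M. x \<ominus>\<^bsub>R\<^esub> y \<in> V)))"

definition complete_topological_ring :: "('r, 'm) ring_scheme \<Rightarrow> 'r topology \<Rightarrow> bool" where
  "complete_topological_ring R T \<longleftrightarrow>
     topological_ring R T \<and> Hausdorff_space T \<and>
     (\<forall>F. F \<noteq> bot \<and> ring_cauchy_filter R T F \<longrightarrow> (\<exists>l. limitin T (\<lambda>x. x) l F))"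

text \<open>
  The topology for which the sets \<open>F k\<close> are a neighbourhood basis of 0; \<open>F\<close> is meant to be
  a descending sequence of additive subgroups.
\<close>

definition filtration_topology :: "('r, 'm) ring_scheme \<Rightarrow> (nat \<Rightarrow> 'r set) \<Rightarrow> 'r topology" where
  "filtration_topology R F =
     topology (\<lambda>V. V \<subseteq> carrier R \<and>
       (\<forall>x\<in>V. \<exists>k. \<forall>y\<in>carrier R. y \<ominus>\<^bsub>R\<^esub> x \<in> F k \<longrightarrow> y \<in> V))"

lemma openin_filtration_topology:
  assumes "decseq F"
  shows "openin (filtration_topology R F) V \<longleftrightarrow>
    V \<subseteq> carrier R \<and> (\<forall>x\<in>V. \<exists>k. \<forall>y\<in>carrier R. y \<ominus>\<^bsub>R\<^esub> x \<in> F k \<longrightarrow> y \<in> V)"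
proof -
  let ?P = "\<lambda>V. V \<subseteq> carrier R \<and> (\<forall>x\<in>V. \<exists>k. \<forall>y\<in>carrier R. y \<ominus>\<^bsub>R\<^esub> x \<in> F k \<longrightarrow> y \<in> V)"
  have "?P (V \<inter> W)" if V: "?P V" and W: "?P W" for V W
  proof (intro conjI ballI)
    show "V \<inter> W \<subseteq> carrier R" using V by blast
    fix x assume "x \<in> V \<inter> W"
    then obtain k l where
      k: "\<forall>y\<in>carrier R. y \<ominus>\<^bsub>R\<^esub> x \<in> F k \<longrightarrow> y \<in> V" and
      l: "\<forall>y\<in>carrier R. y \<ominus>\<^bsub>R\<^esub> x \<in> F l \<longrightarrow> y \<in> W"
      using V W by blast
    have "F (max k l) \<subseteq> F k" "F (max k l) \<subseteq> F l"
      using assms by (auto simp: decseq_def)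
    then show "\<exists>k. \<forall>y\<in>carrier R. y \<ominus>\<^bsub>R\<^esub> x \<in> F k \<longrightarrow> y \<in> V \<inter> W"
      using k l by blast
  qed
  moreover have "?P (\<Union>K)" if "\<forall>V\<in>K. ?P V" for K
    using that by (meson Sup_least UnionE UnionI)
  ultimately have "istopology ?P"
    unfolding istopology_def by blast
  then show ?thesis
    by (simp add: filtration_topology_def topology_inverse')
qed


section \<open>Right skew power series rings\<close>

definition skew_derivation :: "('r, 'm) ring_scheme \<Rightarrow> ('r \<Rightarrow> 'r) \<Rightarrow> 'r \<Rightarrow> 'r" where
  "skew_derivation R \<sigma> x = \<sigma> x \<ominus>\<^bsub>R\<^esub> x"

definition series_sums_from ::
    "('r, 'm) ring_scheme \<Rightarrow> 'r topology \<Rightarrow> nat \<Rightarrow> (nat \<Rightarrow> 'r) \<Rightarrow> 'r \<Rightarrow> bool" where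
  "series_sums_from R T n f l \<longleftrightarrow>
     limitin T (\<lambda>M. \<Oplus>\<^bsub>R\<^esub>k\<in>{n..<M}. f k) l sequentially"

text \<open>A sequence \<open>a\<close> stands for the formal series \<open>\<Sum>i. s\<^sup>i a\<^sub>i\<close>.\<close>

definition skew_summand ::
    "('r, 'm) ring_scheme \<Rightarrow> ('r \<Rightarrow> 'r) \<Rightarrow> ('r \<Rightarrow> 'r) \<Rightarrow>
     (nat \<Rightarrow> 'r) \<Rightarrow> (nat \<Rightarrow> 'r) \<Rightarrow> nat \<Rightarrow> nat \<Rightarrow> nat \<Rightarrow> 'r" where
  "skew_summand R \<sigma> \<delta> a b m n k =
     ([(k choose n)] \<cdot>\<^bsub>R\<^esub> ((\<delta> ^^ (k - n)) ((\<sigma> ^^ n) (a (m - n))))) \<otimes>\<^bsub>R\<^esub> b k"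

definition skew_power_series_ring ::
    "('r, 'm) ring_scheme \<Rightarrow> 'r topology \<Rightarrow> ('r \<Rightarrow> 'r) \<Rightarrow> ('r \<Rightarrow> 'r) \<Rightarrow> (nat \<Rightarrow> 'r) ring" where
  "skew_power_series_ring R T \<sigma> \<delta> =
     \<lparr>carrier = {a. \<forall>i. a i \<in> carrier R},
      mult = (\<lambda>a b m. \<Oplus>\<^bsub>R\<^esub>n\<in>{0..m}.
                (THE l. series_sums_from R T n (skew_summand R \<sigma> \<delta> a b m n) l)),
      one = (\<lambda>i. if i = 0 then \<one>\<^bsub>R\<^esub> else \<zero>\<^bsub>R\<^esub>),
      zero = (\<lambda>_. \<zero>\<^bsub>R\<^esub>),
      add = (\<lambda>a b i. a i \<oplus>\<^bsub>R\<^esub> b i)\<rparr>"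

definition skew_power_series_topology :: "'r topology \<Rightarrow> (nat \<Rightarrow> 'r) topology" where
  "skew_power_series_topology T = product_topology (\<lambda>_. T) UNIV"

text \<open>The data are admissible and all the inner sums in the product of two series converge.\<close>

definition skew_power_series_ring_exists ::
    "('r, 'm) ring_scheme \<Rightarrow> 'r topology \<Rightarrow> ('r \<Rightarrow> 'r) \<Rightarrow> ('r \<Rightarrow> 'r) \<Rightarrow> bool" where
  "skew_power_series_ring_exists R T \<sigma> \<delta> \<longleftrightarrow>
     complete_topological_ring R T \<and>
     \<sigma> \<in> ring_iso R R \<and> continuous_map T T \<sigma> \<and>
     (\<forall>x \<in> carrier R. \<delta> x = \<sigma> x \<ominus>\<^bsub>R\<^esub> x) \<and>
     (\<forall>a \<in> carrier (skew_power_series_ring R T \<sigma> \<delta>).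
      \<forall>b \<in> carrier (skew_power_series_ring R T \<sigma> \<delta>). \<forall>m. \<forall>n\<le>m.
        \<exists>l. series_sums_from R T n (skew_summand R \<sigma> \<delta> a b m n) l) \<and>
     ring (skew_power_series_ring R T \<sigma> \<delta>)"

definition isomorphic_topological_rings ::
    "('a, 'm) ring_scheme \<Rightarrow> 'a topology \<Rightarrow> ('b, 'n) ring_scheme \<Rightarrow> 'b topology \<Rightarrow> bool" where
  "isomorphic_topological_rings A TA B TB \<longleftrightarrow>
     (\<exists>f. f \<in> ring_iso A B \<and> homeomorphic_map TA TB f)"

end

theory Submission
  imports Defs "HOL-Algebra.Subrings" "HOL-Algebra.Group_Action"
begin

text \<open>
  The variable \<open>s\<close> is \<open>g - 1\<close>. For an open normal subgroup \<open>V\<close> such that \<open>g\<close> has the same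
  order \<open>m = p\<^sup>n\<close> modulo \<open>V\<close> and modulo \<open>NV\<close>, the powers \<open>g\<^sup>j\<close>, hence also the powers
  \<open>s\<^sup>j\<close>, with \<open>j < m\<close> form a basis of the right \<open>\<bbbF>\<^sub>p[NV/V]\<close>-module \<open>\<bbbF>\<^sub>p[G/V]\<close>, and
  \<open>s\<^sup>m = g\<^sup>m - 1 = 0\<close> there. Such \<open>V\<close> are cofinal, with \<open>m\<close> arbitrarily large, so in the limit
  every element of \<open>S\<close> is uniquely a series \<open>\<Sum> s\<^sup>i a\<^sub>i\<close> with coefficients in \<open>R\<close>.

  The relation \<open>a s = s \<sigma>(a) + \<delta>(a)\<close> gives the coefficients of \<open>a s\<^sup>k\<close>, and these determine the
  product. Since \<open>\<delta>\<close> maps \<open>R\<^sub>k\<close> into \<open>R\<^sub>k\<^sub>+\<^sub>1\<close>, the series with \<open>a\<^sub>i \<in> R\<^sub>k\<^sub>-\<^sub>i\<close> form a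
  multiplicative filtration by closed subgroups whose first term contains the augmentation ideal;
  hence it is the filtration by the \<open>I\<^sup>k\<close>, and the bijection is a homeomorphism.
\<close>

section \<open>Partial sums of power series and power bases modulo an ideal\<close>

context ring
begin

text \<open>Two topologies on S are in play. In the one given by the kernels of the projections to
  the finite group rings, S is complete; the closed powers of the augmentation ideal give the
  filtration topology. A closed power need not be open for the first topology when G is not
  topologically finitely generated, so the two have to be kept apart. They are linked by two facts:
  the powers in question are closed, and each kernel contains one of them, because a p-group acting
  on a nonzero finite module of exponent p fixes a nonzero vector. Limits are formed with the
  kernels and then located inside closed powers.

  The exponent m is a power of p because \<open>s [^] m\<close> equals g^m - 1 by Frobenius. That g
  has order exactly p^n in a quotient that kills N is what the quotient Z_p provides, for every n.

  The homeomorphism hinges on extracting coefficients from an element of a closed power.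
  Multiplication mixes coefficients through \<delta>, and reading a coefficient of higher index
  loses degree; the two effects balance, since the power of \<delta> that occurs gains as many
  degrees as the index difference costs.\<close>

definition psum :: "'a \<Rightarrow> (nat \<Rightarrow> 'a) \<Rightarrow> nat \<Rightarrow> 'a" where
  "psum t a m = (\<Oplus>i\<in>{..<m}. t [^] i \<otimes> a i)"

lemma psum_0 [simp]: "psum t a 0 = \<zero>"
  by (simp add: psum_def)

lemma psum_Suc:
  assumes "t \<in> carrier R" "\<And>i. a i \<in> carrier R"
  shows "psum t a (Suc m) = psum t a m \<oplus> t [^] m \<otimes> a m"
proof -
  have "psum t a (Suc m) = t [^] m \<otimes> a m \<oplus> psum t a m"
    unfolding psum_def lessThan_Suc using assms by (subst finsum_insert) auto
  then show ?thesis
    using assms by (simp add: psum_def a_comm Pi_def)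
qed

lemma psum_closed [simp, intro]:
  assumes "t \<in> carrier R" "\<And>i. a i \<in> carrier R"
  shows "psum t a m \<in> carrier R"
  unfolding psum_def using assms by auto

lemma minus_add_minus:
  assumes "x \<in> carrier R" "y \<in> carrier R" "z \<in> carrier R" "w \<in> carrier R"
  shows "(x \<oplus> y) \<ominus> (z \<oplus> w) = (x \<ominus> z) \<oplus> (y \<ominus> w)"
  using assms by algebra

lemma minus_telescope:
  assumes "x \<in> carrier R" "y \<in> carrier R" "z \<in> carrier R"
  shows "x \<ominus> z = (x \<ominus> y) \<oplus> (y \<ominus> z)"
  using assms by algebra

lemma minus_swap:
  assumes "x \<in> carrier R" "y \<in> carrier R"
  shows "y \<ominus> x = \<ominus> (x \<ominus> y)"
  using assms by algebra

lemma minus_diff: 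
  assumes "x \<in> carrier R" "y \<in> carrier R" "z \<in> carrier R" "w \<in> carrier R"
  shows "(x \<ominus> y) \<ominus> (z \<ominus> w) = (x \<ominus> z) \<ominus> (y \<ominus> w)"
  using assms by algebra

lemma additive_subgroup_minus_trans:
  assumes "additive_subgroup K R" "x \<in> carrier R" "y \<in> carrier R" "z \<in> carrier R" "x \<ominus> y \<in> K" "y \<ominus> z \<in> K"
  shows "x \<ominus> z \<in> K"
  using assms minus_telescope[of x y z] additive_subgroup.a_closed by metis

lemma additive_subgroup_minus_sym:
  assumes "additive_subgroup K R" "x \<in> carrier R" "y \<in> carrier R" "x \<ominus> y \<in> K"
  shows "y \<ominus> x \<in> K"
  using assms minus_swap[of x y] additive_subgroup.a_inv_closed[OF assms(1)] by metis

lemma additive_subgroup_minus_closed: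
  assumes "additive_subgroup K R" "x \<in> K" "y \<in> K"
  shows "x \<ominus> y \<in> K"
  unfolding a_minus_def using assms
  by (simp add: additive_subgroup.a_closed additive_subgroup.a_inv_closed)

lemma additive_subgroup_minus_iff:
  assumes "additive_subgroup K R" "x \<in> carrier R" "y \<in> carrier R" "x \<ominus> y \<in> K"
  shows "x \<in> K \<longleftrightarrow> y \<in> K"
proof -
  have "x = (x \<ominus> y) \<oplus> y" "y = (y \<ominus> x) \<oplus> x" using assms(2,3) by algebra+
  then show ?thesis
    using assms additive_subgroup_minus_sym additive_subgroup.a_closed by metis
qed

lemma minus_self [simp]: "x \<in> carrier R \<Longrightarrow> x \<ominus> x = \<zero>"
  by (simp add: a_minus_def r_neg)

lemma minus_zero_right [simp]: "x \<in> carrier R \<Longrightarrow> x \<ominus> \<zero> = x"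
  by (simp add: a_minus_def)

section \<open>Powers of an ideal\<close>

lemma ideal_power_0: "I [^]\<^bsub>ideals_set R\<^esub> (0::nat) = carrier R"
  and ideal_power_Suc: "I [^]\<^bsub>ideals_set R\<^esub> Suc k = (I [^]\<^bsub>ideals_set R\<^esub> k) \<cdot> I"
  by (simp_all add: nat_pow_def ideals_set_def)

lemma ideal_power_ideal: "ideal I R \<Longrightarrow> ideal (I [^]\<^bsub>ideals_set R\<^esub> (k::nat)) R"
proof (induction k)
  case 0
  show ?case unfolding ideal_power_0 by (rule oneideal)
next
  case (Suc k)
  then show ?case unfolding ideal_power_Suc by (intro ideal_prod_is_ideal)
qed

text \<open>Powers are built by multiplying with \<open>I\<close> on the right, whereas the
  nilpotency argument for the augmentation ideal has to split off a factor on the left.\<close>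

lemma ideal_power_Suc2:
  assumes I: "ideal I R"
  shows "I [^]\<^bsub>ideals_set R\<^esub> Suc k \<subseteq> I \<cdot> (I [^]\<^bsub>ideals_set R\<^esub> k)"
proof (induction k)
  case 0
  have "I [^]\<^bsub>ideals_set R\<^esub> Suc 0 \<subseteq> I"
    unfolding ideal_power_Suc ideal_power_0 using ideal_prod_inter[OF oneideal I] by blast
  also have "I = I \<cdot> carrier R" using ideal_prod_one[OF I] by simp
  finally show ?case unfolding ideal_power_0 .
next
  case (Suc k)
  have "x \<in> I \<cdot> (I [^]\<^bsub>ideals_set R\<^esub> Suc k)" if "x \<in> (I [^]\<^bsub>ideals_set R\<^esub> Suc k) \<cdot> I" for x
    using that
  proof (induction x rule: ideal_prod.induct)
    case (prod i j)
    then have "i \<otimes> j \<in> (I \<cdot> (I [^]\<^bsub>ideals_set R\<^esub> k)) \<cdot> I" using Suc by (intro ideal_prod.prod) auto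
    then show ?case
      unfolding ideal_power_Suc ideal_prod_assoc[OF I ideal_power_ideal[OF I] I] .
  qed (rule ideal_prod.sum)
  then show ?case unfolding ideal_power_Suc[of I "Suc k"] by blast
qed

section \<open>Arithmetic of the partial sums\<close>

lemma psum_add:
  assumes "t \<in> carrier R" "\<And>i. a i \<in> carrier R" "\<And>i. b i \<in> carrier R"
  shows "psum t (\<lambda>i. a i \<oplus> b i) m = psum t a m \<oplus> psum t b m"
proof (induction m)
  case (Suc m)
  have "psum t a m \<in> carrier R" "psum t b m \<in> carrier R" "t [^] m \<in> carrier R"
    using assms by auto
  then show ?case
    using Suc assms by (simp add: psum_Suc r_distr a_ac)
qed simp

lemma psum_minus:
  assumes "t \<in> carrier R" "\<And>i. a i \<in> carrier R" "\<And>i. b i \<in> carrier R"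
  shows "psum t (\<lambda>i. a i \<ominus> b i) m = psum t a m \<ominus> psum t b m"
proof (induction m)
  case (Suc m)
  have *: "psum t a m \<in> carrier R" "psum t b m \<in> carrier R" "t [^] m \<in> carrier R"
    using assms by auto
  have "t [^] m \<otimes> (a m \<ominus> b m) = t [^] m \<otimes> a m \<ominus> t [^] m \<otimes> b m"
    using * assms by (simp add: a_minus_def r_distr r_minus)
  then show ?case
    using Suc assms * by (simp add: psum_Suc minus_add_minus)
qed (simp add: a_minus_def)

lemma psum_r_mult:
  assumes "t \<in> carrier R" "\<And>i. a i \<in> carrier R" "r \<in> carrier R"
  shows "psum t (\<lambda>i. a i \<otimes> r) m = psum t a m \<otimes> r"
proof (induction m)
  case (Suc m)
  have "psum t a m \<in> carrier R" "t [^] m \<in> carrier R"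
    using assms by auto
  then show ?case
    using Suc assms by (simp add: psum_Suc l_distr m_assoc)
qed (use assms in simp)

text \<open>Coefficients stand to the right of the powers, so a factor \<open>t\<close> on the left
  only raises the degree; \<open>case_nat r a\<close> is the shifted sequence with \<open>r\<close>
  as the freed constant term.\<close>

lemma psum_shift:
  assumes "t \<in> carrier R" "\<And>i. a i \<in> carrier R" and that: "r \<in> carrier R"
  shows "psum t (case_nat r a) (Suc m) = t \<otimes> psum t a m \<oplus> r"
proof (induction m)
  case 0
  have *: "case_nat r a i \<in> carrier R" for i
    using assms that by (cases i) auto
  show ?case using that assms * by (simp add: psum_Suc)
next
  case (Suc m)
  have *: "case_nat r a i \<in> carrier R" for i
    using assms that by (cases i) auto
  have c: "psum t a m \<in> carrier R" "t [^] m \<in> carrier R" "t [^] Suc m = t \<otimes> t [^] m"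
    using assms nat_pow_Suc2[of t m] by auto
  have "psum t (case_nat r a) (Suc (Suc m)) = t \<otimes> psum t a m \<oplus> r \<oplus> t \<otimes> t [^] m \<otimes> a m"
    using Suc assms * c by (simp add: psum_Suc[of _ _ "Suc m"] del: nat_pow_Suc)
  also have "\<dots> = t \<otimes> (psum t a m \<oplus> t [^] m \<otimes> a m) \<oplus> r"
    using c(1,2) assms that by (simp add: r_distr m_assoc a_ac)
  finally show ?case using assms by (simp add: psum_Suc)
qed

lemma psum_in_ideal:
  assumes "ideal L R" "t \<in> carrier R" "\<And>i. a i \<in> carrier R" "\<And>i. i < m \<Longrightarrow> t [^] i \<otimes> a i \<in> L"
  shows "psum t a m \<in> L"
  using assms(4)
proof (induction m)
  case 0
  then show ?case using additive_subgroup.zero_closed[OF ideal.axioms(1)[OF assms(1)]] by simp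
next
  case (Suc m)
  then show ?case
    using assms(2,3) additive_subgroup.a_closed[OF ideal.axioms(1)[OF assms(1)]] by (simp add: psum_Suc)
qed

lemma psum_cong:
  assumes "\<And>i. i < m \<Longrightarrow> a i = b i" "t \<in> carrier R" "\<And>i. a i \<in> carrier R" "\<And>i. b i \<in> carrier R"
  shows "psum t a m = psum t b m"
  using assms(1) by (induction m) (auto simp: psum_Suc assms)

lemma psum_truncate:
  assumes t: "t \<in> carrier R" and d: "\<And>i. d i \<in> carrier R" and "k \<le> n"
  shows "psum t (\<lambda>i. if i < k then d i else \<zero>) n = psum t d k"
  using \<open>k \<le> n\<close>
proof (induction n rule: dec_induct)
  case base show ?case using t d by (intro psum_cong) auto
next
  case (step n)
  then show ?case using t d by (simp add: psum_Suc)
qed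

text \<open>The two clauses are spanning and independence: for an ideal \<open>L\<close>, the powers
  of \<open>t\<close> below \<open>m\<close> form a basis of the quotient by \<open>L\<close> as a
  right module over \<open>A / (A \<inter> L)\<close>. Coefficient sequences are total functions;
  only their values below \<open>m\<close> matter.\<close>

definition power_basis_mod :: "'a set \<Rightarrow> 'a set \<Rightarrow> 'a \<Rightarrow> nat \<Rightarrow> bool" where
  "power_basis_mod A L t m \<longleftrightarrow>
     (\<forall>x\<in>carrier R. \<exists>a. (\<forall>i. a i \<in> A) \<and> x \<ominus> psum t a m \<in> L) \<and>
     (\<forall>a. (\<forall>i. a i \<in> A) \<and> psum t a m \<in> L \<longrightarrow> (\<forall>i<m. a i \<in> L))"

text \<open>Passing from \<open>t\<close> to \<open>t + c\<close> is a unitriangular change of basis.\<close>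

lemma psum_translate:
  assumes A: "subring A R" and t: "t \<in> carrier R" and c: "c \<in> carrier R" "\<And>r. r \<in> A \<Longrightarrow> c \<otimes> r \<in> A"
    and ct: "c \<otimes> t = t \<otimes> c" and a: "\<And>i. a i \<in> A"
  shows "\<exists>b. (\<forall>i. b i \<in> A) \<and> psum (t \<oplus> c) a m = psum t b m \<and> (\<forall>i\<ge>m - 1. b i = a i)"
proof -
  note AE = subringE[OF A]
  have AR: "x \<in> A \<Longrightarrow> x \<in> carrier R" for x using AE(1) by blast
  have cpow: "c \<otimes> t [^] (i::nat) = t [^] i \<otimes> c" for i
  proof (induction i)
    case (Suc i)
    have "c \<otimes> t [^] Suc i = (c \<otimes> t [^] i) \<otimes> t" using t c(1) by (simp add: m_assoc)
    also have "\<dots> = t [^] i \<otimes> (t \<otimes> c)" unfolding Suc using t c(1) ct by (simp add: m_assoc)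
    finally show ?case using t c(1) by (simp add: m_assoc)
  qed (use c in simp)
  have psum_in: "\<exists>b. (\<forall>i. b i \<in> A) \<and> c \<otimes> psum t d k = psum t b k" if d: "\<And>i. d i \<in> A" for d k
  proof (intro exI conjI)
    show "\<forall>i. c \<otimes> d i \<in> A" using c d by blast
    show "c \<otimes> psum t d k = psum t (\<lambda>i. c \<otimes> d i) k"
    proof (induction k)
      case 0 then show ?case using c by simp
    next
      case (Suc k)
      have "psum t d k \<in> carrier R" "t [^] k \<in> carrier R" "d k \<in> carrier R"
        using t AR[OF d] by auto
      moreover from this have "c \<otimes> (t [^] k \<otimes> d k) = t [^] k \<otimes> (c \<otimes> d k)"
        using c cpow[of k] by (simp flip: m_assoc)
      ultimately show ?case using Suc c t AR[OF d] by (simp add: psum_Suc r_distr)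
    qed
  qed
  have add_in: "\<exists>b. (\<forall>i. b i \<in> A) \<and> psum t d k \<oplus> psum t e l = psum t b (max k l)" 
    if d: "\<And>i. d i \<in> A" and e: "\<And>i. e i \<in> A" for d e k l
  proof -
    let ?d = "\<lambda>i. if i < k then d i else \<zero>" and ?e = "\<lambda>i. if i < l then e i else \<zero>"
    have "psum t d k = psum t ?d (max k l)" using psum_truncate[of t d k "max k l", OF t AR[OF d]] by simp
    moreover have "psum t e l = psum t ?e (max k l)" using psum_truncate[of t e l "max k l", OF t AR[OF e]] by simp
    moreover have "psum t (\<lambda>i. ?d i \<oplus> ?e i) (max k l) = psum t ?d (max k l) \<oplus> psum t ?e (max k l)"
      using t AR[OF d] AR[OF e] by (intro psum_add) auto
    moreover have "?d i \<oplus> ?e i \<in> A" for i using AE(2,7) d e by auto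
    ultimately show ?thesis by (intro exI[of _ "\<lambda>i. ?d i \<oplus> ?e i"]) auto
  qed
  \<comment> \<open>The unitriangular shape: the leading term of
    \<open>(t \<oplus> c) [^] k \<otimes> r\<close> is \<open>t [^] k \<otimes> r\<close>, and
    everything else has degree below \<open>k\<close> with coefficients still in
    \<open>A\<close>.\<close>
  have pow: "\<exists>d. (\<forall>i. d i \<in> A) \<and> (t \<oplus> c) [^] k \<otimes> r = t [^] k \<otimes> r \<oplus> psum t d k" if r: "r \<in> A" for k r
  proof (induction k)
    case 0
    then show ?case using AR[OF r] AE(2) by (intro exI[of _ "\<lambda>_. \<zero>"]) auto
  next
    case (Suc k)
    then obtain d where d: "\<And>i. d i \<in> A" and eq: "(t \<oplus> c) [^] k \<otimes> r = t [^] k \<otimes> r \<oplus> psum t d k" by blast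
    have cl: "psum t d k \<in> carrier R" "t [^] k \<in> carrier R" "r \<in> carrier R" "(t \<oplus> c) [^] k \<in> carrier R"
      using t c AR[OF d] AR[OF r] by auto
    have "(t \<oplus> c) [^] Suc k \<otimes> r = (t \<oplus> c) \<otimes> ((t \<oplus> c) [^] k \<otimes> r)"
      using t c cl nat_pow_Suc2[of "t \<oplus> c" k] by (simp add: m_assoc del: nat_pow_Suc)
    also have "\<dots> = t \<otimes> t [^] k \<otimes> r \<oplus> (t \<otimes> psum t d k \<oplus> \<zero>) \<oplus> (c \<otimes> t [^] k \<otimes> r) \<oplus> c \<otimes> psum t d k"
      unfolding eq using t c cl by (simp add: l_distr r_distr a_ac m_assoc)
    also have "t \<otimes> psum t d k \<oplus> \<zero> = psum t (case_nat \<zero> d) (Suc k)"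
      using psum_shift[OF t AR[OF d]] by simp
    also have "c \<otimes> t [^] k \<otimes> r = t [^] k \<otimes> (c \<otimes> r)"
      using cpow[of k] c cl by (simp add: m_assoc)
    also have "t \<otimes> t [^] k = t [^] Suc k" using t nat_pow_Suc2[of t k] by (simp del: nat_pow_Suc)
    finally have 1: "(t \<oplus> c) [^] Suc k \<otimes> r = t [^] Suc k \<otimes> r \<oplus> psum t (case_nat \<zero> d) (Suc k) \<oplus> t [^] k \<otimes> (c \<otimes> r) \<oplus> c \<otimes> psum t d k" .
    obtain e where e: "\<And>i. e i \<in> A" "c \<otimes> psum t d k = psum t e k" using psum_in[of d k, OF d] by blast
    have 2: "t [^] k \<otimes> (c \<otimes> r) \<oplus> c \<otimes> psum t d k = psum t (e(k := c \<otimes> r)) (Suc k)"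
    proof -
      have "(e(k := c \<otimes> r)) i \<in> carrier R" for i using AR[OF e(1)] c cl by auto
      moreover have "psum t (e(k := c \<otimes> r)) k = psum t e k"
        using t AR[OF e(1)] cl c by (intro psum_cong) auto
      moreover have "psum t e k \<in> carrier R" using t AR[OF e(1)] by auto
      ultimately show ?thesis using e(2) t c cl by (simp add: psum_Suc a_comm)
    qed
    have eA: "(e(k := c \<otimes> r)) i \<in> A" for i using e c r by auto
    have cd: "case_nat \<zero> d i \<in> A" for i using d AE(2) by (cases i) auto
    obtain f where f: "\<And>i. f i \<in> A" 
        "psum t (case_nat \<zero> d) (Suc k) \<oplus> (t [^] k \<otimes> (c \<otimes> r) \<oplus> c \<otimes> psum t d k) = psum t f (Suc k)"
      using add_in[of "case_nat \<zero> d" "e(k := c \<otimes> r)" "Suc k" "Suc k", OF cd eA] unfolding 2 max.idem by blast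
    have "psum t (case_nat \<zero> d) (Suc k) \<in> carrier R" "t [^] Suc k \<in> carrier R"
      using t AR[OF cd] by auto
    moreover have assoc4: "w \<oplus> x \<oplus> y \<oplus> z = w \<oplus> (x \<oplus> (y \<oplus> z))"
      if "w \<in> carrier R" "x \<in> carrier R" "y \<in> carrier R" "z \<in> carrier R" for w x y z
      using that by (simp add: a_assoc)
    ultimately have "t [^] Suc k \<otimes> r \<oplus> psum t (case_nat \<zero> d) (Suc k) \<oplus> t [^] k \<otimes> (c \<otimes> r) \<oplus> c \<otimes> psum t d k =
        t [^] Suc k \<otimes> r \<oplus> (psum t (case_nat \<zero> d) (Suc k) \<oplus> (t [^] k \<otimes> (c \<otimes> r) \<oplus> c \<otimes> psum t d k))"
      using cl(1-3) c(1) by (intro assoc4) blast+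
    with 1 f(2) have "(t \<oplus> c) [^] Suc k \<otimes> r = t [^] Suc k \<otimes> r \<oplus> psum t f (Suc k)"
      by (metis (no_types))
    then show ?case using f(1) by blast
  qed
  show ?thesis
  proof (induction m)
    case 0
    then show ?case using a by auto
  next
    case (Suc m)
    then obtain b where b: "\<And>i. b i \<in> A" "psum (t \<oplus> c) a m = psum t b m" by blast
    obtain d where d: "\<And>i. d i \<in> A" and eq: "(t \<oplus> c) [^] m \<otimes> a m = t [^] m \<otimes> a m \<oplus> psum t d m"
      using pow[OF a] by blast
    obtain e where e: "\<And>i. e i \<in> A" "psum t b m \<oplus> psum t d m = psum t e m"
      using add_in[of b d m m, OF b(1) d] by auto
    \<comment> \<open>Only coefficients below \<open>m\<close> are altered. From the leading one on,
      \<open>?e\<close> agrees with \<open>a\<close>, and this is what the proof of independence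
      will use.\<close>
    let ?e = "\<lambda>i. if i < m then e i else a i"
    have cl: "psum t b m \<in> carrier R" "psum t d m \<in> carrier R" "t [^] m \<otimes> a m \<in> carrier R"
      using t AR[OF a] AR[OF b(1)] AR[OF d] by auto
    have "psum (t \<oplus> c) a (Suc m) = psum t b m \<oplus> (t [^] m \<otimes> a m \<oplus> psum t d m)"
      using t c AR[OF a] by (simp add: psum_Suc b eq)
    also have "\<dots> = psum t e m \<oplus> t [^] m \<otimes> a m"
      using cl by (simp add: e(2)[symmetric] a_ac)
    also have "psum t e m = psum t ?e m" using t AR[OF a] AR[OF e(1)] by (intro psum_cong) auto
    also have "psum t ?e m \<oplus> t [^] m \<otimes> a m = psum t ?e (Suc m)"
      using t AR[OF a] AR[OF e(1)] by (simp add: psum_Suc)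
    finally have "psum (t \<oplus> c) a (Suc m) = psum t ?e (Suc m)" .
    then show ?case using e a by (intro exI[of _ ?e]) auto
  qed
qed

text \<open>Spanning: a sum in \<open>t\<close> becomes a sum in \<open>t \<oplus> c\<close> by
  translating back through \<open>\<ominus> c\<close>, hence the hypothesis for both signs.
  Independence: translation keeps the leading coefficient, which therefore lies in \<open>L\<close>;
  its term can be removed and the argument descends to shorter sums.\<close>

lemma power_basis_mod_translate:
  assumes A: "subring A R" and L: "ideal L R" and t: "t \<in> carrier R" and c: "c \<in> carrier R" "\<And>r. r \<in> A \<Longrightarrow> c \<otimes> r \<in> A"
    and c': "\<And>r. r \<in> A \<Longrightarrow> \<ominus> c \<otimes> r \<in> A"
    and ct: "c \<otimes> t = t \<otimes> c" and pb: "power_basis_mod A L t m"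
  shows "power_basis_mod A L (t \<oplus> c) m"
  unfolding power_basis_mod_def
proof (intro conjI ballI allI impI)
  note AE = subringE[OF A]
  have AR: "x \<in> A \<Longrightarrow> x \<in> carrier R" for x using AE(1) by blast
  have tcc: "(t \<oplus> c) \<oplus> \<ominus> c = t" using t c by algebra
  fix x assume "x \<in> carrier R"
  then obtain a where a: "\<And>i. a i \<in> A" "x \<ominus> psum t a m \<in> L"
    using pb unfolding power_basis_mod_def by meson
  have "\<ominus> c \<otimes> (t \<oplus> c) = (t \<oplus> c) \<otimes> (\<ominus> c)"
    using t c ct by (simp add: l_distr r_distr l_minus r_minus minus_add)
  with psum_translate[of A "t \<oplus> c" "\<ominus> c" a m, OF A _ _ c' _ a(1)] obtain b where
    "\<forall>i. b i \<in> A" "psum t a m = psum (t \<oplus> c) b m" using t c tcc by auto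
  then show "\<exists>b. (\<forall>i. b i \<in> A) \<and> x \<ominus> psum (t \<oplus> c) b m \<in> L" using a(2) by auto
next
  note AE = subringE[OF A]
  have AR: "x \<in> A \<Longrightarrow> x \<in> carrier R" for x using AE(1) by blast
  fix a i assume a: "(\<forall>i. a i \<in> A) \<and> psum (t \<oplus> c) a m \<in> L" and "i < m"
  have "psum (t \<oplus> c) a k \<in> L \<Longrightarrow> k \<le> m \<Longrightarrow> i < k \<Longrightarrow> a i \<in> L" for k
  proof (induction k)
    case 0
    then show ?case by simp
  next
    case (Suc k)
    obtain b where b: "\<And>i. b i \<in> A" "psum (t \<oplus> c) a (Suc k) = psum t b (Suc k)" "b k = a k"
      using psum_translate[OF A t c ct, of a "Suc k"] a by auto
    \<comment> \<open>The basis property speaks of sums of length \<open>m\<close> only, so the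
      shorter sum is padded with zeros.\<close>
    let ?b = "\<lambda>i. if i < Suc k then b i else \<zero>"
    have bR: "?b i \<in> carrier R" for i using AR[OF b(1)] by auto
    have "psum t ?b m \<in> L"
      using psum_truncate[of t b "Suc k" m, OF t AR[OF b(1)]] Suc.prems b(2) by simp
    moreover have "?b i \<in> A" for i using b AE(2) by auto
    ultimately have "\<forall>i<m. ?b i \<in> L"
      by (intro pb[unfolded power_basis_mod_def, THEN conjunct2, THEN spec, of ?b, THEN mp] conjI allI)
    then have "?b k \<in> L" using Suc.prems(2) by (simp only: Suc_le_eq)
    then have ak: "a k \<in> L" using b(3) by simp
    then have akL: "(t \<oplus> c) [^] k \<otimes> a k \<in> L" using L t c by (simp add: ideal.I_l_closed)
    have P: "psum (t \<oplus> c) a k \<in> carrier R" "(t \<oplus> c) [^] k \<otimes> a k \<in> carrier R"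
      using t c a AR by auto
    have "psum (t \<oplus> c) a (Suc k) = psum (t \<oplus> c) a k \<oplus> (t \<oplus> c) [^] k \<otimes> a k"
      using t c a AR by (simp add: psum_Suc)
    then have "psum (t \<oplus> c) a k = psum (t \<oplus> c) a (Suc k) \<oplus> \<ominus> ((t \<oplus> c) [^] k \<otimes> a k)"
      using P by (simp add: a_assoc r_neg)
    also have "\<dots> \<in> L" using Suc.prems(1) akL L
      by (intro additive_subgroup.a_closed additive_subgroup.a_inv_closed ideal.axioms(1))
    finally have "psum (t \<oplus> c) a k \<in> L" .
    then show ?case using Suc.IH Suc.prems(2,3) ak by (metis Suc_leD less_antisym)
  qed
  then show "a i \<in> L" using a \<open>i < m\<close> by blast
qed

end

section \<open>Linearly topologised rings\<close>

text \<open>The conditions say that \<open>S\<close> is the inverse limit of its quotients by the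
  ideals in \<open>\<K>\<close>. Completeness is phrased through families of representatives, one
  for each ideal and compatible along inclusions, instead of through filters.\<close>

locale linear_topological_ring = ring S for S (structure) +
  fixes \<K> :: "'a set set"
  assumes nbhd_ideal: "K \<in> \<K> \<Longrightarrow> ideal K S"
    and nbhd_directed: "\<lbrakk>K \<in> \<K>; L \<in> \<K>\<rbrakk> \<Longrightarrow> \<exists>M\<in>\<K>. M \<subseteq> K \<inter> L"
    and separated: "\<lbrakk>x \<in> carrier S; \<And>K. K \<in> \<K> \<Longrightarrow> x \<in> K\<rbrakk> \<Longrightarrow> x = \<zero>"
    and complete: "\<lbrakk>\<And>K. K \<in> \<K> \<Longrightarrow> f K \<in> carrier S;
        \<And>K L. \<lbrakk>K \<in> \<K>; L \<in> \<K>; K \<subseteq> L\<rbrakk> \<Longrightarrow> f K \<ominus> f L \<in> L\<rbrakk> \<Longrightarrow>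
        \<exists>y\<in>carrier S. \<forall>K\<in>\<K>. y \<ominus> f K \<in> K"
begin

text \<open>The intersection of all \<open>A + K\<close>, which is the closure of \<open>A\<close>
  in the linear topology; for the completed group ring \<open>closure_of_eq_cl\<close> identifies it
  with the topological closure.\<close>

definition cl :: "'a set \<Rightarrow> 'a set" where
  "cl A = {x \<in> carrier S. \<forall>K\<in>\<K>. \<exists>a\<in>A. x \<ominus> a \<in> K}"

lemma additive_nbhd: "K \<in> \<K> \<Longrightarrow> additive_subgroup K S"
  using nbhd_ideal ideal.axioms(1) by blast

lemma nbhd_eqI:
  assumes "x \<in> carrier S" "y \<in> carrier S" "\<And>K. K \<in> \<K> \<Longrightarrow> x \<ominus> y \<in> K"
  shows "x = y"
  using separated[of "x \<ominus> y"] assms r_right_minus_eq by auto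

lemma zero_in_nbhd: "K \<in> \<K> \<Longrightarrow> \<zero> \<in> K"
  using additive_nbhd additive_subgroup.zero_closed by blast

lemma nbhd_subset: "K \<in> \<K> \<Longrightarrow> K \<subseteq> carrier S"
  using additive_nbhd additive_subgroup.a_subset by blast

lemma cl_carrier: "cl A \<subseteq> carrier S"
  by (auto simp: cl_def)

lemma cl_increasing: "A \<subseteq> carrier S \<Longrightarrow> A \<subseteq> cl A"
  unfolding cl_def by (auto simp: zero_in_nbhd intro!: bexI)

lemma cl_mono: "A \<subseteq> B \<Longrightarrow> cl A \<subseteq> cl B"
  unfolding cl_def by blast

lemma cl_cl: assumes "A \<subseteq> carrier S" shows "cl (cl A) = cl A"
proof (rule antisym)
  show "cl (cl A) \<subseteq> cl A"
  proof
    fix x assume x: "x \<in> cl (cl A)"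
    have "\<exists>a\<in>A. x \<ominus> a \<in> K" if K: "K \<in> \<K>" for K
    proof -
      obtain b where b: "b \<in> cl A" "x \<ominus> b \<in> K" using x K unfolding cl_def by blast
      obtain a where a: "a \<in> A" "b \<ominus> a \<in> K" using b(1) K unfolding cl_def by blast
      have "x \<ominus> a \<in> K"
        using additive_subgroup_minus_trans[OF additive_nbhd[OF K] _ _ _ b(2) a(2)] x b a assms cl_carrier by blast
      then show ?thesis using a by blast
    qed
    then show "x \<in> cl A" using x unfolding cl_def by blast
  qed
qed (use cl_increasing cl_carrier in blast)

lemma cl_nbhd: assumes "K \<in> \<K>" "A \<subseteq> K" shows "cl A \<subseteq> K"
proof
  fix x assume "x \<in> cl A"
  then obtain a where "a \<in> A" "x \<ominus> a \<in> K" "x \<in> carrier S" using assms unfolding cl_def by blast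
  then show "x \<in> K" using assms additive_subgroup_minus_iff[OF additive_nbhd] nbhd_subset by blast
qed

lemma cl_ideal: assumes A: "ideal A S" shows "ideal (cl A) S"
proof (rule idealI[OF ring_axioms])
  have AS: "A \<subseteq> carrier S" using ideal.Icarr[OF A] by blast
  have aA: "additive_subgroup A S" using A ideal.axioms(1) by blast
  show "subgroup (cl A) (add_monoid S)"
  proof (rule add.subgroupI)
    show "cl A \<subseteq> carrier S" by (rule cl_carrier)
    show "cl A \<noteq> {}" using cl_increasing[OF AS] additive_subgroup.zero_closed[OF aA] by blast
    fix x assume x: "x \<in> cl A"
    show "\<ominus> x \<in> cl A" unfolding cl_def
    proof (intro CollectI conjI ballI)
      show "\<ominus> x \<in> carrier S" using x cl_carrier by auto
      fix K assume K: "K \<in> \<K>"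
      then obtain a where a: "a \<in> A" "x \<ominus> a \<in> K" using x unfolding cl_def by blast
      have "\<ominus> x \<ominus> \<ominus> a = \<ominus> (x \<ominus> a)" using x cl_carrier a AS by (simp add: a_minus_def minus_add subset_eq)
      then show "\<exists>a\<in>A. \<ominus> x \<ominus> a \<in> K"
        using a additive_subgroup.a_inv_closed[OF aA]
          additive_subgroup.a_inv_closed[OF additive_nbhd[OF K]] by metis
    qed
    fix y assume y: "y \<in> cl A"
    show "x \<oplus> y \<in> cl A" unfolding cl_def
    proof (intro CollectI conjI ballI)
      show "x \<oplus> y \<in> carrier S" using x y cl_carrier by blast
      fix K assume K: "K \<in> \<K>"
      then obtain a b where a: "a \<in> A" "x \<ominus> a \<in> K" and b: "b \<in> A" "y \<ominus> b \<in> K"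
        using x y unfolding cl_def by blast
      have "(x \<oplus> y) \<ominus> (a \<oplus> b) = (x \<ominus> a) \<oplus> (y \<ominus> b)"
        using x y cl_carrier a b AS by (intro minus_add_minus) auto
      then show "\<exists>a\<in>A. (x \<oplus> y) \<ominus> a \<in> K"
        using a b additive_subgroup.a_closed[OF aA] additive_subgroup.a_closed[OF additive_nbhd[OF K]] by metis
    qed
  qed
  fix x y assume x: "x \<in> cl A" and y: "y \<in> carrier S"
  show "y \<otimes> x \<in> cl A" unfolding cl_def
  proof (intro CollectI conjI ballI)
    show "y \<otimes> x \<in> carrier S" using x y cl_carrier by blast
    fix K assume K: "K \<in> \<K>"
    then obtain a where a: "a \<in> A" "x \<ominus> a \<in> K" using x unfolding cl_def by blast
    have "y \<otimes> x \<ominus> y \<otimes> a = y \<otimes> (x \<ominus> a)" using x y cl_carrier a AS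
      by (simp add: a_minus_def r_distr r_minus subset_eq)
    then show "\<exists>a\<in>A. y \<otimes> x \<ominus> a \<in> K"
      using a ideal.I_l_closed[OF A _ y] ideal.I_l_closed[OF nbhd_ideal[OF K] _ y] by metis
  qed
  show "x \<otimes> y \<in> cl A" unfolding cl_def
  proof (intro CollectI conjI ballI)
    show "x \<otimes> y \<in> carrier S" using x y cl_carrier by blast
    fix K assume K: "K \<in> \<K>"
    then obtain a where a: "a \<in> A" "x \<ominus> a \<in> K" using x unfolding cl_def by blast
    have "x \<otimes> y \<ominus> a \<otimes> y = (x \<ominus> a) \<otimes> y" using x y cl_carrier a AS
      by (simp add: a_minus_def l_distr l_minus subset_eq)
    then show "\<exists>a\<in>A. x \<otimes> y \<ominus> a \<in> K"
      using a ideal.I_r_closed[OF A _ y] ideal.I_r_closed[OF nbhd_ideal[OF K] _ y] by metis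
  qed
qed

end

text \<open>Isolates what is used of the completed group ring: \<open>R\<close> stands for the
  completed group ring of the normal subgroup, \<open>I\<close> for the augmentation ideal,
  \<open>h\<close> for the inverse of \<open>g\<close>. The bound \<open>n\<close> in
  \<open>power_basis\<close> forces arbitrarily long bases, so that a coefficient of any given index
  is visible modulo arbitrarily small ideals.\<close>

locale skew_generator = linear_topological_ring +
  fixes R I :: "'a set" and g h :: 'a
  assumes R_subring: "subring R S"
    and R_closed: "cl R \<subseteq> R"
    and I_ideal: "ideal I S"
    and I_nilpotent: "K \<in> \<K> \<Longrightarrow> \<exists>k::nat. I [^]\<^bsub>ideals_set S\<^esub> k \<subseteq> K"
    and g_closed [simp, intro]: "g \<in> carrier S" and h_closed [simp, intro]: "h \<in> carrier S"
    and g_h: "g \<otimes> h = \<one>" and h_g: "h \<otimes> g = \<one>"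
    and conj_R: "r \<in> R \<Longrightarrow> h \<otimes> r \<otimes> g \<in> R" and conj_inv_R: "r \<in> R \<Longrightarrow> g \<otimes> r \<otimes> h \<in> R"
    and g_minus_one: "g \<ominus> \<one> \<in> I"
    and power_basis: "K \<in> \<K> \<Longrightarrow> \<exists>L\<in>\<K>. L \<subseteq> K \<and> (\<exists>m>n. (g \<ominus> \<one>) [^] m \<in> L \<and> power_basis_mod R L (g \<ominus> \<one>) m)"
begin

section \<open>The element \<open>s\<close> and the filtration by closed powers\<close>

definition s :: 'a where "s = g \<ominus> \<one>"

definition Ipow :: "nat \<Rightarrow> 'a set" where "Ipow k = I [^]\<^bsub>ideals_set S\<^esub> k"

definition F :: "nat \<Rightarrow> 'a set" where "F k = cl (Ipow k)"

lemma s_closed [simp, intro]: "s \<in> carrier S"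
  by (simp add: s_def)

lemma Ipow_0: "Ipow 0 = carrier S"
  unfolding Ipow_def by (rule ideal_power_0)

lemma Ipow_Suc: "Ipow (Suc k) = Ipow k \<cdot> I"
  unfolding Ipow_def by (rule ideal_power_Suc)

lemma Ipow_ideal: "ideal (Ipow k) S"
  unfolding Ipow_def by (rule ideal_power_ideal[OF I_ideal])

lemma Ipow_subset: "Ipow k \<subseteq> carrier S"
  using ideal.Icarr[OF Ipow_ideal] by blast

lemma Ipow_Suc_subset: "Ipow (Suc k) \<subseteq> Ipow k"
  using ideal_prod_inter[OF Ipow_ideal I_ideal] Ipow_Suc by auto

lemma Ipow_add: "Ipow (k + l) = Ipow k \<cdot> Ipow l"
proof (induction l)
  case 0
  then show ?case using ideal_prod_one[OF Ipow_ideal] by (simp add: Ipow_0)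
next
  case (Suc l)
  then show ?case using ideal_prod_assoc[OF Ipow_ideal Ipow_ideal I_ideal] by (simp add: Ipow_Suc)
qed

lemma F_ideal: "ideal (F k) S"
  unfolding F_def by (intro cl_ideal Ipow_ideal)

lemma F_additive: "additive_subgroup (F k) S"
  using F_ideal ideal.axioms(1) by blast

lemma F_subset: "F k \<subseteq> carrier S"
  using ideal.Icarr[OF F_ideal] by blast

lemma F_0: "F 0 = carrier S"
  unfolding F_def Ipow_0 using cl_carrier cl_increasing by blast

lemma F_closed: "cl (F k) = F k"
  unfolding F_def by (intro cl_cl Ipow_subset)

lemma F_antimono: "k \<le> l \<Longrightarrow> F l \<subseteq> F k"
  unfolding F_def using lift_Suc_antimono_le[of Ipow k l, OF Ipow_Suc_subset] cl_mono by blast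

text \<open>Some power of \<open>I\<close> lies in \<open>K\<close>, and \<open>K\<close> is closed.
  Hence the filtration topology is at least as fine as the one given by \<open>\<K>\<close>.\<close>

lemma F_small: assumes "K \<in> \<K>" obtains k where "F k \<subseteq> K"
  using I_nilpotent[OF assms] cl_nbhd[OF assms] unfolding F_def Ipow_def by blast

lemma Ipow_1: "I \<subseteq> Ipow 1"
  using ideal_prod.prod[of \<one> "carrier S" _ I S] ideal.Icarr[OF I_ideal] by (fastforce simp: Ipow_Suc Ipow_0)

lemma F_mult: assumes x: "x \<in> F k" and y: "y \<in> F l" shows "x \<otimes> y \<in> F (k + l)"
  unfolding F_def cl_def
proof (intro CollectI conjI ballI)
  show "x \<otimes> y \<in> carrier S" using x y F_subset by blast
  fix K assume K: "K \<in> \<K>"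
  then obtain a b where a: "a \<in> Ipow k" "x \<ominus> a \<in> K" and b: "b \<in> Ipow l" "y \<ominus> b \<in> K"
    using x y unfolding F_def cl_def by blast
  have c: "x \<in> carrier S" "y \<in> carrier S" "a \<in> carrier S" "b \<in> carrier S"
    using x y a b F_subset Ipow_subset by blast+
  then have "x \<otimes> y \<ominus> a \<otimes> b = (x \<ominus> a) \<otimes> y \<oplus> a \<otimes> (y \<ominus> b)"
    using minus_telescope[of "x \<otimes> y" "a \<otimes> y" "a \<otimes> b"]
    by (simp add: a_minus_def l_distr r_distr l_minus r_minus)
  moreover have "(x \<ominus> a) \<otimes> y \<in> K" "a \<otimes> (y \<ominus> b) \<in> K"
    using ideal.I_r_closed[OF nbhd_ideal[OF K] a(2) c(2)] ideal.I_l_closed[OF nbhd_ideal[OF K] b(2) c(3)] .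
  ultimately have "x \<otimes> y \<ominus> a \<otimes> b \<in> K"
    using additive_subgroup.a_closed[OF additive_nbhd[OF K]] by metis
  moreover have "a \<otimes> b \<in> Ipow (k + l)" unfolding Ipow_add using a b by (intro ideal_prod.prod)
  ultimately show "\<exists>a\<in>Ipow (k + l). x \<otimes> y \<ominus> a \<in> K" by blast
qed

lemma s_in_F: "s \<in> F 1"
proof -
  have "s \<in> Ipow 1" using g_minus_one Ipow_1 unfolding s_def by blast
  then show ?thesis using cl_increasing[OF Ipow_subset] unfolding F_def by blast
qed

lemma s_pow_in_F: "s [^] k \<in> F k"
proof (induction k)
  case 0 then show ?case by (simp add: F_0)
next
  case (Suc k) then show ?case using F_mult[OF Suc s_in_F] by simp
qed

section \<open>Expansions in powers of \<open>s\<close> with coefficients in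
  \<open>R\<close>\<close>

lemma R_carrier: "r \<in> R \<Longrightarrow> r \<in> carrier S"
  using subringE(1)[OF R_subring] by blast

lemma R_zero: "\<zero> \<in> R" and R_one: "\<one> \<in> R" and R_add: "x \<in> R \<Longrightarrow> y \<in> R \<Longrightarrow> x \<oplus> y \<in> R"
  and R_mult: "x \<in> R \<Longrightarrow> y \<in> R \<Longrightarrow> x \<otimes> y \<in> R" and R_uminus: "x \<in> R \<Longrightarrow> \<ominus> x \<in> R"
  using subringE[OF R_subring] by auto

lemma R_minus: "x \<in> R \<Longrightarrow> y \<in> R \<Longrightarrow> x \<ominus> y \<in> R"
  unfolding a_minus_def by (intro R_add R_uminus)

text \<open>Convergence is required only for the coarser topology given by \<open>\<K>\<close>;
  \<open>expands_tail\<close> upgrades it to convergence along the filtration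
  \<open>F\<close>.\<close>

definition expands :: "'a \<Rightarrow> (nat \<Rightarrow> 'a) \<Rightarrow> bool" where
  "expands x a \<longleftrightarrow> x \<in> carrier S \<and> (\<forall>i. a i \<in> R) \<and>
     (\<forall>K\<in>\<K>. \<exists>m0. \<forall>m\<ge>m0. x \<ominus> psum s a m \<in> K)"

lemma psum_tail:
  assumes a: "\<And>i. a i \<in> R" and "m \<le> n"
  shows "psum s a n \<ominus> psum s a m \<in> F m"
  using \<open>m \<le> n\<close>
proof (induction n rule: dec_induct)
  case base
  then show ?case using R_carrier[OF a] additive_subgroup.zero_closed[OF F_additive] by simp
next
  case (step n)
  have c: "psum s a n \<in> carrier S" "psum s a m \<in> carrier S" "s [^] n \<otimes> a n \<in> carrier S"
    using R_carrier[OF a] by auto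
  have "s [^] n \<otimes> a n \<in> F m"
    using ideal.I_r_closed[OF F_ideal s_pow_in_F R_carrier[OF a]] F_antimono[OF step(1)] by blast
  moreover have "psum s a (Suc n) \<ominus> psum s a m = (psum s a n \<ominus> psum s a m) \<oplus> s [^] n \<otimes> a n"
  proof -
    have "(x \<oplus> y) \<ominus> z = (x \<ominus> z) \<oplus> y" if "x \<in> carrier S" "y \<in> carrier S" "z \<in> carrier S" for x y z
      using that by algebra
    then show ?thesis using c R_carrier[OF a] by (simp add: psum_Suc)
  qed
  ultimately show ?case using step additive_subgroup.a_closed[OF F_additive] by metis
qed

text \<open>The differences of partial sums beyond index \<open>m\<close> lie in \<open>F m\<close>.
  As \<open>F m\<close> is closed, their limit in the coarser topology lies there as well.\<close>

lemma expands_tail: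
  assumes "expands x a" shows "x \<ominus> psum s a m \<in> F m"
proof -
  have a: "a i \<in> R" for i using assms unfolding expands_def by blast
  have x: "x \<in> carrier S" using assms unfolding expands_def by blast
  have p: "psum s a n \<in> carrier S" for n using R_carrier[OF a] by auto
  have "\<exists>z\<in>F m. (x \<ominus> psum s a m) \<ominus> z \<in> K" if K: "K \<in> \<K>" for K
  proof -
    obtain m0 where m0: "\<And>n. n \<ge> m0 \<Longrightarrow> x \<ominus> psum s a n \<in> K" using assms K unfolding expands_def by blast
    let ?n = "max m m0"
    have "(x \<ominus> psum s a m) \<ominus> (psum s a ?n \<ominus> psum s a m) = x \<ominus> psum s a ?n"
      using minus_diff[OF x p[of m] p[of ?n] p[of m]] x p[of m] p[of ?n] by simp
    moreover have "x \<ominus> psum s a ?n \<in> K" by (rule m0) simp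
    moreover have "psum s a ?n \<ominus> psum s a m \<in> F m" by (rule psum_tail[of a, OF a]) simp
    ultimately show ?thesis by (metis (no_types))
  qed
  then have "x \<ominus> psum s a m \<in> cl (F m)" using x p unfolding cl_def by blast
  then show ?thesis by (simp add: F_closed)
qed

lemma expandsI:
  assumes "x \<in> carrier S" "\<And>i. a i \<in> R" "\<And>m. x \<ominus> psum s a m \<in> F m"
  shows "expands x a"
  unfolding expands_def
proof (intro conjI ballI allI assms)
  fix K assume "K \<in> \<K>"
  then obtain k where "F k \<subseteq> K" using F_small by blast
  then show "\<exists>m0. \<forall>m\<ge>m0. x \<ominus> psum s a m \<in> K"
    using assms(3) F_antimono by (intro exI[of _ k]) blast
qed

lemma expands_exists:
  assumes a: "\<And>i. a i \<in> R" shows "\<exists>x. expands x a"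
proof -
  have p: "psum s a n \<in> carrier S" for n using R_carrier[OF a] by auto
  have "\<forall>K\<in>\<K>. \<exists>k. F k \<subseteq> K" using F_small by blast
  \<comment> \<open>All terms of degree at least \<open>k K\<close> lie in \<open>K\<close>, so the
    partial sum of length \<open>k K\<close> represents the whole series modulo \<open>K\<close>.
    Completeness glues these representatives.\<close>
  then obtain k where k: "\<And>K. K \<in> \<K> \<Longrightarrow> F (k K) \<subseteq> K" by metis
  have "\<exists>y\<in>carrier S. \<forall>K\<in>\<K>. y \<ominus> psum s a (k K) \<in> K"
  proof (rule complete)
    fix K L assume KL: "K \<in> \<K>" "L \<in> \<K>" "K \<subseteq> L"
    let ?n = "max (k K) (k L)"
    have "psum s a ?n \<ominus> psum s a (k K) \<in> L" "psum s a ?n \<ominus> psum s a (k L) \<in> L"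
      using psum_tail[of a "k K" ?n, OF a] psum_tail[of a "k L" ?n, OF a] k KL by auto
    then show "psum s a (k K) \<ominus> psum s a (k L) \<in> L"
      using additive_subgroup_minus_trans[OF additive_nbhd[OF KL(2)] p p p]
        additive_subgroup_minus_sym[OF additive_nbhd[OF KL(2)] p p] by blast
  qed (use p in auto)
  then obtain y where y: "y \<in> carrier S" "\<And>K. K \<in> \<K> \<Longrightarrow> y \<ominus> psum s a (k K) \<in> K" by blast
  have "expands y a" unfolding expands_def
  proof (intro conjI ballI allI a y(1))
    fix K assume K: "K \<in> \<K>"
    have "y \<ominus> psum s a m \<in> K" if "m \<ge> k K" for m
    proof -
      have "psum s a m \<ominus> psum s a (k K) \<in> K" using psum_tail[of a "k K" m, OF a that] k K by blast
      then show ?thesis using additive_subgroup_minus_trans[OF additive_nbhd[OF K] y(1) p p y(2)[OF K]]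
          additive_subgroup_minus_sym[OF additive_nbhd[OF K] p p] by blast
    qed
    then show "\<exists>m0. \<forall>m\<ge>m0. y \<ominus> psum s a m \<in> K" by blast
  qed
  then show ?thesis by blast
qed

lemma expands_unique_value:
  assumes "expands x a" "expands y a" shows "x = y"
proof (rule nbhd_eqI)
  show x: "x \<in> carrier S" and y: "y \<in> carrier S" using assms by (auto simp: expands_def)
  have p: "psum s a n \<in> carrier S" for n using assms R_carrier by (auto simp: expands_def)
  fix K assume K: "K \<in> \<K>"
  then obtain m where "F m \<subseteq> K" using F_small by blast
  then have "x \<ominus> psum s a m \<in> K" "y \<ominus> psum s a m \<in> K" using expands_tail assms by blast+
  then show "x \<ominus> y \<in> K"
    using additive_subgroup_minus_trans[OF additive_nbhd[OF K] x p y]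
      additive_subgroup_minus_sym[OF additive_nbhd[OF K] y p] by blast
qed

lemma expands_add:
  assumes "expands x a" "expands y b" shows "expands (x \<oplus> y) (\<lambda>i. a i \<oplus> b i)"
proof -
  have c: "x \<in> carrier S" "y \<in> carrier S" "\<And>i. a i \<in> R" "\<And>i. b i \<in> R" using assms by (auto simp: expands_def)
  have p: "psum s a m \<in> carrier S" "psum s b m \<in> carrier S" for m using c R_carrier by auto
  show ?thesis
  proof (rule expandsI)
    fix m
    have "(x \<oplus> y) \<ominus> psum s (\<lambda>i. a i \<oplus> b i) m = (x \<ominus> psum s a m) \<oplus> (y \<ominus> psum s b m)"
      using c p R_carrier by (simp add: psum_add minus_add_minus)
    also have "\<dots> \<in> F m"
      using assms by (intro additive_subgroup.a_closed[OF F_additive] expands_tail)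
    finally show "(x \<oplus> y) \<ominus> psum s (\<lambda>i. a i \<oplus> b i) m \<in> F m" .
  qed (use c in \<open>auto intro: R_add\<close>)
qed

lemma expands_minus:
  assumes "expands x a" "expands y b" shows "expands (x \<ominus> y) (\<lambda>i. a i \<ominus> b i)"
proof -
  have c: "x \<in> carrier S" "y \<in> carrier S" "\<And>i. a i \<in> R" "\<And>i. b i \<in> R" using assms by (auto simp: expands_def)
  have p: "psum s a m \<in> carrier S" "psum s b m \<in> carrier S" for m using c R_carrier by auto
  show ?thesis
  proof (rule expandsI)
    fix m
    have "(x \<ominus> y) \<ominus> psum s (\<lambda>i. a i \<ominus> b i) m = (x \<ominus> psum s a m) \<ominus> (y \<ominus> psum s b m)"
      using c p[of m] R_carrier minus_diff[of x y "psum s a m" "psum s b m"] by (simp add: psum_minus)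
    also have "\<dots> \<in> F m"
      using assms by (intro additive_subgroup_minus_closed[OF F_additive] expands_tail)
    finally show "(x \<ominus> y) \<ominus> psum s (\<lambda>i. a i \<ominus> b i) m \<in> F m" .
  qed (use c in \<open>auto intro: R_minus\<close>)
qed

lemma expands_r_mult:
  assumes "expands x a" "r \<in> R" shows "expands (x \<otimes> r) (\<lambda>i. a i \<otimes> r)"
proof -
  have c: "x \<in> carrier S" "\<And>i. a i \<in> R" using assms by (auto simp: expands_def)
  have p: "psum s a m \<in> carrier S" for m using c R_carrier by auto
  show ?thesis
  proof (rule expandsI)
    fix m
    have "x \<otimes> r \<ominus> psum s (\<lambda>i. a i \<otimes> r) m = (x \<ominus> psum s a m) \<otimes> r"
      using c p R_carrier[OF assms(2)] R_carrier by (simp add: psum_r_mult a_minus_def l_distr l_minus)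
    also have "\<dots> \<in> F m"
      by (intro ideal.I_r_closed[OF F_ideal] expands_tail assms R_carrier)
    finally show "x \<otimes> r \<ominus> psum s (\<lambda>i. a i \<otimes> r) m \<in> F m" .
  qed (use c R_carrier[OF assms(2)] assms in \<open>auto intro: R_mult\<close>)
qed

lemma expands_shift:
  assumes "expands x a" "r \<in> R" shows "expands (s \<otimes> x \<oplus> r) (case_nat r a)"
proof -
  have c: "x \<in> carrier S" "\<And>i. a i \<in> R" "r \<in> carrier S" using assms R_carrier by (auto simp: expands_def)
  have p: "psum s a m \<in> carrier S" for m using c R_carrier by auto
  show ?thesis
  proof (rule expandsI)
    show "s \<otimes> x \<oplus> r \<in> carrier S" using c by auto
    show "case_nat r a i \<in> R" for i using c(2) assms by (cases i) auto
    fix m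
    show "s \<otimes> x \<oplus> r \<ominus> psum s (case_nat r a) m \<in> F m"
    \<comment> \<open>The factor \<open>s\<close> in \<open>F 1\<close> pays for the shifted degree;
      for \<open>m = 0\<close> nothing has to be shown, since \<open>F 0\<close> is
      everything.\<close>
    proof (cases m)
      case 0
      then show ?thesis using c by (simp add: F_0)
    next
      case (Suc k)
      have "s \<otimes> x \<oplus> r \<ominus> psum s (case_nat r a) m = s \<otimes> x \<oplus> r \<ominus> (s \<otimes> psum s a k \<oplus> r)"
        using Suc psum_shift[of s a r] c R_carrier by simp
      also have "\<dots> = s \<otimes> (x \<ominus> psum s a k)"
        using c p[of k] by (simp add: a_minus_def r_distr r_minus minus_add a_assoc l_neg r_neg a_comm[of r])
      also have "\<dots> \<in> F m" using F_mult[OF s_in_F expands_tail[OF assms(1)], of k] Suc by simp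
      finally show ?thesis .
    qed
  qed
qed

lemma expands_zero: "expands \<zero> (\<lambda>_. \<zero>)"
  by (rule expandsI) (auto simp: R_zero r_right_minus_eq psum_def a_minus_def additive_subgroup.zero_closed[OF F_additive])

lemma expands_const: "r \<in> R \<Longrightarrow> expands r (case_nat r (\<lambda>_. \<zero>))"
  using expands_shift[OF expands_zero] R_carrier by simp

lemma psum_tail_nbhd:
  assumes a: "\<And>i. a i \<in> R" and L: "L \<in> \<K>" and sL: "s [^] m \<in> L" and "m \<le> n"
  shows "psum s a n \<ominus> psum s a m \<in> L"
  using \<open>m \<le> n\<close>
proof (induction n rule: dec_induct)
  case base
  show ?case using R_carrier[OF a] zero_in_nbhd[OF L] by simp
next
  case (step n)
  have "s [^] n \<otimes> a n = s [^] m \<otimes> (s [^] (n - m) \<otimes> a n)"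
    using step(1) R_carrier[OF a] by (simp add: nat_pow_mult flip: m_assoc)
  then have "s [^] n \<otimes> a n \<in> L"
    using ideal.I_r_closed[OF nbhd_ideal[OF L] sL, of "s [^] (n - m) \<otimes> a n"] R_carrier[OF a] by simp
  moreover have "(x \<oplus> y) \<ominus> z = (x \<ominus> z) \<oplus> y" if "x \<in> carrier S" "y \<in> carrier S" "z \<in> carrier S" for x y z
    using that by algebra
  then have "psum s a (Suc n) \<ominus> psum s a m = (psum s a n \<ominus> psum s a m) \<oplus> s [^] n \<otimes> a n"
    using R_carrier[OF a] by (simp add: psum_Suc)
  ultimately show ?case using step(3) additive_subgroup.a_closed[OF additive_nbhd[OF L]] by simp
qed

text \<open>Modulo \<open>L\<close> the series stops at degree \<open>m\<close>, because
  \<open>s [^] m\<close> lies in \<open>L\<close>. What remains is a combination of the basis that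
  is zero modulo \<open>L\<close>, so independence applies.\<close>

lemma expands_in_nbhd:
  assumes e: "expands x a" and x: "x \<in> L" and L: "L \<in> \<K>" and sL: "s [^] m \<in> L" and b: "power_basis_mod R L s m" and "i < m"
  shows "a i \<in> L"
proof -
  have a: "a i \<in> R" for i using e unfolding expands_def by blast
  have p: "psum s a n \<in> carrier S" for n using R_carrier[OF a] by auto
  note aL = additive_nbhd[OF L]
  obtain m0 where "\<And>n. n \<ge> m0 \<Longrightarrow> x \<ominus> psum s a n \<in> L" using e L unfolding expands_def by blast
  then have "x \<ominus> psum s a (m + m0) \<in> L" by simp
  then have "psum s a (m + m0) \<in> L" using additive_subgroup_minus_iff[OF aL _ p] x nbhd_subset[OF L] by blast
  then have "psum s a m \<in> L" using additive_subgroup_minus_iff[OF aL p p psum_tail_nbhd[of a L m "m + m0", OF a L sL le_add1]] by blast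
  then show ?thesis
    using a \<open>i < m\<close> by (intro b[unfolded power_basis_mod_def, THEN conjunct2, THEN spec, of a, THEN mp, THEN spec, THEN mp] conjI allI)
qed

lemma good_nbhd:
  assumes "K \<in> \<K>"
  obtains L m where "L \<in> \<K>" "L \<subseteq> K" "n < m" "s [^] m \<in> L" "power_basis_mod R L s m"
  using power_basis[OF assms, of n] unfolding s_def by blast

text \<open>The coefficient of index \<open>i\<close> is tested modulo arbitrarily small
  \<open>L\<close> whose power basis is long enough to contain the power of degree
  \<open>i\<close>.\<close>

lemma expands_zero_unique:
  assumes "expands \<zero> a" shows "a i = \<zero>"
proof (rule separated)
  show "a i \<in> carrier S" using assms R_carrier unfolding expands_def by blast
  fix K assume "K \<in> \<K>"
  then obtain L m where "L \<in> \<K>" "L \<subseteq> K" "i < m" "s [^] m \<in> L" "power_basis_mod R L s m"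
    using good_nbhd by blast
  then show "a i \<in> K" using expands_in_nbhd[OF assms zero_in_nbhd] by blast
qed

lemma expands_unique:
  assumes "expands x a" "expands x b" shows "a = b"
proof
  fix i
  have "x \<in> carrier S" "a i \<in> carrier S" "b i \<in> carrier S" using assms R_carrier unfolding expands_def by blast+
  then show "a i = b i" using expands_zero_unique[of "\<lambda>i. a i \<ominus> b i" i] expands_minus[OF assms] r_right_minus_eq by simp
qed

text \<open>Coefficients found modulo the finer ideal \<open>L'\<close> reduce to those found modulo
  \<open>L\<close>: since \<open>s [^] m\<close> lies in \<open>L\<close>, cutting the other sum at
  degree \<open>m\<close> does not change its class modulo \<open>L\<close>, and independence
  compares the two sums of length \<open>m\<close>.\<close>

lemma power_basis_coeff_compat:
  assumes L: "L \<in> \<K>" "L' \<subseteq> L" and sL: "s [^] m \<in> L" and b: "power_basis_mod R L s m"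
    and a: "\<And>i. a i \<in> R" and a': "\<And>i. a' i \<in> R" and x: "x \<in> carrier S"
    and xa: "x \<ominus> psum s a m \<in> L" and xa': "x \<ominus> psum s a' m' \<in> L'"
    and i: "i < m" "i < m'"
  shows "a' i \<ominus> a i \<in> L"
proof -
  \<comment> \<open>The padding covers the case where \<open>m'\<close> is smaller than
    \<open>m\<close>.\<close>
  let ?b = "\<lambda>j. if j < m' then a' j else \<zero>" and ?n = "max m m'"
  have bR: "?b j \<in> R" for j using a' R_zero by auto
  have p: "psum s a m \<in> carrier S" "psum s a' m' \<in> carrier S" "psum s ?b n \<in> carrier S" for n
    using R_carrier[OF a] R_carrier[OF a'] by auto
  note aL = additive_nbhd[OF L(1)]
  have "psum s ?b ?n = psum s a' m'"
    by (rule psum_truncate) (use R_carrier[OF a'] in auto)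
  moreover have "psum s ?b ?n \<ominus> psum s ?b m \<in> L"
    by (rule psum_tail_nbhd[of ?b, OF bR L(1) sL]) simp
  ultimately have "x \<ominus> psum s ?b m \<in> L"
    using additive_subgroup_minus_trans[OF aL x p(2) p(3)[of m]] xa' L(2) by auto
  then have "psum s ?b m \<ominus> psum s a m \<in> L"
    using additive_subgroup_minus_trans[OF aL p(3)[of m] x p(1) additive_subgroup_minus_sym[OF aL x p(3)[of m]] xa] by blast
  then have "psum s (\<lambda>j. ?b j \<ominus> a j) m \<in> L"
    using psum_minus[of s ?b a m, OF s_closed R_carrier[OF bR] R_carrier[OF a]] by simp
  then have "?b i \<ominus> a i \<in> L"
    using R_minus[OF bR a] i
    by (intro b[unfolded power_basis_mod_def, THEN conjunct2, THEN spec, of "\<lambda>j. ?b j \<ominus> a j", THEN mp, THEN spec, THEN mp] conjI allI)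
  then show ?thesis using i by simp
qed

text \<open>Modulo each good ideal the element has finitely many coefficients in \<open>R\<close>,
  and those for different ideals are compatible. By completeness each index has a limit coefficient,
  which lies in \<open>R\<close> because \<open>R\<close> is closed.\<close>

lemma coeffs_exist:
  assumes x: "x \<in> carrier S" shows "\<exists>a. expands x a"
proof -
  \<comment> \<open>\<open>P K i c\<close> says that \<open>c\<close> occurs as the coefficient of
    index \<open>i\<close> of \<open>x\<close> modulo some good ideal inside \<open>K\<close>. It is
    a relation because the coefficient is determined only up to that ideal.\<close>
  define P where "P K i c \<longleftrightarrow> (\<exists>L m a. L \<in> \<K> \<and> L \<subseteq> K \<and> i < m \<and> s [^] m \<in> L \<and> power_basis_mod R L s m \<and>
    (\<forall>j. a j \<in> R) \<and> x \<ominus> psum s a m \<in> L \<and> c = a i)" for K i c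
  have PR: "c \<in> R" if "P K i c" for K i c using that unfolding P_def by blast
  have ex: "\<exists>c. P K i c" if K: "K \<in> \<K>" for K i
  proof -
    obtain L m where L: "L \<in> \<K>" "L \<subseteq> K" "i < m" "s [^] m \<in> L" "power_basis_mod R L s m"
      using good_nbhd[OF K] by blast
    then obtain a where "\<forall>j. a j \<in> R" "x \<ominus> psum s a m \<in> L"
      using x unfolding power_basis_mod_def by blast
    then show ?thesis using L unfolding P_def by blast
  qed
  have compat: "c \<ominus> c' \<in> K'" if P: "P K i c" "P K' i c'" and K': "K' \<in> \<K>" and KK: "K \<subseteq> K'" for K K' i c c'
  proof -
    obtain L m a where L: "L \<in> \<K>" "L \<subseteq> K" "i < m" "s [^] m \<in> L" "power_basis_mod R L s m"
      and a: "\<And>j. a j \<in> R" "x \<ominus> psum s a m \<in> L" "c = a i" using P(1) unfolding P_def by blast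
    obtain L' m' a' where L': "L' \<in> \<K>" "L' \<subseteq> K'" "i < m'" "s [^] m' \<in> L'" "power_basis_mod R L' s m'"
      and a': "\<And>j. a' j \<in> R" "x \<ominus> psum s a' m' \<in> L'" "c' = a' i" using P(2) unfolding P_def by blast
    \<comment> \<open>Neither of \<open>L\<close> and \<open>L'\<close> need contain the other, so
      both coefficients are compared with one found modulo a common refinement.\<close>
    obtain M where M: "M \<in> \<K>" "M \<subseteq> L \<inter> L'" using nbhd_directed L(1) L'(1) by blast
    obtain c'' where "P M i c''" using ex M by blast
    then obtain N n b where N: "N \<in> \<K>" "N \<subseteq> M" "i < n" and b: "\<And>j. b j \<in> R" "x \<ominus> psum s b n \<in> N"
      unfolding P_def by blast
    have "b i \<ominus> a i \<in> L"
      by (rule power_basis_coeff_compat[of L N m a b, OF L(1) _ L(4,5) a(1) b(1) x a(2) b(2) L(3) N(3)]) (use M N in blast)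
    moreover have "b i \<ominus> a' i \<in> L'"
      by (rule power_basis_coeff_compat[of L' N m' a' b, OF L'(1) _ L'(4,5) a'(1) b(1) x a'(2) b(2) L'(3) N(3)]) (use M N in blast)
    ultimately have "b i \<ominus> a i \<in> K'" "b i \<ominus> a' i \<in> K'" using L(2) L'(2) KK by auto
    then show ?thesis unfolding a(3) a'(3)
      using additive_subgroup_minus_trans[OF additive_nbhd[OF K'] R_carrier[OF a(1)] R_carrier[OF b(1)] R_carrier[OF a'(1)]]
        additive_subgroup_minus_sym[OF additive_nbhd[OF K'] R_carrier[OF b(1)] R_carrier[OF a(1)]] by blast
  qed
  have "\<exists>y\<in>R. \<forall>K\<in>\<K>. \<forall>c. P K i c \<longrightarrow> y \<ominus> c \<in> K" for i
  proof -
    obtain c where c: "\<And>K. K \<in> \<K> \<Longrightarrow> P K i (c K)" using ex[of _ i] by metis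
    have "\<exists>y\<in>carrier S. \<forall>K\<in>\<K>. y \<ominus> c K \<in> K"
      by (rule complete) (use PR[OF c] R_carrier compat[OF c c] in auto)
    then obtain y where y: "y \<in> carrier S" "\<And>K. K \<in> \<K> \<Longrightarrow> y \<ominus> c K \<in> K" by blast
    then have "y \<in> cl R" unfolding cl_def using PR[OF c] by blast
    then have "y \<in> R" using R_closed by blast
    moreover have "y \<ominus> d \<in> K" if "K \<in> \<K>" "P K i d" for K d
      using additive_subgroup_minus_trans[OF additive_nbhd[OF that(1)] y(1) R_carrier[OF PR[OF c]] R_carrier[OF PR[OF that(2)]] y(2)]
        compat[OF c that(2)] that(1) by blast
    ultimately show ?thesis by blast
  qed
  then obtain b where b: "\<And>i. b i \<in> R" "\<And>i K c. K \<in> \<K> \<Longrightarrow> P K i c \<Longrightarrow> b i \<ominus> c \<in> K" by metis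
  have "expands x b" unfolding expands_def
  proof (intro conjI allI ballI x b(1))
    fix K assume "K \<in> \<K>"
    then obtain L m where L: "L \<in> \<K>" "L \<subseteq> K" "0 < m" "s [^] m \<in> L" "power_basis_mod R L s m"
      using good_nbhd by blast
    then obtain a where a: "\<And>j. a j \<in> R" "x \<ominus> psum s a m \<in> L"
      using x unfolding power_basis_mod_def by blast
    have p: "psum s a n \<in> carrier S" "psum s b n \<in> carrier S" for n using R_carrier[OF a(1)] R_carrier[OF b(1)] by auto
    have "b i \<ominus> a i \<in> L" if "i < m" for i
      using b(2)[OF L(1), of i "a i"] L a that unfolding P_def by blast
    then have "psum s (\<lambda>i. b i \<ominus> a i) m \<in> L"
      using R_carrier[OF b(1)] R_carrier[OF a(1)] ideal.I_l_closed[OF nbhd_ideal[OF L(1)]]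
      by (intro psum_in_ideal nbhd_ideal L) auto
    then have "psum s b m \<ominus> psum s a m \<in> L"
      using psum_minus[of s b a m, OF s_closed R_carrier[OF b(1)] R_carrier[OF a(1)]] by simp
    then have 1: "x \<ominus> psum s b m \<in> L"
      using additive_subgroup_minus_trans[OF additive_nbhd[OF L(1)] x p(1)[of m] p(2)[of m] a(2)]
        additive_subgroup_minus_sym[OF additive_nbhd[OF L(1)] p(2)[of m] p(1)[of m]] by blast
    have "x \<ominus> psum s b n \<in> K" if "n \<ge> m" for n
      using additive_subgroup_minus_trans[OF additive_nbhd[OF L(1)] x p(2)[of m] p(2)[of n] 1]
        additive_subgroup_minus_sym[OF additive_nbhd[OF L(1)] p(2)[of n] p(2)[of m]]
        psum_tail_nbhd[of b L m n, OF b(1) L(1,4) that] L(2) by blast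
    then show "\<exists>m0. \<forall>m\<ge>m0. x \<ominus> psum s b m \<in> K" by blast
  qed
  then show ?thesis by blast
qed

section \<open>The coefficient map and its behaviour under products\<close>

definition coef :: "'a \<Rightarrow> nat \<Rightarrow> 'a" where "coef x = (THE a. expands x a)"

definition val :: "(nat \<Rightarrow> 'a) \<Rightarrow> 'a" where "val a = (THE x. expands x a)"

lemma coef_eqI: "expands x a \<Longrightarrow> coef x = a"
  unfolding coef_def using expands_unique by blast

lemma val_eqI: "expands x a \<Longrightarrow> val a = x"
  unfolding val_def using expands_unique_value by blast

lemma expands_coef: "x \<in> carrier S \<Longrightarrow> expands x (coef x)"
  using coeffs_exist coef_eqI by metis

lemma expands_val: "(\<And>i. a i \<in> R) \<Longrightarrow> expands (val a) a"
  using expands_exists[of a] val_eqI by auto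

lemma coef_in_R: "x \<in> carrier S \<Longrightarrow> coef x i \<in> R"
  using expands_coef unfolding expands_def by blast

lemma coef_closed: "x \<in> carrier S \<Longrightarrow> coef x i \<in> carrier S"
  using coef_in_R R_carrier by blast

lemma val_closed: "(\<And>i. a i \<in> R) \<Longrightarrow> val a \<in> carrier S"
  using expands_val unfolding expands_def by blast

lemma coef_val: "(\<And>i. a i \<in> R) \<Longrightarrow> coef (val a) = a"
  using expands_val coef_eqI by blast

lemma val_coef: "x \<in> carrier S \<Longrightarrow> val (coef x) = x"
  using expands_coef val_eqI by blast

lemma coef_add: "\<lbrakk>x \<in> carrier S; y \<in> carrier S\<rbrakk> \<Longrightarrow> coef (x \<oplus> y) = (\<lambda>i. coef x i \<oplus> coef y i)"
  by (intro coef_eqI expands_add expands_coef)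

lemma coef_minus: "\<lbrakk>x \<in> carrier S; y \<in> carrier S\<rbrakk> \<Longrightarrow> coef (x \<ominus> y) = (\<lambda>i. coef x i \<ominus> coef y i)"
  by (intro coef_eqI expands_minus expands_coef)

lemma coef_zero: "coef \<zero> = (\<lambda>_. \<zero>)"
  by (intro coef_eqI expands_zero)

lemma coef_const: "r \<in> R \<Longrightarrow> coef r = case_nat r (\<lambda>_. \<zero>)"
  by (intro coef_eqI expands_const)

lemma coef_r_mult: "\<lbrakk>x \<in> carrier S; r \<in> R\<rbrakk> \<Longrightarrow> coef (x \<otimes> r) = (\<lambda>i. coef x i \<otimes> r)"
  by (intro coef_eqI expands_r_mult expands_coef)

lemma coef_shift: "\<lbrakk>x \<in> carrier S; r \<in> R\<rbrakk> \<Longrightarrow> coef (s \<otimes> x \<oplus> r) = case_nat r (coef x)"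
  by (intro coef_eqI expands_shift expands_coef)

lemma coef_s_mult: "x \<in> carrier S \<Longrightarrow> coef (s \<otimes> x) = case_nat \<zero> (coef x)"
  using coef_shift[OF _ R_zero] by simp

text \<open>Division by \<open>s\<close> on the left with remainder in \<open>R\<close>: the
  quotient has the shifted coefficient sequence. It drives the induction on the degree.\<close>

lemma decompose:
  assumes "x \<in> carrier S"
  obtains y where "y \<in> carrier S" "x = s \<otimes> y \<oplus> coef x 0" "\<forall>i. coef y i = coef x (Suc i)"
proof -
  have R: "coef x (Suc i) \<in> R" for i using coef_in_R[OF assms] .
  let ?y = "val (\<lambda>i. coef x (Suc i))"
  have y: "?y \<in> carrier S" "coef ?y = (\<lambda>i. coef x (Suc i))"
    using val_closed[of "\<lambda>i. coef x (Suc i)", OF R] coef_val[of "\<lambda>i. coef x (Suc i)", OF R] by auto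
  have "case_nat (coef x 0) (\<lambda>i. coef x (Suc i)) = coef x" by (auto split: nat.split)
  then have "coef (s \<otimes> ?y \<oplus> coef x 0) = coef x"
    using coef_shift[OF y(1) coef_in_R[OF assms, of 0]] y(2) by simp
  moreover have "s \<otimes> ?y \<oplus> coef x 0 \<in> carrier S" using y(1) coef_closed[OF assms] by auto
  ultimately have "s \<otimes> ?y \<oplus> coef x 0 = x" using val_coef assms by metis
  then show ?thesis using that[OF y(1)] y(2) by metis
qed

text \<open>Reduces products to left factors in \<open>R\<close>. Writing \<open>x\<close> as
  \<open>s \<otimes> z \<oplus> a\<close> with \<open>a\<close> in \<open>R\<close>, the part with
  \<open>s\<close> contributes a shifted coefficient of \<open>z \<otimes> y\<close>, which the
  induction on \<open>m\<close> handles, and \<open>a\<close> contributes the summand for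
  \<open>n = m\<close>.\<close>

lemma coef_mult:
  assumes "x \<in> carrier S" "y \<in> carrier S"
  shows "coef (x \<otimes> y) m = (\<Oplus>n\<in>{0..m}. coef (coef x (m - n) \<otimes> y) n)"
  using assms(1)
proof (induction m arbitrary: x)
  case 0
  then obtain z where z: "z \<in> carrier S" "x = s \<otimes> z \<oplus> coef x 0" using decompose by metis
  let ?a = "coef x 0"
  have a: "?a \<in> carrier S" using coef_closed 0 by blast
  have "x \<otimes> y = s \<otimes> (z \<otimes> y) \<oplus> ?a \<otimes> y"
    using z(1) assms(2) a by (subst z(2)) (simp add: l_distr m_assoc)
  then have "coef (x \<otimes> y) 0 = \<zero> \<oplus> coef (?a \<otimes> y) 0"
    using z(1) assms(2) a by (simp add: coef_add coef_s_mult)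
  moreover have "\<zero> \<oplus> coef (?a \<otimes> y) 0 = coef (?a \<otimes> y) 0" using a assms(2) by (intro l_zero coef_closed) simp
  moreover have "coef (?a \<otimes> y) 0 \<in> carrier S" using a assms(2) by (intro coef_closed) simp
  moreover have "(\<Oplus>n\<in>{0..0}. f n) = f 0" if "f 0 \<in> carrier S" for f :: "nat \<Rightarrow> 'a"
    using that by (simp add: finsum_insert)
  ultimately show ?case by (simp only: diff_self_eq_0)
next
  case (Suc m)
  obtain z where z: "z \<in> carrier S" "x = s \<otimes> z \<oplus> coef x 0" "\<forall>i. coef z i = coef x (Suc i)"
    using decompose[OF Suc.prems] by blast
  let ?a = "coef x 0"
  have a: "?a \<in> carrier S" using coef_closed Suc by blast
  have "x \<otimes> y = s \<otimes> (z \<otimes> y) \<oplus> ?a \<otimes> y"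
    using z(1) assms(2) a by (subst z(2)) (simp add: l_distr m_assoc)
  then have "coef (x \<otimes> y) (Suc m) = coef (z \<otimes> y) m \<oplus> coef (?a \<otimes> y) (Suc m)"
    using z(1) assms(2) a by (simp add: coef_add coef_s_mult)
  also have "coef (z \<otimes> y) m = (\<Oplus>n\<in>{0..m}. coef (coef x (Suc m - n) \<otimes> y) n)"
    using Suc.IH[OF z(1)] z(3) coef_closed[OF Suc.prems] assms(2)
    by (auto intro!: finsum_cong' coef_closed simp: Suc_diff_le)
  also have "\<dots> \<oplus> coef (?a \<otimes> y) (Suc m) = (\<Oplus>n\<in>{0..Suc m}. coef (coef x (Suc m - n) \<otimes> y) n)"
  proof -
    have "coef (coef x i \<otimes> y) n \<in> carrier S" for i n
      by (intro coef_closed m_closed Suc.prems assms(2))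
    then show ?thesis
      unfolding atLeast0_atMost_Suc by (subst finsum_insert) (auto intro!: a_comm finsum_closed)
  qed
  finally show ?case .
qed

end

lemma (in ring) additive_subgroup_add_pow:
  assumes "additive_subgroup H R" "x \<in> H" shows "[(n::nat)] \<cdot> x \<in> H"
proof (induction n)
  case 0
  then show ?case using additive_subgroup.zero_closed[OF assms(1)] by simp
next
  case (Suc n)
  then show ?case using additive_subgroup.a_closed[OF assms(1) Suc assms(2)] by simp
qed

lemma (in ring) additive_subgroup_finsum:
  assumes "additive_subgroup H R" "finite A" "\<And>i. i \<in> A \<Longrightarrow> f i \<in> H" shows "(\<Oplus>i\<in>A. f i) \<in> H"
  using assms(2,3)
proof (induction A)
  case empty
  then show ?case using additive_subgroup.zero_closed[OF assms(1)] by simp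
next
  case (insert x A)
  have "H \<subseteq> carrier R" using assms(1) additive_subgroup.a_subset by blast
  with insert show ?case
    using additive_subgroup.a_closed[OF assms(1), of "f x" "finsum R f A"]
    by (subst finsum_insert) auto
qed

context skew_generator
begin

section \<open>The skew commutation rule\<close>

definition sg :: "'a \<Rightarrow> 'a" where "sg x = h \<otimes> x \<otimes> g"

definition dl :: "'a \<Rightarrow> 'a" where "dl x = sg x \<ominus> x"

lemma sg_closed [simp, intro]: "x \<in> carrier S \<Longrightarrow> sg x \<in> carrier S"
  by (simp add: sg_def)

lemma dl_closed [simp, intro]: "x \<in> carrier S \<Longrightarrow> dl x \<in> carrier S"
  by (simp add: dl_def)

lemma sg_R: "x \<in> R \<Longrightarrow> sg x \<in> R"
  by (simp add: sg_def conj_R)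

lemma dl_R: "x \<in> R \<Longrightarrow> dl x \<in> R"
  by (simp add: dl_def sg_R R_minus)

lemma sg_F: "x \<in> F k \<Longrightarrow> sg x \<in> F k"
  unfolding sg_def by (intro ideal.I_l_closed[OF F_ideal] ideal.I_r_closed[OF F_ideal]) auto

lemma sg_minus: "x \<in> carrier S \<Longrightarrow> y \<in> carrier S \<Longrightarrow> sg (x \<ominus> y) = sg x \<ominus> sg y"
  by (simp add: sg_def a_minus_def l_distr r_distr l_minus r_minus)

lemma sg_add: "x \<in> carrier S \<Longrightarrow> y \<in> carrier S \<Longrightarrow> sg (x \<oplus> y) = sg x \<oplus> sg y"
  by (simp add: sg_def l_distr r_distr)

text \<open>Conjugation gives \<open>g \<otimes> sg x = x \<otimes> g\<close>; substituting
  \<open>s \<oplus> \<one>\<close> for \<open>g\<close> and sorting terms yields the rule.\<close>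

lemma mult_s: assumes "x \<in> carrier S" shows "x \<otimes> s = s \<otimes> sg x \<oplus> dl x"
proof -
  have "g \<otimes> sg x = x \<otimes> g" using assms g_h by (simp add: sg_def flip: m_assoc)
  then have "s \<otimes> sg x = x \<otimes> g \<ominus> sg x"
    using assms by (simp add: s_def a_minus_def l_distr l_minus)
  moreover have "(a \<ominus> b) \<oplus> (b \<ominus> x) = a \<ominus> x" if "a \<in> carrier S" "b \<in> carrier S" for a b
    using that assms minus_telescope[of a b x] by simp
  moreover have "x \<otimes> s = x \<otimes> g \<ominus> x" using assms by (simp add: s_def a_minus_def r_distr r_minus)
  ultimately show ?thesis using assms by (simp add: dl_def)
qed

text \<open>By \<open>mult_s\<close>, \<open>dl x\<close> is the difference of
  \<open>x \<otimes> s\<close> and \<open>s \<otimes> sg x\<close>, and either product has the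
  factor \<open>s\<close> from \<open>F 1\<close>.\<close>

lemma dl_F: assumes "x \<in> F k" shows "dl x \<in> F (Suc k)"
proof -
  have x: "x \<in> carrier S" using assms F_subset by blast
  have "g \<otimes> sg x = x \<otimes> g" using x g_h by (simp add: sg_def flip: m_assoc)
  then have "s \<otimes> sg x \<in> F (Suc k)" using F_mult[OF s_in_F sg_F[OF assms]] by simp
  moreover have "x \<otimes> s \<in> F (Suc k)" using F_mult[OF assms s_in_F] by simp
  moreover have "dl x = x \<otimes> s \<ominus> s \<otimes> sg x"
  proof -
    have "b = (a \<oplus> b) \<ominus> a" if "a \<in> carrier S" "b \<in> carrier S" for a b using that by algebra
    then show ?thesis using mult_s[OF x] x by simp
  qed
  ultimately show ?thesis using additive_subgroup_minus_closed[OF F_additive] by simp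
qed

lemma sg_pow_R: "x \<in> R \<Longrightarrow> (sg ^^ n) x \<in> R"
  by (induction n) (auto intro: sg_R)

lemma dl_pow_R: "x \<in> R \<Longrightarrow> (dl ^^ n) x \<in> R"
  by (induction n) (auto intro: dl_R)

lemma sg_pow_F: "x \<in> F k \<Longrightarrow> (sg ^^ n) x \<in> F k"
  by (induction n) (auto intro: sg_F)

lemma dl_pow_F: "x \<in> F k \<Longrightarrow> (dl ^^ n) x \<in> F (k + n)"
  by (induction n) (auto intro: dl_F)

lemma sg_pow_dl: "x \<in> carrier S \<Longrightarrow> (sg ^^ n) (dl x) = dl ((sg ^^ n) x) \<and> (sg ^^ n) x \<in> carrier S"
  by (induction n) (auto simp: dl_def sg_minus)

text \<open>Pascal's rule. Moving one \<open>s\<close> past \<open>a\<close> either keeps an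
  \<open>s\<close> in front and applies \<open>sg\<close>, or drops it and applies
  \<open>dl\<close>; as \<open>sg\<close> and \<open>dl\<close> commute, only the number of choices
  of each kind matters.\<close>

lemma coef_mult_s_pow:
  assumes "a \<in> R"
  shows "coef (a \<otimes> s [^] k) n = [(k choose n)] \<cdot> ((dl ^^ (k - n)) ((sg ^^ n) a))"
  using assms
proof (induction k arbitrary: a n)
  case 0
  then show ?case using R_carrier[OF 0] by (cases n) (auto simp: coef_const)
next
  case (Suc k)
  have a: "a \<in> carrier S" "sg a \<in> carrier S" "dl a \<in> carrier S" using R_carrier[OF Suc.prems] by auto
  have "a \<otimes> s [^] Suc k = (a \<otimes> s) \<otimes> s [^] k" using a nat_pow_Suc2[of s k] by (simp add: m_assoc del: nat_pow_Suc)
  also have "\<dots> = s \<otimes> (sg a \<otimes> s [^] k) \<oplus> dl a \<otimes> s [^] k"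
    using a by (simp add: mult_s l_distr m_assoc)
  finally have eq: "coef (a \<otimes> s [^] Suc k) n = case_nat \<zero> (coef (sg a \<otimes> s [^] k)) n \<oplus> coef (dl a \<otimes> s [^] k) n"
    using a by (simp add: coef_add coef_s_mult del: nat_pow_Suc)
  show ?case
  proof (cases n)
    case 0
    then show ?thesis using eq Suc.IH[OF dl_R[OF Suc.prems], of 0] R_carrier[OF dl_pow_R[OF dl_R[OF Suc.prems]]]
      by (simp add: funpow_swap1 del: nat_pow_Suc)
  next
    case (Suc i)
    let ?x = "(sg ^^ Suc i) a"
    have x: "?x \<in> R" using sg_pow_R[OF Suc.prems(1)] .
    have c: "(dl ^^ j) ?x \<in> carrier S" for j using R_carrier[OF dl_pow_R[OF x]] .
    have 1: "coef (sg a \<otimes> s [^] k) i = [(k choose i)] \<cdot> ((dl ^^ (k - i)) ?x)"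
      using Suc.IH[OF sg_R[OF Suc.prems]] by (simp add: funpow_swap1)
    have 2: "coef (dl a \<otimes> s [^] k) n = [(k choose Suc i)] \<cdot> ((dl ^^ (k - i)) ?x)"
    proof (cases "Suc i \<le> k")
      case True
      then have "k - i = Suc (k - Suc i)" by simp
      then have "(dl ^^ (k - Suc i)) ((sg ^^ Suc i) (dl a)) = (dl ^^ (k - i)) ?x"
        using sg_pow_dl[OF a(1), of "Suc i"] by (simp add: funpow_swap1)
      then show ?thesis using Suc.IH[OF dl_R[OF Suc.prems], of n] \<open>n = Suc i\<close> by simp
    next
      \<comment> \<open>Here \<open>k - i\<close> no longer exceeds \<open>k - Suc i\<close>, so the
        iterates cannot be matched; the binomial coefficient vanishes instead.\<close>
      case False
      then show ?thesis using Suc.IH[OF dl_R[OF Suc.prems], of n] \<open>n = Suc i\<close> by (simp add: binomial_eq_0)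
    qed
    show ?thesis
      using eq 1 2 \<open>n = Suc i\<close> c[of "k - i"] by (simp add: add.nat_pow_mult del: nat_pow_Suc)
  qed
qed

lemma coef_const_mult_psum:
  assumes a: "a \<in> R" and b: "\<And>i. b i \<in> R"
  shows "coef (a \<otimes> psum s b m) n = (\<Oplus>k\<in>{n..<m}. [(k choose n)] \<cdot> ((dl ^^ (k - n)) ((sg ^^ n) a)) \<otimes> b k)"
proof (induction m)
  case 0
  then show ?case using R_carrier[OF a] by (simp add: coef_zero)
next
  case (Suc m)
  let ?f = "\<lambda>k. [(k choose n)] \<cdot> ((dl ^^ (k - n)) ((sg ^^ n) a)) \<otimes> b k"
  have ac: "a \<in> carrier S" "psum s b m \<in> carrier S" "b m \<in> carrier S" using R_carrier[OF a] R_carrier[OF b] by auto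
  have f: "?f k \<in> carrier S" for k
    using R_carrier[OF dl_pow_R[OF sg_pow_R[OF a]]] R_carrier[OF b] by auto
  have "a \<otimes> psum s b (Suc m) = a \<otimes> psum s b m \<oplus> (a \<otimes> s [^] m) \<otimes> b m"
    using ac R_carrier[OF b] by (simp add: psum_Suc r_distr m_assoc)
  then have eq: "coef (a \<otimes> psum s b (Suc m)) n = coef (a \<otimes> psum s b m) n \<oplus> ?f m"
    using ac by (simp add: coef_add coef_r_mult[OF _ b] coef_mult_s_pow[OF a])
  show ?case
  proof (cases "n \<le> m")
    case True
    then have "{n..<Suc m} = insert m {n..<m}" by auto
    then show ?thesis using eq Suc f by (simp add: finsum_insert a_comm finsum_closed Pi_def)
  next
    case False
    then have "?f m = \<zero>" using ac by (simp add: binomial_eq_0)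
    then show ?thesis using eq Suc False by (simp add: Suc_le_eq)
  qed
qed

text \<open>The filtration read off from coefficients, with \<open>s\<close> of weight one.
  Subtraction truncates, so indices from \<open>k\<close> on are unconstrained. The aim is that
  \<open>J k\<close> and \<open>F k\<close> coincide, one inclusion for each direction of
  continuity.\<close>

definition J :: "nat \<Rightarrow> 'a set" where "J k = {x \<in> carrier S. \<forall>i. coef x i \<in> F (k - i)}"

text \<open>Each term of degree \<open>i\<close> below \<open>k\<close> gets \<open>i\<close> from
  \<open>s [^] i\<close> and \<open>k - i\<close> from its coefficient; the tail from degree
  \<open>k\<close> on lies in \<open>F k\<close> anyway.\<close>

lemma J_subset_F: "J k \<subseteq> F k"
proof
  fix x assume "x \<in> J k"
  then have x: "x \<in> carrier S" and c: "\<And>i. coef x i \<in> F (k - i)" by (auto simp: J_def)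
  have "psum s (coef x) k \<in> F k"
  proof (intro psum_in_ideal F_ideal)
    fix i assume "i < k"
    then show "s [^] i \<otimes> coef x i \<in> F k" using F_mult[OF s_pow_in_F[of i] c[of i]] by simp
  qed (use coef_closed[OF x] in auto)
  then show "x \<in> F k"
    using additive_subgroup_minus_iff[OF F_additive x _ expands_tail[OF expands_coef[OF x]]] coef_closed[OF x] by auto
qed

lemma I_subset_F1: "I \<subseteq> F 1"
  using Ipow_1 cl_increasing[OF Ipow_subset] unfolding F_def by blast

text \<open>Only the constant coefficient is constrained. It differs from \<open>y\<close> by a
  multiple of \<open>s\<close>, hence lies in \<open>F 1\<close> together with
  \<open>y\<close>.\<close>

lemma I_subset_J1: "I \<subseteq> J 1"
proof
  fix y assume "y \<in> I"
  then have yF: "y \<in> F 1" and y: "y \<in> carrier S" using I_subset_F1 F_subset by blast+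
  obtain z where z: "z \<in> carrier S" "y = s \<otimes> z \<oplus> coef y 0" using decompose[OF y] by blast
  have "s \<otimes> z \<in> F 1" using ideal.I_r_closed[OF F_ideal s_in_F z(1)] .
  then have "y \<ominus> s \<otimes> z \<in> F 1" using additive_subgroup_minus_closed[OF F_additive yF] by blast
  moreover have cancel: "(a \<oplus> c) \<ominus> a = c" if "a \<in> carrier S" "c \<in> carrier S" for a c
    using that by algebra
  have "y \<ominus> s \<otimes> z = coef y 0"
    by (subst z(2)) (use z(1) coef_closed[OF y, of 0] in \<open>intro cancel, auto\<close>)
  ultimately have "coef y 0 \<in> F 1" by simp
  then have "coef y i \<in> F (1 - i)" for i
    using coef_closed[OF y, of i] F_0 by (cases i) auto
  then show "y \<in> J 1" using y unfolding J_def by blast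
qed

lemma coef_const_mult_approx:
  assumes a: "a \<in> R" and y: "y \<in> carrier S"
  shows "coef (a \<otimes> y) n \<ominus> (\<Oplus>k\<in>{n..<m}. [(k choose n)] \<cdot> ((dl ^^ (k - n)) ((sg ^^ n) a)) \<otimes> coef y k) = 
    coef (a \<otimes> (y \<ominus> psum s (coef y) m)) n"
proof -
  have c: "a \<in> carrier S" "psum s (coef y) m \<in> carrier S" using R_carrier[OF a] coef_closed[OF y] by auto
  have "a \<otimes> (y \<ominus> psum s (coef y) m) = a \<otimes> y \<ominus> a \<otimes> psum s (coef y) m"
    using c y by (simp add: a_minus_def r_distr r_minus)
  then show ?thesis
    using coef_const_mult_psum[of a "coef y", OF a coef_in_R[OF y]] c y by (simp add: coef_minus)
qed

lemma summand_F:
  assumes "a \<in> F j" "b \<in> F l" shows "[(c::nat)] \<cdot> ((dl ^^ d) ((sg ^^ n) a)) \<otimes> b \<in> F (j + d + l)"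
  by (intro F_mult additive_subgroup_add_pow[OF F_additive] dl_pow_F sg_pow_F assms)

text \<open>Continuity for the topology given by \<open>\<K>\<close>. It involves no filtration
  degree and serves to pass from finite sums and algebraic powers to their closures.\<close>

lemma coef_continuous:
  assumes "K \<in> \<K>" obtains L where "L \<in> \<K>" "\<And>x. x \<in> L \<Longrightarrow> coef x n \<in> K"
proof -
  obtain L m where L: "L \<in> \<K>" "L \<subseteq> K" "n < m" "s [^] m \<in> L" "power_basis_mod R L s m"
    using good_nbhd[OF assms] by blast
  have "coef x n \<in> K" if "x \<in> L" for x
    using expands_in_nbhd[OF expands_coef that L(1,4,5,3)] nbhd_subset[OF L(1)] that L(2) by blast
  then show ?thesis using that L(1) by blast
qed

lemma cl_FI:
  assumes "x \<in> carrier S" "\<And>K. K \<in> \<K> \<Longrightarrow> \<exists>a\<in>F k. x \<ominus> a \<in> K"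
  shows "x \<in> F k"
  using assms F_closed unfolding cl_def by blast

text \<open>In the summand of index \<open>k\<close> the derivation is applied \<open>k - n\<close>
  times and gains as many degrees; this makes up for the coefficient of \<open>y\<close> having
  degree only \<open>l - k\<close>. So each summand reaches degree \<open>j + l - n\<close>, and the
  limit stays there because the filtration is closed.\<close>

lemma coef_const_mult_J:
  assumes a: "a \<in> R" "a \<in> F j" and y: "y \<in> J l"
  shows "coef (a \<otimes> y) n \<in> F (j + l - n)"
proof (rule cl_FI)
  have yS: "y \<in> carrier S" and b: "\<And>i. coef y i \<in> F (l - i)" using y by (auto simp: J_def)
  have aS: "a \<in> carrier S" using R_carrier a by blast
  show "coef (a \<otimes> y) n \<in> carrier S" using aS yS by (intro coef_closed) simp
  fix K assume "K \<in> \<K>"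
  then obtain L where L: "L \<in> \<K>" "\<And>x. x \<in> L \<Longrightarrow> coef x n \<in> K" using coef_continuous[of K n] by metis
  obtain m where m: "F m \<subseteq> L" using F_small[OF L(1)] by blast
  let ?f = "\<lambda>k. [(k choose n)] \<cdot> ((dl ^^ (k - n)) ((sg ^^ n) a)) \<otimes> coef y k"
  have "a \<otimes> (y \<ominus> psum s (coef y) m) \<in> L"
    using ideal.I_l_closed[OF nbhd_ideal[OF L(1)] _ aS] expands_tail[OF expands_coef[OF yS], of m] m by blast
  then have "coef (a \<otimes> y) n \<ominus> (\<Oplus>k\<in>{n..<m}. ?f k) \<in> K"
    unfolding coef_const_mult_approx[OF a(1) yS] by (rule L(2))
  moreover have "(\<Oplus>k\<in>{n..<m}. ?f k) \<in> F (j + l - n)"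
  proof (rule additive_subgroup_finsum[OF F_additive])
    fix k assume "k \<in> {n..<m}"
    \<comment> \<open>Truncated subtraction is harmless: if \<open>k\<close> exceeds
      \<open>l\<close>, the gain of \<open>k - n\<close> alone suffices.\<close>
    then have "j + l - n \<le> j + (k - n) + (l - k)" by auto
    then show "?f k \<in> F (j + l - n)"
      using summand_F[OF a(2) b, of "k choose n" "k - n" n k] F_antimono by blast
  qed simp
  ultimately show "\<exists>z\<in>F (j + l - n). coef (a \<otimes> y) n \<ominus> z \<in> K" by blast
qed

lemma J_additive: "x \<in> J k \<Longrightarrow> y \<in> J k \<Longrightarrow> x \<oplus> y \<in> J k"
  unfolding J_def by (auto simp: coef_add intro: additive_subgroup.a_closed[OF F_additive])

text \<open>By \<open>coef_mult\<close> only products of a coefficient of \<open>x\<close> with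
  \<open>y\<close> occur, and the degree of \<open>coef x (m - n)\<close> combines with
  \<open>coef_const_mult_J\<close> to the required degree for each \<open>n\<close>.\<close>

lemma J_mult: assumes x: "x \<in> J k" and y: "y \<in> J l" shows "x \<otimes> y \<in> J (k + l)"
proof -
  have xS: "x \<in> carrier S" and yS: "y \<in> carrier S" using x y by (auto simp: J_def)
  have "coef (x \<otimes> y) m \<in> F (k + l - m)" for m
    unfolding coef_mult[OF xS yS]
  proof (rule additive_subgroup_finsum[OF F_additive])
    fix n assume "n \<in> {0..m}"
    then have "k + l - m \<le> (k - (m - n)) + l - n" by auto
    moreover have "coef x (m - n) \<in> F (k - (m - n))" using x by (auto simp: J_def)
    then have "coef (coef x (m - n) \<otimes> y) n \<in> F ((k - (m - n)) + l - n)"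
      by (intro coef_const_mult_J coef_in_R xS y)
    ultimately show "coef (coef x (m - n) \<otimes> y) n \<in> F (k + l - m)" using F_antimono by blast
  qed simp
  then show ?thesis using xS yS unfolding J_def by simp
qed

lemma Ipow_subset_J: "Ipow k \<subseteq> J k"
proof (induction k)
  case 0
  then show ?case by (auto simp: Ipow_0 J_def F_0 coef_closed)
next
  case (Suc k)
  show ?case
  proof
    fix x assume "x \<in> Ipow (Suc k)"
    then show "x \<in> J (Suc k)"
      unfolding Ipow_Suc
    proof (induction x rule: ideal_prod.induct)
      case (prod i j)
      then show ?case using J_mult[of i k j 1] Suc I_subset_J1 by auto
    next
      case (sum s1 s2)
      then show ?case by (intro J_additive)
    qed
  qed
qed

text \<open>The algebraic power lies in \<open>J k\<close> because \<open>J\<close> is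
  multiplicative and \<open>J 1\<close> contains \<open>I\<close>. For its closure, the coefficients
  of \<open>x\<close> are limits of coefficients of elements of the power, and each
  \<open>F (k - i)\<close> is closed.\<close>

lemma F_subset_J: "F k \<subseteq> J k"
proof
  fix x assume x: "x \<in> F k"
  then have xS: "x \<in> carrier S" using F_subset by blast
  have "coef x i \<in> F (k - i)" for i
  proof (rule cl_FI)
    show "coef x i \<in> carrier S" using coef_closed[OF xS] .
    fix K assume "K \<in> \<K>"
    then obtain L where L: "L \<in> \<K>" "\<And>x. x \<in> L \<Longrightarrow> coef x i \<in> K" using coef_continuous[of K i] by metis
    obtain y where y: "y \<in> Ipow k" "x \<ominus> y \<in> L" using x L(1) unfolding F_def cl_def by blast
    then have yJ: "y \<in> J k" using Ipow_subset_J by blast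
    have "coef (x \<ominus> y) i \<in> K" using L(2) y(2) by blast
    then have "coef x i \<ominus> coef y i \<in> K" using xS yJ by (simp add: coef_minus J_def)
    then show "\<exists>a\<in>F (k - i). coef x i \<ominus> a \<in> K" using yJ unfolding J_def by blast
  qed
  then show "x \<in> J k" using xS by (simp add: J_def)
qed

lemma coef_F: "x \<in> F k \<Longrightarrow> coef x i \<in> F (k - i)"
  using F_subset_J unfolding J_def by blast

text \<open>The rate of convergence of the inner sums: the part of \<open>y\<close> beyond degree
  \<open>m\<close> lies in \<open>F m\<close>, multiplication by \<open>a\<close> keeps it there,
  and taking the coefficient of index \<open>n\<close> costs \<open>n\<close>.\<close>

lemma coef_const_mult_tail:
  assumes a: "a \<in> R" and y: "y \<in> carrier S"
  shows "coef (a \<otimes> y) n \<ominus> (\<Oplus>k\<in>{n..<m}. [(k choose n)] \<cdot> ((dl ^^ (k - n)) ((sg ^^ n) a)) \<otimes> coef y k) \<in> F (m - n)"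
  unfolding coef_const_mult_approx[OF assms]
  by (intro coef_F ideal.I_l_closed[OF F_ideal] expands_tail expands_coef y R_carrier a)

end

section \<open>Filtration topologies\<close>

locale filtered_ring = ring +
  fixes F :: "nat \<Rightarrow> 'a set"
  assumes dec: "decseq F" and ideal_F: "ideal (F k) R"
begin

definition T where "T = filtration_topology R F"

lemma openin_T: "openin T V \<longleftrightarrow> V \<subseteq> carrier R \<and> (\<forall>x\<in>V. \<exists>k. \<forall>y\<in>carrier R. y \<ominus> x \<in> F k \<longrightarrow> y \<in> V)"
  unfolding T_def by (rule openin_filtration_topology[OF dec])

lemma additive_F: "additive_subgroup (F k) R"
  using ideal_F ideal.axioms(1) by blast

lemma topspace_T: "topspace T = carrier R"
proof -
  have "openin T (carrier R)" by (simp add: openin_T)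
  then show ?thesis using openin_subset openin_topspace openin_T by (metis subset_antisym)
qed

lemmas F_minus_trans = additive_subgroup_minus_trans[OF additive_F]
  and F_minus_sym = additive_subgroup_minus_sym[OF additive_F]

lemma F_refl: "x \<in> carrier R \<Longrightarrow> x \<ominus> x \<in> F k"
  using additive_subgroup.zero_closed[OF additive_F] by (simp add: a_minus_def r_neg)

lemma open_coset:
  assumes "x \<in> carrier R" shows "openin T {y \<in> carrier R. y \<ominus> x \<in> F k}"
  unfolding openin_T using F_minus_trans assms by blast

lemma limitin_T:
  "limitin T f l G \<longleftrightarrow> l \<in> carrier R \<and> (\<forall>k. eventually (\<lambda>x. f x \<in> carrier R \<and> f x \<ominus> l \<in> F k) G)"
proof
  assume lim: "limitin T f l G"
  then have l: "l \<in> carrier R" by (simp add: limitin_def topspace_T)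
  moreover have "eventually (\<lambda>x. f x \<in> {y \<in> carrier R. y \<ominus> l \<in> F k}) G" for k
    using lim open_coset[OF l] F_refl[OF l] l unfolding limitin_def by blast
  ultimately show "l \<in> carrier R \<and> (\<forall>k. eventually (\<lambda>x. f x \<in> carrier R \<and> f x \<ominus> l \<in> F k) G)" by simp
next
  assume r: "l \<in> carrier R \<and> (\<forall>k. eventually (\<lambda>x. f x \<in> carrier R \<and> f x \<ominus> l \<in> F k) G)"
  show "limitin T f l G" unfolding limitin_def
  proof (intro conjI allI impI)
    show "l \<in> topspace T" using r by (simp add: topspace_T)
    fix V assume "openin T V \<and> l \<in> V"
    then obtain k where "\<forall>y\<in>carrier R. y \<ominus> l \<in> F k \<longrightarrow> y \<in> V" unfolding openin_T by blast
    then show "eventually (\<lambda>x. f x \<in> V) G" using r eventually_mono by (smt (verit, best))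
  qed
qed

lemma continuous_map_into_T:
  assumes "\<And>x. x \<in> topspace X \<Longrightarrow> f x \<in> carrier R"
    and "\<And>x k. x \<in> topspace X \<Longrightarrow> \<exists>U. openin X U \<and> x \<in> U \<and> (\<forall>y\<in>U. f y \<ominus> f x \<in> F k)"
  shows "continuous_map X T f"
  unfolding continuous_map_eq_topcontinuous_at topcontinuous_at_def
proof (intro ballI conjI allI impI)
  fix x assume x: "x \<in> topspace X"
  show "x \<in> topspace X" "f \<in> topspace X \<rightarrow> topspace T" using x assms by (auto simp: topspace_T)
  fix V assume V: "openin T V \<and> f x \<in> V"
  then obtain k where k: "\<forall>y\<in>carrier R. y \<ominus> f x \<in> F k \<longrightarrow> y \<in> V" unfolding openin_T by blast
  obtain U where U: "openin X U" "x \<in> U" "\<forall>y\<in>U. f y \<ominus> f x \<in> F k" using assms(2)[OF x] by blast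
  then have "\<forall>y\<in>U. f y \<in> V" using k assms(1) openin_subset by blast
  then show "\<exists>U. openin X U \<and> x \<in> U \<and> (\<forall>y\<in>U. f y \<in> V)" using U by blast
qed

lemma continuous_map_binary_T:
  assumes "\<And>x y. x \<in> carrier R \<Longrightarrow> y \<in> carrier R \<Longrightarrow> f x y \<in> carrier R"
    and "\<And>x y x' y' k. \<lbrakk>x \<in> carrier R; y \<in> carrier R; x' \<in> carrier R; y' \<in> carrier R; x' \<ominus> x \<in> F k; y' \<ominus> y \<in> F k\<rbrakk> \<Longrightarrow>
      f x' y' \<ominus> f x y \<in> F k"
  shows "continuous_map (prod_topology T T) T (\<lambda>(x, y). f x y)"
proof (rule continuous_map_into_T)
  fix z k assume z: "z \<in> topspace (prod_topology T T)"
  then obtain x y where xy: "z = (x, y)" "x \<in> carrier R" "y \<in> carrier R" by (auto simp: topspace_T)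
  let ?U = "{u \<in> carrier R. u \<ominus> x \<in> F k} \<times> {u \<in> carrier R. u \<ominus> y \<in> F k}"
  have "openin (prod_topology T T) ?U" using open_coset xy by (simp add: openin_prod_Times_iff)
  moreover have "z \<in> ?U" using xy F_refl by simp
  moreover have "\<forall>w\<in>?U. (case w of (x, y) \<Rightarrow> f x y) \<ominus> (case z of (x, y) \<Rightarrow> f x y) \<in> F k"
    using assms(2) xy by auto
  ultimately show "\<exists>U. openin (prod_topology T T) U \<and> z \<in> U \<and>
      (\<forall>w\<in>U. (case w of (x, y) \<Rightarrow> f x y) \<ominus> (case z of (x, y) \<Rightarrow> f x y) \<in> F k)" by blast
qed (use assms(1) in \<open>auto simp: topspace_T\<close>)

lemma topological_ring_T: "topological_ring R T"
  unfolding topological_ring_def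
proof (intro conjI ring_axioms topspace_T)
  show "continuous_map (prod_topology T T) T (\<lambda>(x, y). x \<oplus> y)"
  proof (rule continuous_map_binary_T)
    fix x y x' y' k
    assume "x \<in> carrier R" "y \<in> carrier R" "x' \<in> carrier R" "y' \<in> carrier R" "x' \<ominus> x \<in> F k" "y' \<ominus> y \<in> F k"
    then show "(x' \<oplus> y') \<ominus> (x \<oplus> y) \<in> F k"
      using additive_subgroup.a_closed[OF additive_F] by (simp add: minus_add_minus)
  qed auto
  show "continuous_map T T (\<lambda>x. \<ominus> x)"
  proof (rule continuous_map_into_T)
    fix x k assume "x \<in> topspace T"
    then have x: "x \<in> carrier R" by (simp add: topspace_T)
    have "\<ominus> y \<ominus> \<ominus> x \<in> F k" if "y \<in> carrier R" "y \<ominus> x \<in> F k" for y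
    proof -
      have "\<ominus> y \<ominus> \<ominus> x = \<ominus> (y \<ominus> x)" using that(1) x by algebra
      then show ?thesis using additive_subgroup.a_inv_closed[OF additive_F that(2)] by simp
    qed
    then show "\<exists>U. openin T U \<and> x \<in> U \<and> (\<forall>y\<in>U. \<ominus> y \<ominus> \<ominus> x \<in> F k)"
      using open_coset[OF x] F_refl[OF x] x by (intro exI[of _ "{y \<in> carrier R. y \<ominus> x \<in> F k}"]) auto
  qed (auto simp: topspace_T)
  show "continuous_map (prod_topology T T) T (\<lambda>(x, y). x \<otimes> y)"
  proof (rule continuous_map_binary_T)
    fix x y x' y' k
    assume a: "x \<in> carrier R" "y \<in> carrier R" "x' \<in> carrier R" "y' \<in> carrier R" "x' \<ominus> x \<in> F k" "y' \<ominus> y \<in> F k"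
    have "x' \<otimes> y' \<ominus> x \<otimes> y = (x' \<ominus> x) \<otimes> y' \<oplus> x \<otimes> (y' \<ominus> y)"
      using a minus_telescope[of "x' \<otimes> y'" "x \<otimes> y'" "x \<otimes> y"]
      by (simp add: a_minus_def l_distr r_distr l_minus r_minus)
    moreover have "(x' \<ominus> x) \<otimes> y' \<in> F k" using ideal.I_r_closed[OF ideal_F a(5) a(4)] .
    moreover have "x \<otimes> (y' \<ominus> y) \<in> F k" using ideal.I_l_closed[OF ideal_F a(6) a(1)] .
    ultimately show "x' \<otimes> y' \<ominus> x \<otimes> y \<in> F k" using additive_subgroup.a_closed[OF additive_F] by metis
  qed auto
qed

lemma Hausdorff_T:
  assumes "\<And>x. x \<in> carrier R \<Longrightarrow> (\<And>k. x \<in> F k) \<Longrightarrow> x = \<zero>"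
  shows "Hausdorff_space T"
  unfolding Hausdorff_space_def
proof (intro allI impI)
  fix x y assume "x \<in> topspace T \<and> y \<in> topspace T \<and> x \<noteq> y"
  then have xy: "x \<in> carrier R" "y \<in> carrier R" "x \<noteq> y" by (auto simp: topspace_T)
  then obtain k where k: "x \<ominus> y \<notin> F k"
    using assms[of "x \<ominus> y"] r_right_minus_eq[OF xy(1,2)] minus_closed by blast
  have "disjnt {z \<in> carrier R. z \<ominus> x \<in> F k} {z \<in> carrier R. z \<ominus> y \<in> F k}"
    unfolding disjnt_iff using k F_minus_trans F_minus_sym xy by blast
  then show "\<exists>U V. openin T U \<and> openin T V \<and> x \<in> U \<and> y \<in> V \<and> disjnt U V"
    using open_coset xy F_refl by (intro exI conjI) auto
qed

end

section \<open>The isomorphism with the skew power series ring\<close>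

context ring
begin

text \<open>The additive inverse is selected within the carrier of the record, so restricting the
  carrier does not preserve it by definition; uniqueness of inverses does.\<close>

lemma subring_a_inv:
  assumes "subring H R" "x \<in> H" shows "\<ominus>\<^bsub>R\<lparr>carrier := H\<rparr>\<^esub> x = \<ominus> x"
proof -
  interpret H: ring "R\<lparr>carrier := H\<rparr>" using subring_is_ring[OF assms(1)] .
  have "\<ominus> x \<in> H" "x \<in> carrier R" using subringE(1,5)[OF assms(1)] assms(2) by auto
  then show ?thesis using H.minus_equality[of "\<ominus> x" x] assms(2) by (simp add: l_neg)
qed

lemma subring_a_minus:
  assumes "subring H R" "x \<in> H" "y \<in> H" shows "x \<ominus>\<^bsub>R\<lparr>carrier := H\<rparr>\<^esub> y = x \<ominus> y"
  using subring_a_inv[OF assms(1,3)] by (simp add: a_minus_def)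

lemma subring_add_pow: "[(n::nat)] \<cdot>\<^bsub>R\<lparr>carrier := H\<rparr>\<^esub> x = [n] \<cdot> x"
  by (simp add: add_pow_def nat_pow_def)

lemma subring_finsum:
  assumes "subring H R" "finite A" "\<And>i. i \<in> A \<Longrightarrow> f i \<in> H"
  shows "finsum (R\<lparr>carrier := H\<rparr>) f A = finsum R f A"
proof -
  interpret H: ring "R\<lparr>carrier := H\<rparr>" using subring_is_ring[OF assms(1)] .
  have HR: "H \<subseteq> carrier R" using subringE(1)[OF assms(1)] .
  show ?thesis using assms(2,3)
  proof (induction A)
    case (insert x A)
    have "finsum (R\<lparr>carrier := H\<rparr>) f (insert x A) = f x \<oplus>\<^bsub>R\<lparr>carrier := H\<rparr>\<^esub> finsum (R\<lparr>carrier := H\<rparr>) f A"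
      using insert by (intro H.finsum_insert) auto
    moreover have "finsum R f (insert x A) = f x \<oplus> finsum R f A"
      using insert HR by (intro finsum_insert) auto
    ultimately show ?case using insert by simp
  qed simp
qed

end

context skew_generator
begin

section \<open>The coefficient ring as a complete filtered ring\<close>

abbreviation RR where "RR \<equiv> S\<lparr>carrier := R\<rparr>"

abbreviation FR where "FR \<equiv> \<lambda>k. R \<inter> F k"

sublocale FS: filtered_ring S F
proof (intro filtered_ring.intro filtered_ring_axioms.intro F_ideal ring_axioms)
  show "decseq F" unfolding decseq_def using F_antimono by blast
qed

lemma FR_ideal: "ideal (FR k) RR"
proof (rule idealI)
  show RRr: "ring RR" using subring_is_ring[OF R_subring] .
  interpret RR: ring RR by (rule RRr)
  show "subgroup (FR k) (add_monoid RR)"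
  proof (rule RR.add.subgroupI)
    show "FR k \<noteq> {}" using R_zero additive_subgroup.zero_closed[OF F_additive] by blast
    show "\<ominus>\<^bsub>RR\<^esub> x \<in> FR k" if "x \<in> FR k" for x
      using that subring_a_inv[OF R_subring, of x] R_uminus additive_subgroup.a_inv_closed[OF F_additive] by auto
  qed (auto intro: R_add additive_subgroup.a_closed[OF F_additive])
qed (auto intro: R_mult ideal.I_l_closed[OF F_ideal] ideal.I_r_closed[OF F_ideal] R_carrier)

sublocale FR: filtered_ring RR FR
proof (intro filtered_ring.intro filtered_ring_axioms.intro FR_ideal)
  show "ring RR" using subring_is_ring[OF R_subring] .
  show "decseq FR" unfolding decseq_def using F_antimono by blast
qed

lemma RR_minus: "x \<in> R \<Longrightarrow> y \<in> R \<Longrightarrow> x \<ominus>\<^bsub>RR\<^esub> y = x \<ominus> y"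
  using subring_a_minus[OF R_subring] .

lemma F_separated: "x \<in> carrier S \<Longrightarrow> (\<And>k. x \<in> F k) \<Longrightarrow> x = \<zero>"
  using separated F_small by blast

lemma Hausdorff_FR: "Hausdorff_space FR.T"
  using F_separated R_carrier by (intro FR.Hausdorff_T) auto

text \<open>Filtration topology and \<open>\<K>\<close> interact here: a Cauchy filter for the
  filtration has a limit in the coarser topology by completeness of \<open>S\<close>, the limit lies
  in \<open>R\<close> because \<open>R\<close> is closed, and it is a limit for the filtration
  because every \<open>F l\<close> is closed.\<close>

lemma complete_FR: "complete_topological_ring RR FR.T"
  unfolding complete_topological_ring_def
proof (intro conjI allI impI FR.topological_ring_T Hausdorff_FR)
  fix \<F> assume \<F>: "\<F> \<noteq> bot \<and> ring_cauchy_filter RR FR.T \<F>"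
  have "\<exists>M\<subseteq>R. eventually (\<lambda>x. x \<in> M) \<F> \<and> (\<forall>x\<in>M. \<forall>y\<in>M. x \<ominus> y \<in> F k)" for k
  proof -
    have "openin FR.T {y \<in> carrier RR. y \<ominus>\<^bsub>RR\<^esub> \<zero> \<in> FR k}"
      using FR.open_coset[of \<zero> k] R_zero by simp
    moreover have "\<zero>\<^bsub>RR\<^esub> \<in> {y \<in> carrier RR. y \<ominus>\<^bsub>RR\<^esub> \<zero> \<in> FR k}"
      using FR.F_refl[of \<zero> k] R_zero by simp
    ultimately obtain M where "M \<subseteq> carrier RR" "eventually (\<lambda>x. x \<in> M) \<F>"
      and M: "\<forall>x\<in>M. \<forall>y\<in>M. x \<ominus>\<^bsub>RR\<^esub> y \<in> {y \<in> carrier RR. y \<ominus>\<^bsub>RR\<^esub> \<zero> \<in> FR k}"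
      using \<F> unfolding ring_cauchy_filter_def by meson
    moreover from this have "x \<ominus> y \<in> F k" if "x \<in> M" "y \<in> M" for x y
    proof -
      have "x \<in> R" "y \<in> R" using that \<open>M \<subseteq> carrier RR\<close> by auto
      then have "x \<ominus>\<^bsub>RR\<^esub> y = x \<ominus> y" "(x \<ominus> y) \<ominus>\<^bsub>RR\<^esub> \<zero> = x \<ominus> y"
        using R_minus[of x y] R_zero R_carrier[of "x \<ominus> y"] by (simp_all add: RR_minus)
      then show ?thesis using M that by force
    qed
    ultimately show ?thesis by (intro exI[of _ M]) auto
  qed
  then obtain M where M: "\<And>k. M k \<subseteq> R" "\<And>k. eventually (\<lambda>x. x \<in> M k) \<F>"
    "\<And>k x y. x \<in> M k \<Longrightarrow> y \<in> M k \<Longrightarrow> x \<ominus> y \<in> F k" by metis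
  \<comment> \<open>The filter is proper, so two sets that hold eventually have a common point; this
    replaces a nested choice of the sets \<open>M k\<close>.\<close>
  have meet: "\<exists>z. z \<in> M k \<and> z \<in> M l" for k l
    using eventually_happens'[OF _ eventually_conj[OF M(2)[of k] M(2)[of l]]] \<F> by blast
  have "\<forall>K\<in>\<K>. \<exists>k. F k \<subseteq> K" using F_small by blast
  then obtain k where k: "\<And>K. K \<in> \<K> \<Longrightarrow> F (k K) \<subseteq> K" by metis
  obtain x where x: "\<And>k. x k \<in> M k" using meet by metis
  have xS: "x k \<in> carrier S" for k using x M(1) R_carrier by blast
  have MS: "z \<in> M k \<Longrightarrow> z \<in> carrier S" for z k using M(1) R_carrier by blast
  have "\<exists>y\<in>carrier S. \<forall>K\<in>\<K>. y \<ominus> x (k K) \<in> K"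
  proof (rule complete)
    fix K L assume KL: "K \<in> \<K>" "L \<in> \<K>" "K \<subseteq> L"
    obtain z where z: "z \<in> M (k K)" "z \<in> M (k L)" using meet by blast
    have "x (k K) \<ominus> z \<in> L" "z \<ominus> x (k L) \<in> L"
      using M(3)[OF x z(1)] M(3)[OF z(2) x] k[OF KL(1)] k[OF KL(2)] KL(3) by blast+
    then show "x (k K) \<ominus> x (k L) \<in> L"
      using additive_subgroup_minus_trans[OF additive_nbhd[OF KL(2)] xS MS[OF z(1)] xS] by blast
  qed (use xS in auto)
  then obtain y where y: "y \<in> carrier S" "\<And>K. K \<in> \<K> \<Longrightarrow> y \<ominus> x (k K) \<in> K" by blast
  have "y \<in> cl R" unfolding cl_def using y x M(1) by blast
  then have yR: "y \<in> R" using R_closed by blast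
  have "z \<ominus> y \<in> F l" if z: "z \<in> M l" for z l
  proof (rule cl_FI)
    show "z \<ominus> y \<in> carrier S" using MS[OF z] y by auto
    fix K assume K: "K \<in> \<K>"
    \<comment> \<open>The point \<open>w\<close> is close to \<open>y\<close> modulo
      \<open>K\<close> and differs from \<open>z\<close> by an element of \<open>F l\<close>; thus
      \<open>z \<ominus> y\<close> is approximated from \<open>F l\<close>.\<close>
    obtain w where w: "w \<in> M l" "w \<in> M (k K)" using meet by blast
    have "w \<ominus> x (k K) \<in> K" using M(3)[OF w(2) x] k[OF K] by blast
    then have "y \<ominus> w \<in> K"
      using additive_subgroup_minus_trans[OF additive_nbhd[OF K] y(1) xS MS[OF w(1)] y(2)[OF K]]
        additive_subgroup_minus_sym[OF additive_nbhd[OF K] MS[OF w(1)] xS] by blast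
    moreover have "(z \<ominus> y) \<ominus> (z \<ominus> w) = w \<ominus> y"
      using MS[OF z] MS[OF w(1)] y(1) by algebra
    ultimately have "(z \<ominus> y) \<ominus> (z \<ominus> w) \<in> K"
      using additive_subgroup_minus_sym[OF additive_nbhd[OF K] y(1) MS[OF w(1)]] by simp
    then show "\<exists>a\<in>F l. z \<ominus> y \<ominus> a \<in> K" using M(3)[OF z w(1)] by blast
  qed
  then have "eventually (\<lambda>z. z \<in> carrier RR \<and> z \<ominus>\<^bsub>RR\<^esub> y \<in> FR l) \<F>" for l
    using M(1)[of l] yR by (intro eventually_mono[OF M(2)[of l]]) (auto simp: RR_minus R_minus subset_eq)
  then show "\<exists>l. limitin FR.T (\<lambda>x. x) l \<F>"
    unfolding FR.limitin_T using yR by auto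
qed

definition ddl :: "'a \<Rightarrow> 'a" where "ddl = skew_derivation RR sg"

lemma ddl_pow: "x \<in> R \<Longrightarrow> (ddl ^^ n) x = (dl ^^ n) x"
proof (induction n)
  case (Suc n)
  have "ddl y = dl y" if "y \<in> R" for y
    using that by (simp add: ddl_def dl_def skew_derivation_def RR_minus sg_R)
  then show ?case using Suc dl_pow_R[of x n] by simp
qed simp

section \<open>The skew power series ring over \<open>R\<close>\<close>

abbreviation P where "P \<equiv> skew_power_series_ring RR FR.T sg ddl"

lemma summand_eq:
  assumes "\<And>i. a i \<in> R"
  shows "skew_summand RR sg ddl a b m n k = [(k choose n)] \<cdot> ((dl ^^ (k - n)) ((sg ^^ n) (a (m - n)))) \<otimes> b k"
  by (simp add: skew_summand_def subring_add_pow ddl_pow[OF sg_pow_R[OF assms]])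

lemma R_add_pow: "x \<in> R \<Longrightarrow> [(n::nat)] \<cdot> x \<in> R"
  by (induction n) (auto simp: R_zero R_add)

lemma R_finsum: "finite A \<Longrightarrow> (\<And>i. i \<in> A \<Longrightarrow> f i \<in> R) \<Longrightarrow> (\<Oplus>i\<in>A. f i) \<in> R"
proof (induction A rule: finite_induct)
  case (insert x A)
  then show ?case using R_carrier by (subst finsum_insert) (auto intro!: R_add)
qed (simp add: R_zero)

text \<open>Identifies the inner sum for \<open>n\<close> as the coefficient of index
  \<open>n\<close> of \<open>a (m - n) \<otimes> y\<close>. The error of the partial sum up to
  \<open>M\<close> lies in \<open>F (M - n)\<close>, whence the bound \<open>l + n\<close>.\<close>

lemma sums_coef:
  assumes a: "\<And>i. a i \<in> R" and y: "y \<in> carrier S"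
  shows "series_sums_from RR FR.T n (skew_summand RR sg ddl a (coef y) m n) (coef (a (m - n) \<otimes> y) n)"
  unfolding series_sums_from_def FR.limitin_T
proof (intro conjI allI)
  let ?f = "skew_summand RR sg ddl a (coef y) m n"
  have c: "coef (a (m - n) \<otimes> y) n \<in> R" using R_carrier[OF a] y by (intro coef_in_R) auto
  then show "coef (a (m - n) \<otimes> y) n \<in> carrier RR" by simp
  have fR: "?f k \<in> R" for k
    unfolding summand_eq[of a, OF a] by (intro R_mult R_add_pow dl_pow_R sg_pow_R a coef_in_R y)
  have fin: "finsum RR ?f {n..<M} = (\<Oplus>k\<in>{n..<M}. ?f k)" "(\<Oplus>k\<in>{n..<M}. ?f k) \<in> R" for M
    using subring_finsum[OF R_subring, of "{n..<M}" ?f] R_finsum[of "{n..<M}" ?f] fR by auto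
  fix l
  have "finsum RR ?f {n..<M} \<ominus> coef (a (m - n) \<otimes> y) n \<in> F l" if "M \<ge> l + n" for M
  proof -
    have "coef (a (m - n) \<otimes> y) n \<ominus> (\<Oplus>k\<in>{n..<M}. ?f k) \<in> F (M - n)"
      using coef_const_mult_tail[OF a y] by (simp add: summand_eq[of a, OF a])
    then have "coef (a (m - n) \<otimes> y) n \<ominus> (\<Oplus>k\<in>{n..<M}. ?f k) \<in> F l"
      using F_antimono[OF add_le_imp_le_diff[OF that]] by blast
    then show ?thesis unfolding fin
      using additive_subgroup_minus_sym[OF F_additive R_carrier[OF c] R_carrier[OF fin(2)]] by blast
  qed
  then show "eventually (\<lambda>M. finsum RR ?f {n..<M} \<in> carrier RR \<and>
      finsum RR ?f {n..<M} \<ominus>\<^bsub>RR\<^esub> coef (a (m - n) \<otimes> y) n \<in> FR l) sequentially"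
    unfolding eventually_sequentially using fin c R_minus by (intro exI[of _ "l + n"]) (auto simp: RR_minus)
qed

lemma sums_unique:
  assumes "series_sums_from RR FR.T n f l" shows "(THE l. series_sums_from RR FR.T n f l) = l"
  using assms limitin_Hausdorff_unique[OF _ _ sequentially_bot Hausdorff_FR]
  unfolding series_sums_from_def by (intro the_equality) blast+

lemma carrier_P: "carrier P = {a. \<forall>i. a i \<in> R}"
  by (simp add: skew_power_series_ring_def)

text \<open>Bijectivity is existence and uniqueness of expansions. The product rule is
  \<open>coef_mult\<close>, each summand there being the limit of the corresponding inner
  sum.\<close>

lemma coef_iso: "coef \<in> ring_iso S P"
proof (rule ring_iso_memI)
  show "coef x \<in> carrier P" if "x \<in> carrier S" for x using coef_in_R[OF that] by (simp add: carrier_P)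
  show "coef (x \<otimes> y) = coef x \<otimes>\<^bsub>P\<^esub> coef y" if x: "x \<in> carrier S" and y: "y \<in> carrier S" for x y
  proof
    fix m
    have "(coef x \<otimes>\<^bsub>P\<^esub> coef y) m = finsum RR (\<lambda>n. coef (coef x (m - n) \<otimes> y) n) {0..m}"
      unfolding skew_power_series_ring_def
      by (simp add: sums_unique[OF sums_coef[of "coef x", OF coef_in_R[OF x] y]])
    also have "\<dots> = (\<Oplus>n\<in>{0..m}. coef (coef x (m - n) \<otimes> y) n)"
      using x y by (intro subring_finsum R_subring coef_in_R m_closed coef_closed) auto
    finally show "coef (x \<otimes> y) m = (coef x \<otimes>\<^bsub>P\<^esub> coef y) m" using coef_mult[OF x y] by simp
  qed
  show "coef (x \<oplus> y) = coef x \<oplus>\<^bsub>P\<^esub> coef y" if "x \<in> carrier S" "y \<in> carrier S" for x y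
    using coef_add[OF that] by (simp add: skew_power_series_ring_def)
  show "coef \<one> = \<one>\<^bsub>P\<^esub>"
    using coef_const[OF R_one] by (auto simp: skew_power_series_ring_def split: nat.split)
  show "bij_betw coef (carrier S) (carrier P)"
    by (rule bij_betw_byWitness[of _ val]) (auto simp: carrier_P val_coef coef_val val_closed coef_in_R)
qed

text \<open>The ring axioms are transported along the bijection instead of being checked on the
  product formula. The transport yields a record whose zero is the image of zero, which is the same
  element.\<close>

lemma ring_P: "ring P"
proof -
  have "ring (P\<lparr>zero := coef \<zero>\<rparr>)" using ring_iso_imp_img_ring[OF coef_iso] .
  moreover have "P\<lparr>zero := coef \<zero>\<rparr> = P" unfolding coef_zero by (simp add: skew_power_series_ring_def)
  ultimately show ?thesis by simp
qed

lemma sg_iso: "sg \<in> ring_iso RR RR"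
proof (rule ring_iso_memI)
  show "sg x \<in> carrier RR" if "x \<in> carrier RR" for x using that sg_R by simp
  show "sg (x \<otimes>\<^bsub>RR\<^esub> y) = sg x \<otimes>\<^bsub>RR\<^esub> sg y" if "x \<in> carrier RR" "y \<in> carrier RR" for x y
  proof -
    have xy: "x \<in> carrier S" "y \<in> carrier S" using that R_carrier by auto
    have "h \<otimes> x \<otimes> g \<otimes> (h \<otimes> y \<otimes> g) = h \<otimes> x \<otimes> (g \<otimes> h) \<otimes> y \<otimes> g"
      using xy by (simp add: m_assoc)
    then show ?thesis using xy by (simp add: sg_def g_h m_assoc)
  qed
  show "sg (x \<oplus>\<^bsub>RR\<^esub> y) = sg x \<oplus>\<^bsub>RR\<^esub> sg y" if "x \<in> carrier RR" "y \<in> carrier RR" for x y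
    using that R_carrier by (simp add: sg_add)
  show "sg \<one>\<^bsub>RR\<^esub> = \<one>\<^bsub>RR\<^esub>" by (simp add: sg_def h_g)
  show "bij_betw sg (carrier RR) (carrier RR)"
  proof (rule bij_betw_byWitness[of _ "\<lambda>x. g \<otimes> x \<otimes> h"])
    have 1: "g \<otimes> (h \<otimes> x \<otimes> g) \<otimes> h = (g \<otimes> h) \<otimes> x \<otimes> (g \<otimes> h)" if "x \<in> carrier S" for x
      using that by (simp add: m_assoc)
    have 2: "h \<otimes> (g \<otimes> x \<otimes> h) \<otimes> g = (h \<otimes> g) \<otimes> x \<otimes> (h \<otimes> g)" if "x \<in> carrier S" for x
      using that by (simp add: m_assoc)
    show "\<forall>x\<in>carrier RR. g \<otimes> sg x \<otimes> h = x" using 1 R_carrier by (simp add: sg_def g_h)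
    show "\<forall>x\<in>carrier RR. sg (g \<otimes> x \<otimes> h) = x" using 2 R_carrier by (simp add: sg_def h_g)
  qed (use sg_R conj_inv_R in auto)
qed

lemma sg_continuous: "continuous_map FR.T FR.T sg"
proof (rule FR.continuous_map_into_T)
  show "sg x \<in> carrier RR" if "x \<in> topspace FR.T" for x using that sg_R by (simp add: FR.topspace_T)
  fix x k assume "x \<in> topspace FR.T"
  then have x: "x \<in> R" by (simp add: FR.topspace_T)
  have "sg y \<ominus>\<^bsub>RR\<^esub> sg x \<in> FR k" if "y \<in> R" "y \<ominus>\<^bsub>RR\<^esub> x \<in> FR k" for y
    using that x sg_F[of "y \<ominus> x" k] R_carrier by (simp add: RR_minus sg_R R_minus sg_minus)
  then show "\<exists>U. openin FR.T U \<and> x \<in> U \<and> (\<forall>y\<in>U. sg y \<ominus>\<^bsub>RR\<^esub> sg x \<in> FR k)"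
    using FR.open_coset[of x k] FR.F_refl[of x k] x
    by (intro exI[of _ "{y \<in> carrier RR. y \<ominus>\<^bsub>RR\<^esub> x \<in> FR k}"]) auto
qed

lemma exists_P: "skew_power_series_ring_exists RR FR.T sg ddl"
  unfolding skew_power_series_ring_exists_def
proof (intro conjI complete_FR sg_iso sg_continuous ring_P ballI allI impI)
  show "ddl x = sg x \<ominus>\<^bsub>RR\<^esub> x" for x by (simp add: ddl_def skew_derivation_def)
  fix a b m n assume "a \<in> carrier P" "b \<in> carrier P"
  then have a: "\<And>i. a i \<in> R" and b: "\<And>i. b i \<in> R" by (auto simp: carrier_P)
  \<comment> \<open>Every sequence in \<open>R\<close> is the coefficient sequence of its value in
    \<open>S\<close>, so convergence for arbitrary \<open>b\<close> is the case already
    treated.\<close>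
  show "\<exists>l. series_sums_from RR FR.T n (skew_summand RR sg ddl a b m n) l"
    using sums_coef[of a "val b" n m, OF a] val_closed[of b, OF b] coef_val[of b, OF b] by auto
qed

text \<open>Both inclusions between \<open>F\<close> and \<open>J\<close> are used: elements of
  \<open>F (k + i)\<close> have their coefficient of index \<open>i\<close> in \<open>F k\<close>,
  and series whose first \<open>k\<close> coefficients agree modulo \<open>F k\<close> differ by an
  element of \<open>J k\<close>.\<close>

lemma coef_homeomorphic: "homeomorphic_map FS.T (skew_power_series_topology FR.T) coef"
proof -
  have "continuous_map FS.T (skew_power_series_topology FR.T) coef"
    unfolding skew_power_series_topology_def continuous_map_componentwise_UNIV
  proof
    fix i
    show "continuous_map FS.T FR.T (\<lambda>x. coef x i)"
    proof (rule FR.continuous_map_into_T)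
      show "coef x i \<in> carrier RR" if "x \<in> topspace FS.T" for x
        using that coef_in_R by (simp add: FS.topspace_T)
      fix x k assume "x \<in> topspace FS.T"
      then have x: "x \<in> carrier S" by (simp add: FS.topspace_T)
      have "coef y i \<ominus>\<^bsub>RR\<^esub> coef x i \<in> FR k" if "y \<in> carrier S" "y \<ominus> x \<in> F (k + i)" for y
        using coef_F[OF that(2), of i] that(1) x coef_in_R by (simp add: RR_minus coef_minus R_minus)
      then show "\<exists>U. openin FS.T U \<and> x \<in> U \<and> (\<forall>y\<in>U. coef y i \<ominus>\<^bsub>RR\<^esub> coef x i \<in> FR k)"
        using FS.open_coset[OF x, of "k + i"] FS.F_refl[OF x, of "k + i"] x
        by (intro exI[of _ "{y \<in> carrier S. y \<ominus> x \<in> F (k + i)}"]) auto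
    qed
  qed
  moreover have "continuous_map (skew_power_series_topology FR.T) FS.T val"
  proof (rule FS.continuous_map_into_T)
    have ts: "topspace (skew_power_series_topology FR.T) = {a. \<forall>i. a i \<in> R}"
      by (auto simp: skew_power_series_topology_def FR.topspace_T PiE_def Pi_def)
    show "val a \<in> carrier S" if "a \<in> topspace (skew_power_series_topology FR.T)" for a
      using that val_closed unfolding ts by auto
    fix a k assume "a \<in> topspace (skew_power_series_topology FR.T)"
    then have a: "\<And>i. a i \<in> R" unfolding ts by auto
    \<comment> \<open>Only the first \<open>k\<close> coordinates are constrained, so the box is
      open in the product topology. Closeness modulo \<open>F k\<close> is more than the weights
      \<open>k - i\<close> demand.\<close>
    let ?V = "\<lambda>i. if i < k then {y \<in> carrier RR. y \<ominus>\<^bsub>RR\<^esub> a i \<in> FR k} else topspace FR.T"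
    let ?U = "PiE UNIV ?V"
    have "openin (skew_power_series_topology FR.T) ?U"
      unfolding skew_power_series_topology_def
    proof (rule product_topology_basis)
      show "openin FR.T (?V i)" for i using FR.open_coset[of "a i" k] a by auto
      show "finite {i. ?V i \<noteq> topspace FR.T}"
        by (rule finite_subset[of _ "{..<k}"]) auto
    qed
    moreover have "a \<in> ?U"
      using a R_zero additive_subgroup.zero_closed[OF F_additive] by (auto simp: FR.topspace_T)
    moreover have "val b \<ominus> val a \<in> F k" if "b \<in> ?U" for b
    proof -
      have bV: "b i \<in> ?V i" for i using that by (auto simp: PiE_def Pi_def)
      have b: "b i \<in> R" for i using bV[of i] by (auto simp: FR.topspace_T split: if_splits)
      have ba: "b i \<ominus> a i \<in> F k" if "i < k" for i
        using bV[of i] that a b by (auto simp: RR_minus)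
      have "coef (val b \<ominus> val a) i \<in> F (k - i)" for i
      proof (cases "i < k")
        case True
        then show ?thesis using ba[OF True] F_antimono[of "k - i" k] val_closed[of a, OF a] val_closed[of b, OF b]
          by (auto simp: coef_minus coef_val[of a, OF a] coef_val[of b, OF b])
      next
        case False
        then show ?thesis using val_closed[of a, OF a] val_closed[of b, OF b] coef_closed by (simp add: F_0)
      qed
      then have "val b \<ominus> val a \<in> J k"
        using val_closed[of a, OF a] val_closed[of b, OF b] unfolding J_def by simp
      then show ?thesis using J_subset_F by blast
    qed
    ultimately show "\<exists>U. openin (skew_power_series_topology FR.T) U \<and> a \<in> U \<and> (\<forall>b\<in>U. val b \<ominus> val a \<in> F k)"
      by blast
  qed
  moreover have "topspace (skew_power_series_topology FR.T) = {a. \<forall>i. a i \<in> R}"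
    by (auto simp: skew_power_series_topology_def FR.topspace_T PiE_def Pi_def)
  ultimately have "homeomorphic_maps FS.T (skew_power_series_topology FR.T) coef val"
    unfolding homeomorphic_maps_def using val_coef coef_val by (simp add: FS.topspace_T)
  then show ?thesis using homeomorphic_maps_imp_map by blast
qed

theorem skew_power_series_isomorphism:
  "skew_power_series_ring_exists RR FR.T sg ddl \<and>
   isomorphic_topological_rings S FS.T P (skew_power_series_topology FR.T)"
  unfolding isomorphic_topological_rings_def using exists_P coef_iso coef_homeomorphic by blast

end

section \<open>Group rings of finite groups\<close>

locale finite_group_ring = group H for H (structure) +
  fixes p :: nat
  assumes finite_H [simp]: "finite (carrier H)" and p_gt_1: "1 < p"
begin

abbreviation Fp where "Fp \<equiv> residue_ring (int p)"

abbreviation A where "A \<equiv> group_ring Fp H"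

lemma Fp_simps [simp]: "carrier Fp = {0..int p - 1}" "a \<otimes>\<^bsub>Fp\<^esub> b = (a * b) mod int p" "\<one>\<^bsub>Fp\<^esub> = 1"
  "\<zero>\<^bsub>Fp\<^esub> = 0" "a \<oplus>\<^bsub>Fp\<^esub> b = (a + b) mod int p"
  by (simp_all add: residue_ring_def)

end

text \<open>Sums over the prime field become integer sums reduced once at the end, so that
  coefficient computations can be carried out with ordinary sums over the integers.\<close>

lemma residue_ring_finsum:
  assumes p: "1 < (p::nat)" and "finite I" "\<And>i. i \<in> I \<Longrightarrow> f i \<in> {0..int p - 1}"
  shows "finsum (residue_ring (int p)) f I = (\<Sum>i\<in>I. f i) mod int p"
proof -
  interpret residues "int p" "residue_ring (int p)" using p by unfold_locales auto
  show ?thesis using assms(2,3)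
  proof (induction I)
    case empty
    then show ?case by (simp add: res_zero_eq)
  next
    case (insert i I)
    have "finsum (residue_ring (int p)) f (insert i I) = f i \<oplus>\<^bsub>residue_ring (int p)\<^esub> finsum (residue_ring (int p)) f I"
      using insert by (intro finsum_insert) (auto simp: residue_ring_def)
    then show ?case using insert by (simp add: residue_ring_def mod_add_right_eq)
  qed
qed

lemma mod_in_residues: "1 < (p::nat) \<Longrightarrow> (a::int) mod int p \<in> {0..int p - 1}"
  using pos_mod_bound[of "int p" a] by simp

lemma mod_residues: "a \<in> {0..int p - 1} \<Longrightarrow> a mod int p = a"
  by simp

context finite_group_ring
begin

section \<open>Coefficients and ring axioms\<close>

lemma carrier_A: "carrier A = carrier H \<rightarrow>\<^sub>E {0..int p - 1}"
  by (simp add: group_ring_def)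

lemma coeff_range: "x \<in> carrier A \<Longrightarrow> u \<in> carrier H \<Longrightarrow> x u \<in> {0..int p - 1}"
  by (auto simp: carrier_A)

lemma A_eqI:
  assumes "x \<in> carrier A" "y \<in> carrier A" "\<And>u. u \<in> carrier H \<Longrightarrow> x u = y u" shows "x = y"
  using assms unfolding carrier_A by (rule PiE_ext)

lemma A_mult:
  assumes "h \<in> carrier H"
  shows "(x \<otimes>\<^bsub>A\<^esub> y) h = (\<Sum>u\<in>carrier H. x u * y (inv u \<otimes> h)) mod int p"
proof -
  have "(x \<otimes>\<^bsub>A\<^esub> y) h = finsum Fp (\<lambda>u. (x u * y (inv u \<otimes> h)) mod int p) (carrier H)"
    using assms by (simp add: group_ring_def)
  also have "\<dots> = (\<Sum>u\<in>carrier H. (x u * y (inv u \<otimes> h)) mod int p) mod int p"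
    using p_gt_1 by (intro residue_ring_finsum mod_in_residues) auto
  finally show ?thesis by (simp add: mod_sum_eq)
qed

lemma A_add: "h \<in> carrier H \<Longrightarrow> (x \<oplus>\<^bsub>A\<^esub> y) h = (x h + y h) mod int p"
  by (simp add: group_ring_def)

lemma A_one: "h \<in> carrier H \<Longrightarrow> \<one>\<^bsub>A\<^esub> h = (if h = \<one> then 1 else 0)"
  by (simp add: group_ring_def)

lemma A_zero: "h \<in> carrier H \<Longrightarrow> \<zero>\<^bsub>A\<^esub> h = 0"
  by (simp add: group_ring_def)

lemma A_mult_closed: "x \<otimes>\<^bsub>A\<^esub> y \<in> carrier A"
proof -
  have "(x \<otimes>\<^bsub>A\<^esub> y) h \<in> {0..int p - 1}" if "h \<in> carrier H" for h
    unfolding A_mult[OF that] using p_gt_1 by (rule mod_in_residues)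
  then show ?thesis unfolding carrier_A by (auto simp: group_ring_def)
qed

lemma A_add_closed: "x \<oplus>\<^bsub>A\<^esub> y \<in> carrier A"
proof -
  have "(x \<oplus>\<^bsub>A\<^esub> y) h \<in> {0..int p - 1}" if "h \<in> carrier H" for h
    unfolding A_add[OF that] using p_gt_1 by (rule mod_in_residues)
  then show ?thesis unfolding carrier_A by (auto simp: group_ring_def)
qed

lemma A_one_closed: "\<one>\<^bsub>A\<^esub> \<in> carrier A" and A_zero_closed: "\<zero>\<^bsub>A\<^esub> \<in> carrier A"
  using p_gt_1 by (auto simp: group_ring_def)

lemma sum_translate:
  assumes "v \<in> carrier H" shows "(\<Sum>u\<in>carrier H. f (inv v \<otimes> u)) = (\<Sum>u\<in>carrier H. f u)"
  using assms by (intro sum.reindex_bij_witness[of _ "\<lambda>u. v \<otimes> u" "\<lambda>u. inv v \<otimes> u"]) (auto simp flip: m_assoc)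

lemma sum_mod_mult_left: "(\<Sum>u\<in>I. (f u mod int p) * k u) mod int p = (\<Sum>u\<in>I. f u * k u) mod int p"
  by (subst (1 2) mod_sum_eq[symmetric]) (simp add: mod_mult_left_eq)

lemma sum_mod_mult_right: "(\<Sum>u\<in>I. k u * (f u mod int p)) mod int p = (\<Sum>u\<in>I. k u * f u) mod int p"
  by (subst (1 2) mod_sum_eq[symmetric]) (simp add: mod_mult_right_eq)

lemma A_assoc: "(x \<otimes>\<^bsub>A\<^esub> y) \<otimes>\<^bsub>A\<^esub> z = x \<otimes>\<^bsub>A\<^esub> (y \<otimes>\<^bsub>A\<^esub> z)"
proof (rule A_eqI[OF A_mult_closed A_mult_closed])
  fix h assume h: "h \<in> carrier H"
  have "((x \<otimes>\<^bsub>A\<^esub> y) \<otimes>\<^bsub>A\<^esub> z) h = (\<Sum>u\<in>carrier H. (\<Sum>v\<in>carrier H. x v * y (inv v \<otimes> u)) * z (inv u \<otimes> h)) mod int p"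
    unfolding A_mult[OF h, of "x \<otimes>\<^bsub>A\<^esub> y"] by (simp add: A_mult sum_mod_mult_left)
  also have "(\<Sum>u\<in>carrier H. (\<Sum>v\<in>carrier H. x v * y (inv v \<otimes> u)) * z (inv u \<otimes> h)) =
      (\<Sum>v\<in>carrier H. x v * (\<Sum>u\<in>carrier H. y (inv v \<otimes> u) * z (inv u \<otimes> h)))"
    by (simp add: sum_distrib_left sum_distrib_right mult.assoc) (rule sum.swap)
  also have "\<dots> = (\<Sum>v\<in>carrier H. x v * (\<Sum>w\<in>carrier H. y w * z (inv w \<otimes> (inv v \<otimes> h))))"
  proof (rule sum.cong[OF refl])
    fix v assume v: "v \<in> carrier H"
    have "inv u \<otimes> h = inv (inv v \<otimes> u) \<otimes> (inv v \<otimes> h)" if "u \<in> carrier H" for u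
    proof -
      have "inv (inv v \<otimes> u) \<otimes> (inv v \<otimes> h) = inv u \<otimes> (v \<otimes> inv v) \<otimes> h"
        using that v h by (simp only: inv_mult_group inv_inv inv_closed m_closed m_assoc)
      then show ?thesis using that v h by simp
    qed
    then have "(\<Sum>u\<in>carrier H. y (inv v \<otimes> u) * z (inv u \<otimes> h)) =
        (\<Sum>u\<in>carrier H. (\<lambda>w. y w * z (inv w \<otimes> (inv v \<otimes> h))) (inv v \<otimes> u))"
      by (intro sum.cong) auto
    also have "\<dots> = (\<Sum>w\<in>carrier H. y w * z (inv w \<otimes> (inv v \<otimes> h)))" using v by (rule sum_translate)
    finally show "x v * (\<Sum>u\<in>carrier H. y (inv v \<otimes> u) * z (inv u \<otimes> h)) =
        x v * (\<Sum>w\<in>carrier H. y w * z (inv w \<otimes> (inv v \<otimes> h)))" by simp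
  qed
  also have "\<dots> mod int p = (x \<otimes>\<^bsub>A\<^esub> (y \<otimes>\<^bsub>A\<^esub> z)) h"
    using h by (simp add: A_mult sum_mod_mult_right)
  finally show "((x \<otimes>\<^bsub>A\<^esub> y) \<otimes>\<^bsub>A\<^esub> z) h = (x \<otimes>\<^bsub>A\<^esub> (y \<otimes>\<^bsub>A\<^esub> z)) h" .
qed

lemma ring_A: "ring A"
proof (rule ringI)
  show "abelian_group A"
  proof (rule abelian_groupI)
    fix x y z assume x: "x \<in> carrier A" and y: "y \<in> carrier A" and z: "z \<in> carrier A"
    show "x \<oplus>\<^bsub>A\<^esub> y \<oplus>\<^bsub>A\<^esub> z = x \<oplus>\<^bsub>A\<^esub> (y \<oplus>\<^bsub>A\<^esub> z)"
      by (rule A_eqI[OF A_add_closed A_add_closed]) (simp add: A_add mod_add_left_eq mod_add_right_eq add.assoc)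
    show "x \<oplus>\<^bsub>A\<^esub> y = y \<oplus>\<^bsub>A\<^esub> x"
      by (rule A_eqI[OF A_add_closed A_add_closed]) (simp add: A_add add.commute)
    show "\<zero>\<^bsub>A\<^esub> \<oplus>\<^bsub>A\<^esub> x = x"
      using x coeff_range[OF x] by (intro A_eqI[OF A_add_closed]) (auto simp: A_add A_zero)
    let ?y = "\<lambda>h\<in>carrier H. (- x h) mod int p"
    have y: "?y \<in> carrier A" using mod_in_residues[OF p_gt_1] unfolding carrier_A by auto
    moreover have "?y \<oplus>\<^bsub>A\<^esub> x = \<zero>\<^bsub>A\<^esub>"
      by (rule A_eqI[OF A_add_closed A_zero_closed]) (simp add: A_add A_zero mod_add_left_eq)
    ultimately show "\<exists>y\<in>carrier A. y \<oplus>\<^bsub>A\<^esub> x = \<zero>\<^bsub>A\<^esub>" by blast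
  qed (auto simp: A_add_closed A_zero_closed)
  show "monoid A"
  proof (rule monoidI)
    fix x assume x: "x \<in> carrier A"
    show "\<one>\<^bsub>A\<^esub> \<otimes>\<^bsub>A\<^esub> x = x"
    proof (rule A_eqI[OF A_mult_closed x])
      fix h assume h: "h \<in> carrier H"
      have "(\<Sum>u\<in>carrier H. \<one>\<^bsub>A\<^esub> u * x (inv u \<otimes> h)) = (\<Sum>u\<in>carrier H. if u = \<one> then x h else 0)"
        using h by (intro sum.cong) (auto simp: A_one)
      then show "(\<one>\<^bsub>A\<^esub> \<otimes>\<^bsub>A\<^esub> x) h = x h" using h coeff_range[OF x h] by (simp add: A_mult)
    qed
    show "x \<otimes>\<^bsub>A\<^esub> \<one>\<^bsub>A\<^esub> = x"
    proof (rule A_eqI[OF A_mult_closed x])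
      fix h assume h: "h \<in> carrier H"
      have "inv u \<otimes> h = \<one> \<longleftrightarrow> u = h" if "u \<in> carrier H" for u
        using that h by (metis inv_closed inv_equality inv_inv l_inv)
      then have "(\<Sum>u\<in>carrier H. x u * \<one>\<^bsub>A\<^esub> (inv u \<otimes> h)) = (\<Sum>u\<in>carrier H. if u = h then x h else 0)"
        using h by (intro sum.cong) (auto simp: A_one)
      then show "(x \<otimes>\<^bsub>A\<^esub> \<one>\<^bsub>A\<^esub>) h = x h" using h coeff_range[OF x h] by (simp add: A_mult)
    qed
  qed (auto simp: A_mult_closed A_one_closed A_assoc)
  fix x y z
  show "(x \<oplus>\<^bsub>A\<^esub> y) \<otimes>\<^bsub>A\<^esub> z = x \<otimes>\<^bsub>A\<^esub> z \<oplus>\<^bsub>A\<^esub> y \<otimes>\<^bsub>A\<^esub> z"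
    by (rule A_eqI[OF A_mult_closed A_add_closed])
      (simp add: A_mult A_add sum_mod_mult_left mod_add_eq distrib_right sum.distrib)
  show "z \<otimes>\<^bsub>A\<^esub> (x \<oplus>\<^bsub>A\<^esub> y) = z \<otimes>\<^bsub>A\<^esub> x \<oplus>\<^bsub>A\<^esub> z \<otimes>\<^bsub>A\<^esub> y"
    by (rule A_eqI[OF A_mult_closed A_add_closed])
      (simp add: A_mult A_add sum_mod_mult_right mod_add_eq distrib_left sum.distrib)
qed

lemma finite_A: "finite (carrier A)"
  unfolding carrier_A by (intro finite_PiE) auto

end

locale group_ring_pushforward = D: finite_group_ring H p + E: finite_group_ring H' p + h: group_hom H H' f
  for H (structure) and H' (structure) and f and p
begin

abbreviation push where "push \<equiv> group_ring_map D.Fp H H' f"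

lemma push_eq:
  assumes "x \<in> carrier D.A" "h' \<in> carrier H'"
  shows "push x h' = (\<Sum>h\<in>{h \<in> carrier H. f h = h'}. x h) mod int p"
proof -
  have "finsum D.Fp x {h \<in> carrier H. f h = h'} = (\<Sum>h\<in>{h \<in> carrier H. f h = h'}. x h) mod int p"
    using D.coeff_range[OF assms(1)] by (intro residue_ring_finsum D.p_gt_1) auto
  then show ?thesis using assms(2) unfolding group_ring_map_def by simp
qed

lemma push_closed: assumes "x \<in> carrier D.A" shows "push x \<in> carrier E.A"
proof -
  have "push x h' \<in> {0..int p - 1}" if "h' \<in> carrier H'" for h'
    unfolding push_eq[OF assms that] using D.p_gt_1 by (rule mod_in_residues)
  then show ?thesis unfolding E.carrier_A by (auto simp: group_ring_map_def)
qed

lemma push_add: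
  assumes x: "x \<in> carrier D.A" and y: "y \<in> carrier D.A"
  shows "push (x \<oplus>\<^bsub>D.A\<^esub> y) = push x \<oplus>\<^bsub>E.A\<^esub> push y"
proof (rule E.A_eqI[OF push_closed[OF D.A_add_closed] E.A_add_closed])
  fix h' assume h': "h' \<in> carrier H'"
  show "push (x \<oplus>\<^bsub>D.A\<^esub> y) h' = (push x \<oplus>\<^bsub>E.A\<^esub> push y) h'"
    using h' by (simp add: E.A_add push_eq[OF _ h'] x y D.A_add_closed D.A_add mod_sum_eq mod_add_eq sum.distrib)
qed

lemma push_one: "push \<one>\<^bsub>D.A\<^esub> = \<one>\<^bsub>E.A\<^esub>"
proof (rule E.A_eqI[OF push_closed[OF D.A_one_closed] E.A_one_closed])
  fix h' assume h': "h' \<in> carrier H'"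
  have "(\<Sum>h\<in>{h \<in> carrier H. f h = h'}. \<one>\<^bsub>D.A\<^esub> h) = (\<Sum>h\<in>{h \<in> carrier H. f h = h'}. if h = \<one>\<^bsub>H\<^esub> then 1 else 0)"
    by (intro sum.cong) (auto simp: D.A_one)
  also have "\<dots> = (if h' = \<one>\<^bsub>H'\<^esub> then 1 else 0)" by simp
  finally show "push \<one>\<^bsub>D.A\<^esub> h' = \<one>\<^bsub>E.A\<^esub> h'"
    using h' D.p_gt_1 by (simp add: push_eq[OF D.A_one_closed] E.A_one)
qed

lemma push_zero: "push \<zero>\<^bsub>D.A\<^esub> = \<zero>\<^bsub>E.A\<^esub>"
  by (rule E.A_eqI[OF push_closed[OF D.A_zero_closed] E.A_zero_closed])
    (simp add: push_eq[OF D.A_zero_closed] E.A_zero D.A_zero)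

lemma push_mult:
  assumes x: "x \<in> carrier D.A" and y: "y \<in> carrier D.A"
  shows "push (x \<otimes>\<^bsub>D.A\<^esub> y) = push x \<otimes>\<^bsub>E.A\<^esub> push y"
proof (rule E.A_eqI[OF push_closed[OF D.A_mult_closed] E.A_mult_closed])
  fix h' assume h': "h' \<in> carrier H'"
  let ?X = "\<lambda>u'. \<Sum>u\<in>{u \<in> carrier H. f u = u'}. x u" and ?Y = "\<lambda>u'. \<Sum>u\<in>{u \<in> carrier H. f u = u'}. y u"
  have "(push x \<otimes>\<^bsub>E.A\<^esub> push y) h' = (\<Sum>u'\<in>carrier H'. ?X u' mod int p * (?Y (inv\<^bsub>H'\<^esub> u' \<otimes>\<^bsub>H'\<^esub> h') mod int p)) mod int p"
    using h' by (simp add: E.A_mult push_eq x y)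
  also have "\<dots> = (\<Sum>u'\<in>carrier H'. ?X u' * ?Y (inv\<^bsub>H'\<^esub> u' \<otimes>\<^bsub>H'\<^esub> h')) mod int p"
    by (simp add: E.sum_mod_mult_left E.sum_mod_mult_right)
  also have "(\<Sum>u'\<in>carrier H'. ?X u' * ?Y (inv\<^bsub>H'\<^esub> u' \<otimes>\<^bsub>H'\<^esub> h')) =
      (\<Sum>u'\<in>carrier H'. \<Sum>u\<in>{u \<in> carrier H. f u = u'}. x u * ?Y (inv\<^bsub>H'\<^esub> (f u) \<otimes>\<^bsub>H'\<^esub> h'))"
    by (simp add: sum_distrib_right)
  also have "\<dots> = (\<Sum>u\<in>carrier H. x u * ?Y (inv\<^bsub>H'\<^esub> (f u) \<otimes>\<^bsub>H'\<^esub> h'))"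
    by (intro sum.group) auto
  also have "\<dots> = (\<Sum>u\<in>carrier H. x u * (\<Sum>h\<in>{h \<in> carrier H. f h = h'}. y (inv\<^bsub>H\<^esub> u \<otimes>\<^bsub>H\<^esub> h)))"
  proof (rule sum.cong[OF refl])
    fix u assume u: "u \<in> carrier H"
    have "?Y (inv\<^bsub>H'\<^esub> (f u) \<otimes>\<^bsub>H'\<^esub> h') = (\<Sum>h\<in>{h \<in> carrier H. f h = h'}. y (inv\<^bsub>H\<^esub> u \<otimes>\<^bsub>H\<^esub> h))"
    proof (rule sum.reindex_bij_witness[of _ "\<lambda>h. inv\<^bsub>H\<^esub> u \<otimes>\<^bsub>H\<^esub> h" "\<lambda>w. u \<otimes>\<^bsub>H\<^esub> w"])
      fix w assume "w \<in> {w \<in> carrier H. f w = inv\<^bsub>H'\<^esub> (f u) \<otimes>\<^bsub>H'\<^esub> h'}"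
      then have w: "w \<in> carrier H" "f w = inv\<^bsub>H'\<^esub> (f u) \<otimes>\<^bsub>H'\<^esub> h'" by auto
      then have "f (u \<otimes>\<^bsub>H\<^esub> w) = h'" using u h' by (simp flip: E.m_assoc)
      then show "u \<otimes>\<^bsub>H\<^esub> w \<in> {h \<in> carrier H. f h = h'}" using u w by simp
      show "inv\<^bsub>H\<^esub> u \<otimes>\<^bsub>H\<^esub> (u \<otimes>\<^bsub>H\<^esub> w) = w" using u w by (simp flip: D.m_assoc)
      then show "y (inv\<^bsub>H\<^esub> u \<otimes>\<^bsub>H\<^esub> (u \<otimes>\<^bsub>H\<^esub> w)) = y w" by simp
    next
      fix w assume "w \<in> {h \<in> carrier H. f h = h'}"
      then show "u \<otimes>\<^bsub>H\<^esub> (inv\<^bsub>H\<^esub> u \<otimes>\<^bsub>H\<^esub> w) = w" "inv\<^bsub>H\<^esub> u \<otimes>\<^bsub>H\<^esub> w \<in> {w \<in> carrier H. f w = inv\<^bsub>H'\<^esub> (f u) \<otimes>\<^bsub>H'\<^esub> h'}"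
        using u by (auto simp flip: D.m_assoc)
    qed
    then show "x u * ?Y (inv\<^bsub>H'\<^esub> (f u) \<otimes>\<^bsub>H'\<^esub> h') =
        x u * (\<Sum>h\<in>{h \<in> carrier H. f h = h'}. y (inv\<^bsub>H\<^esub> u \<otimes>\<^bsub>H\<^esub> h))" by simp
  qed
  also have "\<dots> = (\<Sum>h\<in>{h \<in> carrier H. f h = h'}. \<Sum>u\<in>carrier H. x u * y (inv\<^bsub>H\<^esub> u \<otimes>\<^bsub>H\<^esub> h))"
    unfolding sum_distrib_left by (rule sum.swap)
  also have "\<dots> mod int p = (\<Sum>h\<in>{h \<in> carrier H. f h = h'}. (\<Sum>u\<in>carrier H. x u * y (inv\<^bsub>H\<^esub> u \<otimes>\<^bsub>H\<^esub> h)) mod int p) mod int p"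
    by (simp add: mod_sum_eq)
  also have "\<dots> = push (x \<otimes>\<^bsub>D.A\<^esub> y) h'"
    using h' by (simp add: push_eq[OF D.A_mult_closed] D.A_mult)
  finally show "push (x \<otimes>\<^bsub>D.A\<^esub> y) h' = (push x \<otimes>\<^bsub>E.A\<^esub> push y) h'" by simp
qed

end

section \<open>Completed group rings\<close>

lemma (in group) r_coset_eq_iff:
  assumes "subgroup H G" "c \<in> carrier G" "d \<in> carrier G"
  shows "H #> c = H #> d \<longleftrightarrow> c \<otimes> inv d \<in> H"
proof
  assume "H #> c = H #> d"
  then have "c \<in> H #> d" using rcos_self[OF assms(2,1)] by simp
  then obtain u where "u \<in> H" "c = u \<otimes> d" by (auto simp: r_coset_def)
  then show "c \<otimes> inv d \<in> H" using assms subgroup.mem_carrier[OF assms(1)] by (auto simp: m_assoc)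
next
  assume u: "c \<otimes> inv d \<in> H"
  have "c = (c \<otimes> inv d) \<otimes> d" using assms by (simp add: m_assoc)
  then have "c \<in> H #> d" using u unfolding r_coset_def by blast
  then show "H #> c = H #> d" using repr_independence[OF _ assms(3,1)] by blast
qed

locale pro_p_group_ring = group G for G (structure) +
  fixes p :: nat and T :: "'a topology"
  assumes prime_p: "prime p" and pro_p: "pro_p_group p G T"
begin

section \<open>Open normal subgroups and their cosets\<close>

abbreviation \<U> where "\<U> \<equiv> open_normal_subgroups G T"

abbreviation Fp where "Fp \<equiv> residue_ring (int p)"

abbreviation A where "A U \<equiv> group_ring Fp (G Mod U)"

abbreviation S where "S \<equiv> completed_group_ring Fp G T"

declare mult_FactGroup [simp del] one_FactGroup [simp del] carrier_FactGroup [simp del]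

lemma p_gt_1: "1 < p" using prime_p prime_gt_1_nat by blast

lemma topspace_T: "topspace T = carrier G"
  using pro_p by (simp add: pro_p_group_def profinite_group_def topological_group_def)

lemma \<U>_normal: "U \<in> \<U> \<Longrightarrow> U \<lhd> G" and \<U>_open: "U \<in> \<U> \<Longrightarrow> openin T U"
  by (auto simp: open_normal_subgroups_def)

lemma \<U>_subgroup: "U \<in> \<U> \<Longrightarrow> subgroup U G"
  using \<U>_normal normal_imp_subgroup by blast

lemma \<U>_subset: "U \<in> \<U> \<Longrightarrow> U \<subseteq> carrier G"
  using \<U>_subgroup subgroup.subset by blast

lemma carrier_in_\<U>: "carrier G \<in> \<U>"
  using topspace_T openin_topspace[of T] by (simp add: open_normal_subgroups_def normal_self)

lemma inter_in_\<U>: "U \<in> \<U> \<Longrightarrow> V \<in> \<U> \<Longrightarrow> U \<inter> V \<in> \<U>"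
  by (simp add: open_normal_subgroups_def normal_subgroup_intersect openin_Int)

lemma card_cosets: assumes "U \<in> \<U>" obtains n where "card (carrier (G Mod U)) = p ^ n"
  using assms pro_p by (auto simp: pro_p_group_def FactGroup_def)

lemma finite_cosets: "U \<in> \<U> \<Longrightarrow> finite (carrier (G Mod U))"
  using card_cosets p_gt_1 by (metis card_ge_0_finite gr0I less_nat_zero_code power_not_zero)

lemma finite_group_ring_quotient: "U \<in> \<U> \<Longrightarrow> finite_group_ring (G Mod U) p"
  unfolding finite_group_ring_def finite_group_ring_axioms_def
  using normal.factorgroup_is_group[OF \<U>_normal] finite_cosets p_gt_1 by blast

lemma coset_cases:
  assumes "C \<in> carrier (G Mod U)" obtains c where "c \<in> carrier G" "C = U #> c"
  using assms by (auto simp: FactGroup_def RCOSETS_def)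

lemma coset_in: "c \<in> carrier G \<Longrightarrow> U #> c \<in> carrier (G Mod U)"
  by (auto simp: FactGroup_def RCOSETS_def)

lemma coset_mult: "U \<in> \<U> \<Longrightarrow> c \<in> carrier G \<Longrightarrow> d \<in> carrier G \<Longrightarrow> (U #> c) \<otimes>\<^bsub>G Mod U\<^esub> (U #> d) = U #> (c \<otimes> d)"
  using normal.rcos_sum[OF \<U>_normal] by (simp add: FactGroup_def)

lemma coset_one: "U \<in> \<U> \<Longrightarrow> \<one>\<^bsub>G Mod U\<^esub> = U #> \<one>"
  using \<U>_subset by (simp add: FactGroup_def)

lemma coset_inv: assumes "U \<in> \<U>" "c \<in> carrier G" shows "inv\<^bsub>G Mod U\<^esub> (U #> c) = U #> inv c"
proof -
  interpret Q: group "G Mod U" using normal.factorgroup_is_group[OF \<U>_normal[OF assms(1)]] .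
  have "(U #> inv c) \<otimes>\<^bsub>G Mod U\<^esub> (U #> c) = \<one>\<^bsub>G Mod U\<^esub>"
    using assms coset_mult[OF assms(1), of "inv c" c] coset_one[OF assms(1)] by (simp only: inv_closed l_inv)
  then show ?thesis
    using assms by (intro Q.inv_equality coset_in) auto
qed

lemma coset_eq_iff:
  "U \<in> \<U> \<Longrightarrow> c \<in> carrier G \<Longrightarrow> d \<in> carrier G \<Longrightarrow> U #> c = U #> d \<longleftrightarrow> c \<otimes> inv d \<in> U"
  by (rule r_coset_eq_iff[OF \<U>_subgroup])

lemma coset_coarsen:
  assumes "subgroup U G" "subgroup V G" "U \<subseteq> V" "c \<in> carrier G"
  shows "V <#> (U #> c) = V #> c"
proof
  show "V <#> (U #> c) \<subseteq> V #> c"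
  proof
    fix x assume "x \<in> V <#> (U #> c)"
    then obtain v u where vu: "v \<in> V" "u \<in> U" "x = v \<otimes> (u \<otimes> c)" by (auto simp: set_mult_def r_coset_def)
    then have "v \<in> carrier G" "u \<in> carrier G" "u \<in> V"
      using assms subgroup.mem_carrier[OF assms(1)] subgroup.mem_carrier[OF assms(2)] by auto
    then have "x = (v \<otimes> u) \<otimes> c" "v \<otimes> u \<in> V"
      using assms(4) vu subgroup.m_closed[OF assms(2)] by (auto simp: m_assoc)
    then show "x \<in> V #> c" unfolding r_coset_def by blast
  qed
  show "V #> c \<subseteq> V <#> (U #> c)"
    using rcos_self[OF assms(4,1)] unfolding set_mult_def r_coset_def by blast
qed

lemma coset_coarsen': "U \<in> \<U> \<Longrightarrow> V \<in> \<U> \<Longrightarrow> U \<subseteq> V \<Longrightarrow> c \<in> carrier G \<Longrightarrow> V <#> (U #> c) = V #> c"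
  using coset_coarsen \<U>_subgroup by blast

lemma pushforward:
  assumes "U \<in> \<U>" "V \<in> \<U>" "U \<subseteq> V"
  shows "group_ring_pushforward (G Mod U) (G Mod V) (\<lambda>C. V <#> C) p"
proof -
  have "(\<lambda>C. V <#> C) \<in> hom (G Mod U) (G Mod V)"
  proof (rule homI)
    show "V <#> C \<in> carrier (G Mod V)" if "C \<in> carrier (G Mod U)" for C
      using that assms by (elim coset_cases) (simp add: coset_coarsen' coset_in)
    show "V <#> (C \<otimes>\<^bsub>G Mod U\<^esub> D) = (V <#> C) \<otimes>\<^bsub>G Mod V\<^esub> (V <#> D)"
      if "C \<in> carrier (G Mod U)" "D \<in> carrier (G Mod U)" for C D
      using that assms by (elim coset_cases) (simp add: coset_coarsen' coset_mult)
  qed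
  then show ?thesis
    by (intro group_ring_pushforward.intro group_hom.intro group_hom_axioms.intro
        finite_group_ring_quotient normal.factorgroup_is_group[OF \<U>_normal] assms)
qed

section \<open>The inverse limit ring\<close>

abbreviation proj where "proj U V \<equiv> group_ring_map Fp (G Mod U) (G Mod V) (\<lambda>C. V <#> C)"

lemma S_mem_iff:
  "x \<in> carrier S \<longleftrightarrow> x \<in> (\<Pi>\<^sub>E U\<in>\<U>. carrier (A U)) \<and> (\<forall>U\<in>\<U>. \<forall>V\<in>\<U>. U \<subseteq> V \<longrightarrow> x V = proj U V (x U))"
  by (simp only: completed_group_ring_def partial_object.simps mem_Collect_eq)

lemma S_component: "x \<in> carrier S \<Longrightarrow> U \<in> \<U> \<Longrightarrow> x U \<in> carrier (A U)"
  unfolding S_mem_iff by (blast intro: PiE_mem)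

lemma S_compat: "x \<in> carrier S \<Longrightarrow> U \<in> \<U> \<Longrightarrow> V \<in> \<U> \<Longrightarrow> U \<subseteq> V \<Longrightarrow> x V = proj U V (x U)"
  unfolding S_mem_iff by blast

lemma S_memI:
  assumes "x \<in> extensional \<U>" "\<And>U. U \<in> \<U> \<Longrightarrow> x U \<in> carrier (A U)"
    "\<And>U V. U \<in> \<U> \<Longrightarrow> V \<in> \<U> \<Longrightarrow> U \<subseteq> V \<Longrightarrow> x V = proj U V (x U)"
  shows "x \<in> carrier S"
  unfolding S_mem_iff PiE_def using assms by blast

lemma S_extensional: "x \<in> carrier S \<Longrightarrow> x \<in> extensional \<U>"
  unfolding S_mem_iff PiE_def by blast

lemma S_eqI:
  assumes "x \<in> extensional \<U>" "y \<in> extensional \<U>" "\<And>U. U \<in> \<U> \<Longrightarrow> x U = y U" shows "x = y"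
  using assms by (rule extensionalityI)

lemma S_mult: "U \<in> \<U> \<Longrightarrow> (x \<otimes>\<^bsub>S\<^esub> y) U = x U \<otimes>\<^bsub>A U\<^esub> y U"
  and S_add: "U \<in> \<U> \<Longrightarrow> (x \<oplus>\<^bsub>S\<^esub> y) U = x U \<oplus>\<^bsub>A U\<^esub> y U"
  and S_one: "U \<in> \<U> \<Longrightarrow> \<one>\<^bsub>S\<^esub> U = \<one>\<^bsub>A U\<^esub>"
  and S_zero: "U \<in> \<U> \<Longrightarrow> \<zero>\<^bsub>S\<^esub> U = \<zero>\<^bsub>A U\<^esub>"
  by (simp_all add: completed_group_ring_def)

lemma S_ext [simp]: "x \<otimes>\<^bsub>S\<^esub> y \<in> extensional \<U>" "x \<oplus>\<^bsub>S\<^esub> y \<in> extensional \<U>"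
  "\<one>\<^bsub>S\<^esub> \<in> extensional \<U>" "\<zero>\<^bsub>S\<^esub> \<in> extensional \<U>"
  by (simp_all add: completed_group_ring_def)

lemma ring_A: "U \<in> \<U> \<Longrightarrow> ring (A U)"
  using finite_group_ring.ring_A[OF finite_group_ring_quotient] .

lemma S_mult_closed: assumes "x \<in> carrier S" "y \<in> carrier S" shows "x \<otimes>\<^bsub>S\<^esub> y \<in> carrier S"
proof (rule S_memI)
  show "(x \<otimes>\<^bsub>S\<^esub> y) U \<in> carrier (A U)" if "U \<in> \<U>" for U
    using finite_group_ring.A_mult_closed[OF finite_group_ring_quotient[OF that]] that by (simp add: S_mult)
  fix U V assume U: "U \<in> \<U>" "V \<in> \<U>" "U \<subseteq> V"
  show "(x \<otimes>\<^bsub>S\<^esub> y) V = proj U V ((x \<otimes>\<^bsub>S\<^esub> y) U)"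
    using group_ring_pushforward.push_mult[OF pushforward[OF U]] S_component S_compat[OF _ U] assms U
    by (simp add: S_mult)
qed simp

lemma S_add_closed: assumes "x \<in> carrier S" "y \<in> carrier S" shows "x \<oplus>\<^bsub>S\<^esub> y \<in> carrier S"
proof (rule S_memI)
  show "(x \<oplus>\<^bsub>S\<^esub> y) U \<in> carrier (A U)" if "U \<in> \<U>" for U
    using finite_group_ring.A_add_closed[OF finite_group_ring_quotient[OF that]] that by (simp add: S_add)
  fix U V assume U: "U \<in> \<U>" "V \<in> \<U>" "U \<subseteq> V"
  show "(x \<oplus>\<^bsub>S\<^esub> y) V = proj U V ((x \<oplus>\<^bsub>S\<^esub> y) U)"
    using group_ring_pushforward.push_add[OF pushforward[OF U]] S_component S_compat[OF _ U] assms U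
    by (simp add: S_add)
qed simp

lemma S_one_closed: "\<one>\<^bsub>S\<^esub> \<in> carrier S"
proof (rule S_memI)
  show "\<one>\<^bsub>S\<^esub> U \<in> carrier (A U)" if "U \<in> \<U>" for U
    using finite_group_ring.A_one_closed[OF finite_group_ring_quotient[OF that]] that by (simp add: S_one)
  fix U V assume U: "U \<in> \<U>" "V \<in> \<U>" "U \<subseteq> V"
  show "\<one>\<^bsub>S\<^esub> V = proj U V (\<one>\<^bsub>S\<^esub> U)"
    using group_ring_pushforward.push_one[OF pushforward[OF U]] U by (simp add: S_one)
qed simp

lemma S_zero_closed: "\<zero>\<^bsub>S\<^esub> \<in> carrier S"
proof (rule S_memI)
  show "\<zero>\<^bsub>S\<^esub> U \<in> carrier (A U)" if "U \<in> \<U>" for U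
    using finite_group_ring.A_zero_closed[OF finite_group_ring_quotient[OF that]] that by (simp add: S_zero)
  fix U V assume U: "U \<in> \<U>" "V \<in> \<U>" "U \<subseteq> V"
  show "\<zero>\<^bsub>S\<^esub> V = proj U V (\<zero>\<^bsub>S\<^esub> U)"
    using group_ring_pushforward.push_zero[OF pushforward[OF U]] U by (simp add: S_zero)
qed simp

lemma S_neg_exists: assumes x: "x \<in> carrier S" shows "\<exists>y\<in>carrier S. y \<oplus>\<^bsub>S\<^esub> x = \<zero>\<^bsub>S\<^esub>"
proof
  let ?y = "\<lambda>U\<in>\<U>. \<ominus>\<^bsub>A U\<^esub> (x U)"
  show "?y \<in> carrier S"
  proof (rule S_memI)
    show "?y U \<in> carrier (A U)" if "U \<in> \<U>" for U
      using abelian_group.a_inv_closed[OF ring.is_abelian_group[OF ring_A[OF that]] S_component[OF x that]] that by simp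
    fix U V assume U: "U \<in> \<U>" "V \<in> \<U>" "U \<subseteq> V"
    interpret AU: ring "A U" using ring_A[OF U(1)] .
    interpret AV: ring "A V" using ring_A[OF U(2)] .
    interpret P: group_ring_pushforward "G Mod U" "G Mod V" "\<lambda>C. V <#> C" p using pushforward[OF U] .
    have xU: "x U \<in> carrier (A U)" using S_component[OF x U(1)] .
    have "proj U V (\<ominus>\<^bsub>A U\<^esub> (x U)) \<oplus>\<^bsub>A V\<^esub> proj U V (x U) = \<zero>\<^bsub>A V\<^esub>"
      using P.push_add[OF AU.a_inv_closed[OF xU] xU] P.push_zero AU.l_neg[OF xU] by simp
    then have "\<ominus>\<^bsub>A V\<^esub> (proj U V (x U)) = proj U V (\<ominus>\<^bsub>A U\<^esub> (x U))"
      by (intro AV.minus_equality P.push_closed xU AU.a_inv_closed)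
    then show "?y V = proj U V (?y U)" using U S_compat[OF x U] by simp
  qed simp
  show "?y \<oplus>\<^bsub>S\<^esub> x = \<zero>\<^bsub>S\<^esub>"
    by (rule S_eqI) (use ring.is_abelian_group[OF ring_A] S_component[OF x] in \<open>auto simp: S_add S_zero abelian_group.l_neg\<close>)
qed

lemma ring_S: "ring S"
proof (rule ringI)
  show "abelian_group S"
  proof (rule abelian_groupI)
    fix x y z assume x: "x \<in> carrier S" and y: "y \<in> carrier S" and z: "z \<in> carrier S"
    have ab: "abelian_monoid (A U)" if "U \<in> \<U>" for U
      using ring.is_abelian_group[OF ring_A[OF that]] abelian_group_def by blast
    note c = S_component[OF x] S_component[OF y] S_component[OF z]
    show "x \<oplus>\<^bsub>S\<^esub> y \<oplus>\<^bsub>S\<^esub> z = x \<oplus>\<^bsub>S\<^esub> (y \<oplus>\<^bsub>S\<^esub> z)"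
      by (rule S_eqI) (simp_all add: S_add abelian_monoid.a_assoc[OF ab] c)
    show "x \<oplus>\<^bsub>S\<^esub> y = y \<oplus>\<^bsub>S\<^esub> x"
      by (rule S_eqI) (simp_all add: S_add abelian_monoid.a_comm[OF ab] c)
    show "\<zero>\<^bsub>S\<^esub> \<oplus>\<^bsub>S\<^esub> x = x"
      by (rule S_eqI) (simp_all add: S_add S_zero abelian_monoid.l_zero[OF ab] c S_extensional[OF x])
  qed (auto simp: S_add_closed S_zero_closed S_neg_exists)
  show "monoid S"
  proof (rule monoidI)
    fix x y z assume x: "x \<in> carrier S" and y: "y \<in> carrier S" and z: "z \<in> carrier S"
    have m: "monoid (A U)" if "U \<in> \<U>" for U using ring.is_monoid[OF ring_A[OF that]] .
    note c = S_component[OF x] S_component[OF y] S_component[OF z]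
    show "x \<otimes>\<^bsub>S\<^esub> y \<otimes>\<^bsub>S\<^esub> z = x \<otimes>\<^bsub>S\<^esub> (y \<otimes>\<^bsub>S\<^esub> z)"
      by (rule S_eqI) (simp_all add: S_mult monoid.m_assoc[OF m] c)
    show "\<one>\<^bsub>S\<^esub> \<otimes>\<^bsub>S\<^esub> x = x"
      by (rule S_eqI) (simp_all add: S_mult S_one monoid.l_one[OF m] c S_extensional[OF x])
    show "x \<otimes>\<^bsub>S\<^esub> \<one>\<^bsub>S\<^esub> = x"
      by (rule S_eqI) (simp_all add: S_mult S_one monoid.r_one[OF m] c S_extensional[OF x])
  qed (auto simp: S_mult_closed S_one_closed)
  fix x y z assume x: "x \<in> carrier S" and y: "y \<in> carrier S" and z: "z \<in> carrier S"
  note c = S_component[OF x] S_component[OF y] S_component[OF z]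
  show "(x \<oplus>\<^bsub>S\<^esub> y) \<otimes>\<^bsub>S\<^esub> z = x \<otimes>\<^bsub>S\<^esub> z \<oplus>\<^bsub>S\<^esub> y \<otimes>\<^bsub>S\<^esub> z"
    by (rule S_eqI) (simp_all add: S_mult S_add ring.ring_simprules(13)[OF ring_A] c)
  show "z \<otimes>\<^bsub>S\<^esub> (x \<oplus>\<^bsub>S\<^esub> y) = z \<otimes>\<^bsub>S\<^esub> x \<oplus>\<^bsub>S\<^esub> z \<otimes>\<^bsub>S\<^esub> y"
    by (rule S_eqI) (simp_all add: S_mult S_add ring.ring_simprules(23)[OF ring_A] c)
qed

sublocale S: ring S by (rule ring_S)

lemma S_uminus: assumes "x \<in> carrier S" "U \<in> \<U>" shows "(\<ominus>\<^bsub>S\<^esub> x) U = \<ominus>\<^bsub>A U\<^esub> (x U)"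
proof -
  interpret AU: ring "A U" using ring_A[OF assms(2)] .
  have "(\<ominus>\<^bsub>S\<^esub> x) U \<oplus>\<^bsub>A U\<^esub> x U = \<zero>\<^bsub>A U\<^esub>"
    using S.l_neg[OF assms(1)] S_add[OF assms(2), of "\<ominus>\<^bsub>S\<^esub> x" x] S_zero[OF assms(2)] by simp
  then show ?thesis using AU.minus_equality S_component assms by (metis S.a_inv_closed)
qed

lemma S_minus_eq_zero_iff:
  assumes "x \<in> carrier S" "y \<in> carrier S" "U \<in> \<U>"
  shows "(x \<ominus>\<^bsub>S\<^esub> y) U = \<zero>\<^bsub>A U\<^esub> \<longleftrightarrow> x U = y U"
proof -
  interpret AU: ring "A U" using ring_A[OF assms(3)] .
  have "(x \<ominus>\<^bsub>S\<^esub> y) U = x U \<ominus>\<^bsub>A U\<^esub> y U"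
    using assms by (simp add: a_minus_def S_add S_uminus)
  then show ?thesis using AU.r_right_minus_eq S_component assms by simp
qed

section \<open>Kernels of the projections as neighbourhoods of zero\<close>

definition ker :: "'a set \<Rightarrow> ('a set \<Rightarrow> 'a set \<Rightarrow> int) set" where
  "ker U = {x \<in> carrier S. x U = \<zero>\<^bsub>A U\<^esub>}"

lemma minus_in_ker_iff: "\<lbrakk>x \<in> carrier S; y \<in> carrier S; U \<in> \<U>\<rbrakk> \<Longrightarrow> x \<ominus>\<^bsub>S\<^esub> y \<in> ker U \<longleftrightarrow> x U = y U"
  by (simp add: ker_def S_minus_eq_zero_iff)

lemma ker_ideal: assumes "U \<in> \<U>" shows "ideal (ker U) S"
proof (rule idealI[OF ring_S])
  interpret AU: ring "A U" using ring_A[OF assms] .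
  show "subgroup (ker U) (add_monoid S)"
    by (rule S.add.subgroupI) (use assms S_component S_zero in \<open>auto simp: ker_def S_add S_uminus\<close>)
qed (use assms ring_A[OF assms] S_component in \<open>auto simp: ker_def S_mult ring.ring_simprules\<close>)

lemma ker_mono:
  assumes "U \<in> \<U>" "V \<in> \<U>" "U \<subseteq> V" shows "ker U \<subseteq> ker V"
  using S_compat[OF _ assms] group_ring_pushforward.push_zero[OF pushforward[OF assms]] by (auto simp: ker_def)

lemma linear_topological_ring_S: "linear_topological_ring S (ker ` \<U>)"
proof (intro linear_topological_ring.intro ring_S linear_topological_ring_axioms.intro)
  show "ideal K S" if "K \<in> ker ` \<U>" for K using that ker_ideal by blast
  show "\<exists>M\<in>ker ` \<U>. M \<subseteq> K \<inter> L" if KL: "K \<in> ker ` \<U>" "L \<in> ker ` \<U>" for K L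
  proof -
    obtain U V where U: "U \<in> \<U>" "V \<in> \<U>" "K = ker U" "L = ker V" using KL by blast
    then have "ker (U \<inter> V) \<subseteq> K \<inter> L"
      using ker_mono[OF inter_in_\<U>[OF U(1,2)] U(1)] ker_mono[OF inter_in_\<U>[OF U(1,2)] U(2)] by simp
    then show ?thesis using inter_in_\<U> U by blast
  qed
  show "x = \<zero>\<^bsub>S\<^esub>" if "x \<in> carrier S" "\<And>K. K \<in> ker ` \<U> \<Longrightarrow> x \<in> K" for x
  proof (rule S_eqI[OF S_extensional[OF that(1)] S_extensional[OF S_zero_closed]])
    fix U assume U: "U \<in> \<U>"
    then have "x \<in> ker U" using that(2) by blast
    then show "x U = \<zero>\<^bsub>S\<^esub> U" using U by (simp add: ker_def S_zero)
  qed
  fix f assume f: "\<And>K. K \<in> ker ` \<U> \<Longrightarrow> f K \<in> carrier S"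
    and fc: "\<And>K L. \<lbrakk>K \<in> ker ` \<U>; L \<in> ker ` \<U>; K \<subseteq> L\<rbrakk> \<Longrightarrow> f K \<ominus>\<^bsub>S\<^esub> f L \<in> L"
  \<comment> \<open>The component of the limit at \<open>U\<close> is read off from the
    representative attached to \<open>ker U\<close>; compatibility along inclusions of kernels makes
    the components a point of the inverse limit.\<close>
  let ?y = "\<lambda>U\<in>\<U>. f (ker U) U"
  have y: "?y \<in> carrier S"
  proof (rule S_memI)
    show "?y U \<in> carrier (A U)" if "U \<in> \<U>" for U using that f S_component by simp
    fix U V assume U: "U \<in> \<U>" "V \<in> \<U>" "U \<subseteq> V"
    have "f (ker U) V = f (ker V) V"
      using fc[of "ker U" "ker V"] ker_mono[OF U] minus_in_ker_iff f U by simp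
    then show "?y V = proj U V (?y U)" using U S_compat[OF f U] by simp
  qed simp
  moreover have "?y \<ominus>\<^bsub>S\<^esub> f (ker U) \<in> ker U" if "U \<in> \<U>" for U
    using minus_in_ker_iff[OF y f that] that by simp
  ultimately show "\<exists>y\<in>carrier S. \<forall>K\<in>ker ` \<U>. y \<ominus>\<^bsub>S\<^esub> f K \<in> K" by blast
qed

sublocale S: linear_topological_ring S "ker ` \<U>"
  by (rule linear_topological_ring_S)

text \<open>A basic open set of the product constrains finitely many components, and all of these
  are determined by the component at the intersection of the subgroups involved. So it is enough to
  approximate in one component at a time.\<close>

lemma closure_of_eq_cl:
  assumes B: "B \<subseteq> carrier S"
  shows "Abstract_Topology.closure_of (completed_group_ring_topology Fp G T) B = S.cl B"
proof -
  let ?X = "product_topology (\<lambda>U. discrete_topology (carrier (A U))) \<U>"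
  have SX: "carrier S \<subseteq> topspace ?X" using S_component S_extensional by (auto simp: PiE_def)
  have mem: "x \<in> S.cl B \<longleftrightarrow> x \<in> carrier S \<and> (\<forall>U\<in>\<U>. \<exists>b\<in>B. b U = x U)" for x
    unfolding S.cl_def using minus_in_ker_iff B by (auto simp: subset_eq) metis+
  have "x \<in> Abstract_Topology.closure_of (subtopology ?X (carrier S)) B \<longleftrightarrow> x \<in> S.cl B" for x
  proof
    assume x: "x \<in> Abstract_Topology.closure_of (subtopology ?X (carrier S)) B"
    then have xS: "x \<in> carrier S" by (auto simp: closure_of_def)
    have "\<exists>b\<in>B. b U = x U" if U: "U \<in> \<U>" for U
    proof -
      have "openin ?X (PiE \<U> (\<lambda>V. if V = U then {x U} else carrier (A V)))"
        using S_component[OF xS U] by (intro product_topology_basis) (auto intro: finite_subset[of _ "{U}"])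
      then have "openin (subtopology ?X (carrier S)) (PiE \<U> (\<lambda>V. if V = U then {x U} else carrier (A V)) \<inter> carrier S)"
        by (auto simp: openin_subtopology)
      moreover have "x \<in> PiE \<U> (\<lambda>V. if V = U then {x U} else carrier (A V)) \<inter> carrier S"
        using xS S_component[OF xS] S_extensional[OF xS] by (simp add: PiE_def Pi_def)
      ultimately obtain b where "b \<in> B" "b \<in> PiE \<U> (\<lambda>V. if V = U then {x U} else carrier (A V))"
        using x unfolding closure_of_def by blast
      moreover from this(2) have "b U \<in> (if U = U then {x U} else carrier (A U))" using U by (rule PiE_mem)
      ultimately show ?thesis by auto
    qed
    then show "x \<in> S.cl B" using mem xS by blast
  next
    assume x: "x \<in> S.cl B"
    then have xS: "x \<in> carrier S" using mem by blast
    have "\<exists>b\<in>B. b \<in> W" if W: "openin (subtopology ?X (carrier S)) W" "x \<in> W" for W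
    proof -
      obtain O' where O': "openin ?X O'" "W = O' \<inter> carrier S" using W(1) by (auto simp: openin_subtopology)
      then obtain Y where Y: "finite {U \<in> \<U>. Y U \<noteq> carrier (A U)}" "x \<in> PiE \<U> Y" "PiE \<U> Y \<subseteq> O'"
        using W(2) unfolding openin_product_topology_alt by (metis (no_types, lifting) Collect_cong IntD1 topspace_discrete_topology)
      \<comment> \<open>Directedness for finite families; \<open>carrier G\<close> serves as the
        bound of the empty family.\<close>
      have dir: "\<exists>V\<in>\<U>. \<forall>U\<in>D. V \<subseteq> U" if "finite D" "D \<subseteq> \<U>" for D
        using that
      proof (induction D)
        case (insert U D)
        then obtain V where "V \<in> \<U>" "\<forall>U\<in>D. V \<subseteq> U" by auto
        then show ?case using insert.prems by (intro bexI[of _ "U \<inter> V"] inter_in_\<U>) auto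
      qed (use carrier_in_\<U> in auto)
      obtain V where V: "V \<in> \<U>" "\<And>U. U \<in> \<U> \<Longrightarrow> Y U \<noteq> carrier (A U) \<Longrightarrow> V \<subseteq> U"
        using dir[OF Y(1)] by blast
      obtain b where b: "b \<in> B" "b V = x V" using mem x V(1) by blast
      then have bS: "b \<in> carrier S" using B by blast
      have "b U \<in> Y U" if U: "U \<in> \<U>" for U
      proof (cases "Y U = carrier (A U)")
        case False
        then have "b U = x U" using V U S_compat[OF bS V(1) U] S_compat[OF xS V(1) U] b(2) by simp
        then show ?thesis using PiE_mem[OF Y(2) U] by simp
      qed (use S_component[OF bS U] in simp)
      then have "b \<in> PiE \<U> Y" using S_extensional[OF bS] by (auto simp: PiE_def)
      then show ?thesis using b(1) Y(3) O'(2) bS by blast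
    qed
    moreover have "x \<in> topspace (subtopology ?X (carrier S))" using xS SX by auto
    ultimately show "x \<in> Abstract_Topology.closure_of (subtopology ?X (carrier S)) B"
      unfolding closure_of_def by blast
  qed
  then show ?thesis unfolding completed_group_ring_topology_def by blast
qed

lemma coeff_range: "x \<in> carrier S \<Longrightarrow> U \<in> \<U> \<Longrightarrow> C \<in> carrier (G Mod U) \<Longrightarrow> x U C \<in> {0..int p - 1}"
  using finite_group_ring.coeff_range[OF finite_group_ring_quotient S_component] by blast

lemma coeff_mod: "x \<in> carrier S \<Longrightarrow> U \<in> \<U> \<Longrightarrow> C \<in> carrier (G Mod U) \<Longrightarrow> x U C mod int p = x U C"
  using coeff_range mod_residues by blast

lemma component_eqI:
  assumes "x \<in> carrier S" "y \<in> carrier S" "U \<in> \<U>" "\<And>C. C \<in> carrier (G Mod U) \<Longrightarrow> x U C = y U C"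
  shows "x U = y U"
  using finite_group_ring.A_eqI[OF finite_group_ring_quotient S_component S_component] assms by blast

lemma coeff_add: "U \<in> \<U> \<Longrightarrow> C \<in> carrier (G Mod U) \<Longrightarrow> (x \<oplus>\<^bsub>S\<^esub> y) U C = (x U C + y U C) mod int p"
  using finite_group_ring.A_add[OF finite_group_ring_quotient] by (simp add: S_add)

lemma coeff_zero: "U \<in> \<U> \<Longrightarrow> C \<in> carrier (G Mod U) \<Longrightarrow> \<zero>\<^bsub>S\<^esub> U C = 0"
  using finite_group_ring.A_zero[OF finite_group_ring_quotient] by (simp add: S_zero)

lemma coeff_mult: "U \<in> \<U> \<Longrightarrow> C \<in> carrier (G Mod U) \<Longrightarrow>
    (x \<otimes>\<^bsub>S\<^esub> y) U C = (\<Sum>D\<in>carrier (G Mod U). x U D * y U (inv\<^bsub>G Mod U\<^esub> D \<otimes>\<^bsub>G Mod U\<^esub> C)) mod int p"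
  using finite_group_ring.A_mult[OF finite_group_ring_quotient] by (simp add: S_mult)

lemma in_ker_iff: "U \<in> \<U> \<Longrightarrow> x \<in> carrier S \<Longrightarrow> x \<in> ker U \<longleftrightarrow> (\<forall>C\<in>carrier (G Mod U). x U C = 0)"
  using component_eqI[OF _ S_zero_closed, of x U] coeff_zero[of U] S_zero[of U] by (auto simp: ker_def)

section \<open>Group elements inside the completed group ring\<close>

definition ge :: "'a \<Rightarrow> 'a set \<Rightarrow> 'a set \<Rightarrow> int" where "ge h = group_element Fp G T h"

lemma ge_coeff: "U \<in> \<U> \<Longrightarrow> C \<in> carrier (G Mod U) \<Longrightarrow> ge h U C = (if C = U #> h then 1 else 0)"
  by (simp add: ge_def group_element_def residue_ring_def)

lemma ge_closed [simp, intro]: assumes h: "h \<in> carrier G" shows "ge h \<in> carrier S"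
proof (rule S_memI)
  show "ge h \<in> extensional \<U>" by (simp add: ge_def group_element_def)
  show c: "ge h U \<in> carrier (A U)" if "U \<in> \<U>" for U
    using that p_gt_1 by (auto simp: ge_def group_element_def group_ring_def residue_ring_def)
  fix U V assume U: "U \<in> \<U>" "V \<in> \<U>" "U \<subseteq> V"
  interpret P: group_ring_pushforward "G Mod U" "G Mod V" "\<lambda>C. V <#> C" p using pushforward[OF U] .
  show "ge h V = proj U V (ge h U)"
  proof (rule P.E.A_eqI[OF c[OF U(2)] P.push_closed[OF c[OF U(1)]]])
    fix D assume D: "D \<in> carrier (G Mod V)"
    have "proj U V (ge h U) D = (\<Sum>C\<in>{C \<in> carrier (G Mod U). V <#> C = D}. if C = U #> h then 1 else 0) mod int p"
      unfolding P.push_eq[OF c[OF U(1)] D] using U by (intro arg_cong2[where f = "(mod)"] sum.cong) (auto simp: ge_coeff)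
    also have "\<dots> = (if V #> h = D then 1 else 0)"
      using finite_cosets[OF U(1)] p_gt_1 coset_in[OF h] coset_coarsen'[OF U h] by simp
    finally show "ge h V D = proj U V (ge h U) D" using U D by (auto simp: ge_coeff)
  qed
qed

lemma ge_mult_left:
  assumes x: "x \<in> carrier S" and U: "U \<in> \<U>" and "h \<in> carrier G" "c \<in> carrier G"
  shows "(ge h \<otimes>\<^bsub>S\<^esub> x) U (U #> c) = x U (U #> (inv h \<otimes> c))"
proof -
  have "(ge h \<otimes>\<^bsub>S\<^esub> x) U (U #> c) =
      (\<Sum>D\<in>carrier (G Mod U). if D = U #> h then x U (U #> (inv h \<otimes> c)) else 0) mod int p"
    using assms by (subst coeff_mult) (auto simp: coset_in ge_coeff coset_inv coset_mult intro!: arg_cong2[where f = "(mod)"] sum.cong)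
  then show ?thesis using assms coset_in finite_cosets[OF U] coeff_mod[OF x U] by simp
qed

lemma ge_mult_right:
  assumes x: "x \<in> carrier S" and U: "U \<in> \<U>" and "h \<in> carrier G" "c \<in> carrier G"
  shows "(x \<otimes>\<^bsub>S\<^esub> ge h) U (U #> c) = x U (U #> (c \<otimes> inv h))"
proof -
  have eq: "U #> (inv d \<otimes> c) = U #> h \<longleftrightarrow> U #> d = U #> (c \<otimes> inv h)" if d: "d \<in> carrier G" for d
  proof
    assume "U #> (inv d \<otimes> c) = U #> h"
    then have "(U #> d) \<otimes>\<^bsub>G Mod U\<^esub> (U #> (inv d \<otimes> c)) \<otimes>\<^bsub>G Mod U\<^esub> (U #> inv h) = (U #> d) \<otimes>\<^bsub>G Mod U\<^esub> (U #> h) \<otimes>\<^bsub>G Mod U\<^esub> (U #> inv h)" by simp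
    moreover have "d \<otimes> (inv d \<otimes> c) \<otimes> inv h = c \<otimes> inv h" "d \<otimes> h \<otimes> inv h = d"
      using d assms by (simp_all add: m_assoc) (simp_all flip: m_assoc)
    ultimately show "U #> d = U #> (c \<otimes> inv h)" using d assms by (simp add: coset_mult)
  next
    assume "U #> d = U #> (c \<otimes> inv h)"
    then have "inv\<^bsub>G Mod U\<^esub> (U #> d) \<otimes>\<^bsub>G Mod U\<^esub> (U #> c) = inv\<^bsub>G Mod U\<^esub> (U #> (c \<otimes> inv h)) \<otimes>\<^bsub>G Mod U\<^esub> (U #> c)" by simp
    moreover have "inv (c \<otimes> inv h) \<otimes> c = h" using assms by (simp add: inv_mult_group m_assoc)
    ultimately show "U #> (inv d \<otimes> c) = U #> h" using d assms by (simp add: coset_mult coset_inv)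
  qed
  have "x U D * ge h U (inv\<^bsub>G Mod U\<^esub> D \<otimes>\<^bsub>G Mod U\<^esub> (U #> c)) = (if D = U #> (c \<otimes> inv h) then x U (U #> (c \<otimes> inv h)) else 0)"
    if D: "D \<in> carrier (G Mod U)" for D
  proof -
    obtain d where d: "d \<in> carrier G" "D = U #> d" using coset_cases[OF D] by blast
    then show ?thesis using assms eq[OF d(1)] by (auto simp: coset_inv coset_mult coset_in ge_coeff)
  qed
  then have "(x \<otimes>\<^bsub>S\<^esub> ge h) U (U #> c) =
      (\<Sum>D\<in>carrier (G Mod U). if D = U #> (c \<otimes> inv h) then x U (U #> (c \<otimes> inv h)) else 0) mod int p"
    using assms by (subst coeff_mult) (auto simp: coset_in intro!: arg_cong2[where f = "(mod)"] sum.cong)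
  then show ?thesis using assms coset_in finite_cosets[OF U] coeff_mod[OF x U] by simp
qed

lemma S_eq_coeffI:
  assumes "x \<in> carrier S" "y \<in> carrier S" "\<And>U c. U \<in> \<U> \<Longrightarrow> c \<in> carrier G \<Longrightarrow> x U (U #> c) = y U (U #> c)"
  shows "x = y"
proof (rule S_eqI[OF S_extensional[OF assms(1)] S_extensional[OF assms(2)]])
  fix U assume U: "U \<in> \<U>"
  show "x U = y U"
    by (rule component_eqI[OF assms(1,2) U]) (use assms(3)[OF U] in \<open>auto elim: coset_cases\<close>)
qed

lemma coset_cancel:
  assumes U: "U \<in> \<U>" and "h \<in> carrier G" "c \<in> carrier G" "d \<in> carrier G"
  shows "U #> (inv h \<otimes> c) = U #> d \<longleftrightarrow> U #> c = U #> (h \<otimes> d)"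
proof
  assume "U #> (inv h \<otimes> c) = U #> d"
  then have "(U #> h) \<otimes>\<^bsub>G Mod U\<^esub> (U #> (inv h \<otimes> c)) = (U #> h) \<otimes>\<^bsub>G Mod U\<^esub> (U #> d)" by simp
  moreover have "h \<otimes> (inv h \<otimes> c) = c" using assms by (simp flip: m_assoc)
  ultimately show "U #> c = U #> (h \<otimes> d)" using assms by (simp add: coset_mult)
next
  assume "U #> c = U #> (h \<otimes> d)"
  then have "(U #> inv h) \<otimes>\<^bsub>G Mod U\<^esub> (U #> c) = (U #> inv h) \<otimes>\<^bsub>G Mod U\<^esub> (U #> (h \<otimes> d))" by simp
  moreover have "inv h \<otimes> (h \<otimes> d) = d" using assms by (simp flip: m_assoc)
  ultimately show "U #> (inv h \<otimes> c) = U #> d" using assms by (simp add: coset_mult)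
qed

lemma ge_mult:
  assumes "h \<in> carrier G" "k \<in> carrier G" shows "ge h \<otimes>\<^bsub>S\<^esub> ge k = ge (h \<otimes> k)"
proof (rule S_eq_coeffI)
  fix U c assume "U \<in> \<U>" "c \<in> carrier G"
  then show "(ge h \<otimes>\<^bsub>S\<^esub> ge k) U (U #> c) = ge (h \<otimes> k) U (U #> c)"
    using assms by (simp add: ge_mult_left ge_coeff coset_in coset_cancel)
qed (use assms S_mult_closed in auto)

lemma ge_one: "ge \<one> = \<one>\<^bsub>S\<^esub>"
proof (rule S_eq_coeffI[OF _ S_one_closed])
  fix U c assume U: "U \<in> \<U>" and c: "c \<in> carrier G"
  interpret Q: finite_group_ring "G Mod U" p using finite_group_ring_quotient[OF U] .
  show "ge \<one> U (U #> c) = \<one>\<^bsub>S\<^esub> U (U #> c)"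
    using U c by (simp add: ge_coeff coset_in S_one Q.A_one coset_one)
qed auto

lemma ge_component_eq:
  assumes "h \<in> carrier G" "k \<in> carrier G" "U \<in> \<U>" "U #> h = U #> k" shows "ge h \<ominus>\<^bsub>S\<^esub> ge k \<in> ker U"
  using assms component_eqI[of "ge h" "ge k" U] by (simp add: minus_in_ker_iff ge_coeff)

lemma coeff_add_pow:
  assumes "x \<in> carrier S" "U \<in> \<U>" "C \<in> carrier (G Mod U)"
  shows "([(n::nat)] \<cdot>\<^bsub>S\<^esub> x) U C = (int n * x U C) mod int p"
proof (induction n)
  case 0
  then show ?case using assms by (simp add: coeff_zero)
next
  case (Suc n)
  then show ?case using assms by (simp add: coeff_add mod_add_right_eq distrib_right add.commute)
qed

lemma char_p: assumes "x \<in> carrier S" shows "[p] \<cdot>\<^bsub>S\<^esub> x = \<zero>\<^bsub>S\<^esub>"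
proof (rule S_eq_coeffI)
  show "[p] \<cdot>\<^bsub>S\<^esub> x \<in> carrier S" using assms by simp
qed (use assms in \<open>auto simp: coeff_add_pow coset_in coeff_zero\<close>)

lemma coeff_uminus:
  assumes "x \<in> carrier S" "U \<in> \<U>" "C \<in> carrier (G Mod U)"
  shows "(\<ominus>\<^bsub>S\<^esub> x) U C = (- x U C) mod int p"
proof -
  have "((\<ominus>\<^bsub>S\<^esub> x) U C + x U C) mod int p = 0"
    using S.l_neg[OF assms(1)] coeff_add[OF assms(2,3), of "\<ominus>\<^bsub>S\<^esub> x" x] coeff_zero[OF assms(2,3)] by simp
  then have "(\<ominus>\<^bsub>S\<^esub> x) U C mod int p = (- x U C) mod int p"
    by (simp add: mod_eq_dvd_iff mod_eq_0_iff_dvd)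
  then show ?thesis using coeff_mod[of "\<ominus>\<^bsub>S\<^esub> x"] assms by simp
qed

text \<open>An induction principle: modulo \<open>ker U\<close> every element is a sum of group
  elements. The coefficients are taken as integers from \<open>0\<close> to \<open>p - 1\<close>, so
  a scalar is a repeated summand and their total serves as the measure.\<close>

lemma ge_span:
  assumes U: "U \<in> \<U>" and MS: "M \<subseteq> carrier S" and add: "\<And>x y. x \<in> M \<Longrightarrow> y \<in> M \<Longrightarrow> x \<oplus>\<^bsub>S\<^esub> y \<in> M"
    and ker: "ker U \<subseteq> M" and ge: "\<And>h. h \<in> carrier G \<Longrightarrow> ge h \<in> M" and x: "x \<in> carrier S"
  shows "x \<in> M"
  using x
proof (induction "nat (\<Sum>C\<in>carrier (G Mod U). x U C)" arbitrary: x rule: less_induct)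
  case less
  note x = less.prems
  show ?case
  proof (cases "\<forall>C\<in>carrier (G Mod U). x U C = 0")
    case True
    then show ?thesis using ker in_ker_iff[OF U x] by blast
  next
    case False
    then obtain C where C: "C \<in> carrier (G Mod U)" "x U C \<noteq> 0" by blast
    obtain c where c: "c \<in> carrier G" "C = U #> c" using coset_cases[OF C(1)] by blast
    let ?y = "x \<ominus>\<^bsub>S\<^esub> ge c"
    have y: "?y \<in> carrier S" using x c by simp
    have yD: "?y U D = x U D - (if D = C then 1 else 0)" if D: "D \<in> carrier (G Mod U)" for D
    proof -
      have "?y U D = (x U D + (- (if D = C then 1 else 0)) mod int p) mod int p"
        using U D x c by (simp add: a_minus_def coeff_add coeff_uminus ge_coeff)
      also have "\<dots> = (x U D - (if D = C then 1 else 0)) mod int p"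
        by (simp add: mod_add_right_eq)
      \<comment> \<open>No wrap-around happens, since the coefficient at \<open>C\<close> is nonzero
        and thus at least one; the total really drops.\<close>
      also have "\<dots> = x U D - (if D = C then 1 else 0)"
        using coeff_range[OF x U D] C(2) by auto
      finally show ?thesis .
    qed
    have "(\<Sum>D\<in>carrier (G Mod U). ?y U D) = (\<Sum>D\<in>carrier (G Mod U). x U D) - (\<Sum>D\<in>carrier (G Mod U). if D = C then 1 else 0)"
      by (simp add: yD sum_subtractf)
    also have "\<dots> = (\<Sum>D\<in>carrier (G Mod U). x U D) - 1" using C finite_cosets[OF U] by simp
    finally have "(\<Sum>D\<in>carrier (G Mod U). ?y U D) < (\<Sum>D\<in>carrier (G Mod U). x U D)" by simp
    moreover have "0 \<le> (\<Sum>D\<in>carrier (G Mod U). ?y U D)"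
      by (rule sum_nonneg) (use coeff_range[OF y U] in auto)
    ultimately have "?y \<in> M" using less.hyps[OF _ y] by simp
    moreover have "x = ?y \<oplus>\<^bsub>S\<^esub> ge c"
      using x c by (simp add: a_minus_def S.a_assoc S.l_neg)
    ultimately show ?thesis using add ge c by metis
  qed
qed

end

locale pro_p_group_ring_normal = pro_p_group_ring +
  fixes N :: "'a set"
  assumes N_normal: "N \<lhd> G"
begin

section \<open>Elements supported on the normal subgroup\<close>

lemma N_subgroup: "subgroup N G"
  using N_normal normal_imp_subgroup by blast

lemma N_carrier: "n \<in> N \<Longrightarrow> n \<in> carrier G"
  using subgroup.mem_carrier[OF N_subgroup] .

text \<open>An intrinsic description of the image of the completed group ring of \<open>N\<close>:
  coefficients vanish at all cosets of \<open>U\<close> that do not meet \<open>N\<close>. It allows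
  work inside \<open>S\<close> without a preimage at hand; \<open>completed_subgroup_ring_eq\<close>
  proves the agreement.\<close>

definition supported :: "('a set \<Rightarrow> 'a set \<Rightarrow> int) set" where
  "supported = {x \<in> carrier S. \<forall>U\<in>\<U>. \<forall>C\<in>carrier (G Mod U). x U C \<noteq> 0 \<longrightarrow> C \<in> (\<lambda>n. U #> n) ` N}"

lemma supportedD: "x \<in> supported \<Longrightarrow> U \<in> \<U> \<Longrightarrow> c \<in> carrier G \<Longrightarrow> x U (U #> c) \<noteq> 0 \<Longrightarrow> \<exists>n\<in>N. U #> c = U #> n"
  unfolding supported_def using coset_in by blast

lemma supportedI:
  assumes "x \<in> carrier S" "\<And>U c. U \<in> \<U> \<Longrightarrow> c \<in> carrier G \<Longrightarrow> x U (U #> c) \<noteq> 0 \<Longrightarrow> \<exists>n\<in>N. U #> c = U #> n"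
  shows "x \<in> supported"
  unfolding supported_def using assms by (fastforce elim: coset_cases)

lemma supported_carrier: "x \<in> supported \<Longrightarrow> x \<in> carrier S"
  by (simp add: supported_def)

lemma supported_subring: "subring supported S"
proof (rule S.subringI)
  show "supported \<subseteq> carrier S" using supported_carrier by blast
  have "\<exists>n\<in>N. U #> c = U #> n" if "U \<in> \<U>" "c \<in> carrier G" "ge \<one> U (U #> c) \<noteq> 0" for U c
    using that subgroup.one_closed[OF N_subgroup] by (auto simp: ge_coeff coset_in split: if_splits)
  then show "\<one>\<^bsub>S\<^esub> \<in> supported"
    unfolding ge_one[symmetric] by (intro supportedI) auto
  show "\<ominus>\<^bsub>S\<^esub> x \<in> supported" if x: "x \<in> supported" for x
  proof (rule supportedI)
    fix U c assume U: "U \<in> \<U>" "c \<in> carrier G" "(\<ominus>\<^bsub>S\<^esub> x) U (U #> c) \<noteq> 0"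
    then have "x U (U #> c) \<noteq> 0" using coeff_uminus[OF supported_carrier[OF x] U(1) coset_in[OF U(2)]] by auto
    then show "\<exists>n\<in>N. U #> c = U #> n" using supportedD[OF x U(1,2)] by blast
  qed (use x supported_carrier in simp)
  show "x \<oplus>\<^bsub>S\<^esub> y \<in> supported" if x: "x \<in> supported" and y: "y \<in> supported" for x y
  proof (rule supportedI)
    fix U c assume U: "U \<in> \<U>" "c \<in> carrier G" "(x \<oplus>\<^bsub>S\<^esub> y) U (U #> c) \<noteq> 0"
    then have "x U (U #> c) \<noteq> 0 \<or> y U (U #> c) \<noteq> 0" using coeff_add[OF U(1) coset_in[OF U(2)], of x y] by auto
    then show "\<exists>n\<in>N. U #> c = U #> n" using supportedD[OF x U(1,2)] supportedD[OF y U(1,2)] by blast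
  qed (use x y supported_carrier in simp)
  show "x \<otimes>\<^bsub>S\<^esub> y \<in> supported" if x: "x \<in> supported" and y: "y \<in> supported" for x y
  proof (rule supportedI)
    fix U c assume U: "U \<in> \<U>" "c \<in> carrier G" "(x \<otimes>\<^bsub>S\<^esub> y) U (U #> c) \<noteq> 0"
    then have "(\<Sum>D\<in>carrier (G Mod U). x U D * y U (inv\<^bsub>G Mod U\<^esub> D \<otimes>\<^bsub>G Mod U\<^esub> (U #> c))) \<noteq> 0"
      using coeff_mult[OF U(1) coset_in[OF U(2)], of x y] by auto
    then obtain D where D: "D \<in> carrier (G Mod U)" "x U D * y U (inv\<^bsub>G Mod U\<^esub> D \<otimes>\<^bsub>G Mod U\<^esub> (U #> c)) \<noteq> 0"
      by (meson sum.neutral)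
    obtain d where d: "d \<in> carrier G" "D = U #> d" using coset_cases[OF D(1)] by blast
    have nz: "x U (U #> d) \<noteq> 0" "y U (U #> (inv d \<otimes> c)) \<noteq> 0"
      using D(2) d U by (auto simp: coset_inv coset_mult)
    obtain n where n: "n \<in> N" "U #> d = U #> n" using supportedD[OF x U(1) d(1) nz(1)] by blast
    obtain m where m: "m \<in> N" "U #> (inv d \<otimes> c) = U #> m"
      using supportedD[OF y U(1) _ nz(2)] d U by auto
    have "U #> c = U #> (d \<otimes> m)" using m coset_cancel[OF U(1) d(1) U(2)] N_carrier by blast
    also have "\<dots> = (U #> n) \<otimes>\<^bsub>G Mod U\<^esub> (U #> m)"
      using coset_mult[OF U(1) d(1) N_carrier[OF m(1)]] n by simp
    also have "\<dots> = U #> (n \<otimes> m)" using coset_mult[OF U(1)] n m N_carrier by blast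
    finally show "\<exists>n\<in>N. U #> c = U #> n" using subgroup.m_closed[OF N_subgroup n(1) m(1)] by blast
  qed (use x y supported_carrier in simp)
qed

lemma ge_supported: "n \<in> N \<Longrightarrow> ge n \<in> supported"
  using N_carrier by (intro supportedI) (auto simp: ge_coeff coset_in split: if_splits)

lemma supported_closed: "S.cl supported \<subseteq> supported"
proof
  fix x assume x: "x \<in> S.cl supported"
  then have xS: "x \<in> carrier S" using S.cl_carrier by blast
  show "x \<in> supported"
  proof (rule supportedI[OF xS])
    fix U c assume U: "U \<in> \<U>" "c \<in> carrier G" "x U (U #> c) \<noteq> 0"
    obtain y where y: "y \<in> supported" "x \<ominus>\<^bsub>S\<^esub> y \<in> ker U" using x U(1) unfolding S.cl_def by blast
    then have "y U (U #> c) \<noteq> 0" using minus_in_ker_iff[OF xS supported_carrier[OF y(1)] U(1)] U(3) by simp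
    then show "\<exists>n\<in>N. U #> c = U #> n" using supportedD[OF y(1) U(1,2)] by blast
  qed
qed

lemma supported_conj:
  assumes x: "x \<in> supported" and h: "h \<in> carrier G" shows "ge (inv h) \<otimes>\<^bsub>S\<^esub> x \<otimes>\<^bsub>S\<^esub> ge h \<in> supported"
proof (rule supportedI)
  have xS: "x \<in> carrier S" using supported_carrier[OF x] .
  show "ge (inv h) \<otimes>\<^bsub>S\<^esub> x \<otimes>\<^bsub>S\<^esub> ge h \<in> carrier S" using xS h by simp
  fix U c assume U: "U \<in> \<U>" "c \<in> carrier G" "(ge (inv h) \<otimes>\<^bsub>S\<^esub> x \<otimes>\<^bsub>S\<^esub> ge h) U (U #> c) \<noteq> 0"
  have "(ge (inv h) \<otimes>\<^bsub>S\<^esub> x \<otimes>\<^bsub>S\<^esub> ge h) U (U #> c) = x U (U #> (h \<otimes> (c \<otimes> inv h)))"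
    using xS h U by (simp add: ge_mult_right ge_mult_left)
  then obtain n where n: "n \<in> N" "U #> (h \<otimes> (c \<otimes> inv h)) = U #> n"
    using supportedD[OF x U(1), of "h \<otimes> (c \<otimes> inv h)"] U h by auto
  have "c = inv h \<otimes> (h \<otimes> (c \<otimes> inv h)) \<otimes> h"
    using h U by (simp add: m_assoc) (simp flip: m_assoc)
  then have "U #> c = (U #> inv h) \<otimes>\<^bsub>G Mod U\<^esub> (U #> (h \<otimes> (c \<otimes> inv h))) \<otimes>\<^bsub>G Mod U\<^esub> (U #> h)"
    using h U by (simp add: coset_mult)
  also have "\<dots> = U #> (inv h \<otimes> n \<otimes> h)" using n h U N_carrier by (simp add: coset_mult)
  finally show "\<exists>n\<in>N. U #> c = U #> n"
    using normal.inv_op_closed1[OF N_normal h n(1)] by blast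
qed

end

section \<open>Nilpotency of the augmentation ideal modulo open normal subgroups\<close>

text \<open>Orbit counting. Orbits have p-power size, so if \<open>x0\<close> were the only fixed
  point, all other orbits would have size divisible by \<open>p\<close> and the size of
  \<open>E\<close> would be 1 modulo \<open>p\<close>.\<close>

lemma p_group_fixed_point:
  assumes H: "group H" "card (carrier H) = p ^ n" and p: "prime p" and E: "finite E" "p dvd card E"
    and act: "\<And>h x. h \<in> carrier H \<Longrightarrow> x \<in> E \<Longrightarrow> act h x \<in> E"
      "\<And>x. x \<in> E \<Longrightarrow> act \<one>\<^bsub>H\<^esub> x = x"
      "\<And>h k x. \<lbrakk>h \<in> carrier H; k \<in> carrier H; x \<in> E\<rbrakk> \<Longrightarrow> act (h \<otimes>\<^bsub>H\<^esub> k) x = act h (act k x)"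
    and x0: "x0 \<in> E" "\<And>h. h \<in> carrier H \<Longrightarrow> act h x0 = x0"
  shows "\<exists>x\<in>E. x \<noteq> x0 \<and> (\<forall>h\<in>carrier H. act h x = x)"
proof (rule ccontr)
  assume none: "\<not> (\<exists>x\<in>E. x \<noteq> x0 \<and> (\<forall>h\<in>carrier H. act h x = x))"
  interpret H: group H by (rule H(1))
  \<comment> \<open>The maps are restricted to \<open>E\<close> because the elements of
    \<open>Bij E\<close> are extensional.\<close>
  define \<phi> where "\<phi> = (\<lambda>h. \<lambda>x\<in>E. act h x)"
  have Bij: "\<phi> h \<in> Bij E" if h: "h \<in> carrier H" for h
  proof -
    have "bij_betw (\<phi> h) E E"
      using h by (intro bij_betw_byWitness[of _ "act (inv\<^bsub>H\<^esub> h)"]) (auto simp: \<phi>_def act(1) act(2) simp flip: act(3))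
    then show ?thesis by (simp add: Bij_def \<phi>_def)
  qed
  have "\<phi> \<in> hom H (BijGroup E)"
  proof (rule homI)
    fix h k assume hk: "h \<in> carrier H" "k \<in> carrier H"
    then have "\<phi> (h \<otimes>\<^bsub>H\<^esub> k) = compose E (\<phi> h) (\<phi> k)"
      by (auto simp: \<phi>_def compose_def act(1,3))
    then show "\<phi> (h \<otimes>\<^bsub>H\<^esub> k) = \<phi> h \<otimes>\<^bsub>BijGroup E\<^esub> \<phi> k"
      using Bij hk by (simp add: BijGroup_def)
  qed (simp add: BijGroup_def Bij)
  then interpret group_action H E \<phi>
    by (intro group_action.intro group_hom.intro group_hom_axioms.intro H group_BijGroup)
  have orb: "orbit H \<phi> x = (\<lambda>h. act h x) ` carrier H" if "x \<in> E" for x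
    using that by (auto simp: orbit_def \<phi>_def)
  have card_orb: "p dvd card (orbit H \<phi> x)" if x: "x \<in> E" "x \<noteq> x0" for x
  proof -
    have "card (orbit H \<phi> x) dvd p ^ n"
      using orbit_stabilizer_theorem[OF x(1)] H(2) by (metis dvd_triv_left order_def)
    then obtain k where k: "card (orbit H \<phi> x) = p ^ k" using divides_primepow_nat[OF p] by blast
    have "k \<noteq> 0"
    proof
      assume "k = 0"
      then obtain y where "orbit H \<phi> x = {y}" using k card_1_singletonE by (metis power_0)
      then have "act h x = y" if "h \<in> carrier H" for h using that orb[OF x(1)] by auto
      then have "\<forall>h\<in>carrier H. act h x = x" using act(2)[OF x(1)] H.one_closed by metis
      then show False using none x by blast
    qed
    then show ?thesis using k by (simp add: dvd_power)
  qed
  have fin: "finite (orbits H E \<phi>)"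
    using E(1) orbits_coverture by (metis finite_UnionD)
  have o0: "orbit H \<phi> x0 = {x0}" using orb[OF x0(1)] x0(2) H.one_closed by auto
  then have in0: "{x0} \<in> orbits H E \<phi>" using x0(1) unfolding orbits_def by blast
  have "card E = (\<Sum>O'\<in>orbits H E \<phi>. card O')"
    using disjoint_sum[OF E(1), of "\<lambda>_. 1::nat"] by simp
  also have "\<dots> = 1 + (\<Sum>O'\<in>orbits H E \<phi> - {{x0}}. card O')"
    using sum.remove[OF fin in0, of card] by simp
  finally have "card E = 1 + (\<Sum>O'\<in>orbits H E \<phi> - {{x0}}. card O')" .
  moreover have "p dvd (\<Sum>O'\<in>orbits H E \<phi> - {{x0}}. card O')"
  proof (rule dvd_sum)
    fix O' assume "O' \<in> orbits H E \<phi> - {{x0}}"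
    then obtain x where "x \<in> E" "O' = orbit H \<phi> x" "O' \<noteq> {x0}" unfolding orbits_def by blast
    then show "p dvd card O'" using card_orb o0 by metis
  qed
  ultimately have "p dvd 1" using E(2) by (metis dvd_add_left_iff)
  then show False using p by (simp add: prime_nat_iff)
qed

context pro_p_group_ring
begin

abbreviation I where "I \<equiv> augmentation_ideal Fp G T"

lemma I_eq_ker: "I = ker (carrier G)"
proof -
  have "x \<in> ker (carrier G) \<longleftrightarrow> x (carrier G) (carrier G) = 0" if x: "x \<in> carrier S" for x
  proof -
    have "C = carrier G" if "C \<in> carrier (G Mod carrier G)" for C
      using that coset_join2[OF _ \<U>_subgroup[OF carrier_in_\<U>]] by (elim coset_cases) auto
    moreover have "carrier G \<in> carrier (G Mod carrier G)"
      using coset_in[of \<one> "carrier G"] coset_join2[OF _ \<U>_subgroup[OF carrier_in_\<U>], of \<one>] by simp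
    ultimately show ?thesis using in_ker_iff[OF carrier_in_\<U> x] by metis
  qed
  then show ?thesis by (auto simp: augmentation_ideal_def ker_def residue_ring_def)
qed

lemma I_ideal: "ideal I S"
  unfolding I_eq_ker by (rule ker_ideal[OF carrier_in_\<U>])

lemma ge_minus_ge_in_I: "h \<in> carrier G \<Longrightarrow> k \<in> carrier G \<Longrightarrow> ge h \<ominus>\<^bsub>S\<^esub> ge k \<in> I"
  unfolding I_eq_ker using coset_join2[OF _ \<U>_subgroup[OF carrier_in_\<U>]]
  by (intro ge_component_eq carrier_in_\<U>) auto

definition stable :: "('a set \<Rightarrow> 'a set \<Rightarrow> int) set \<Rightarrow> bool" where
  "stable Z \<longleftrightarrow> additive_subgroup Z S \<and> (\<forall>h\<in>carrier G. \<forall>x\<in>Z. ge h \<otimes>\<^bsub>S\<^esub> x \<in> Z)"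

text \<open>
  As \<open>G/U\<close> is a p-group, it fixes a nonzero vector in the finite module \<open>S/Z\<close> unless
  \<open>Z = S\<close>. So iterating \<open>next_fix\<close>, starting from the kernel of \<open>S \<rightarrow> \<bbbF>\<^sub>p[G/U]\<close>, reaches
  \<open>S\<close>, while the augmentation ideal maps \<open>next_fix Z\<close> into \<open>Z\<close>.
\<close>

definition next_fix :: "('a set \<Rightarrow> 'a set \<Rightarrow> int) set \<Rightarrow> ('a set \<Rightarrow> 'a set \<Rightarrow> int) set" where
  "next_fix Z = {x \<in> carrier S. \<forall>h\<in>carrier G. ge h \<otimes>\<^bsub>S\<^esub> x \<ominus>\<^bsub>S\<^esub> x \<in> Z}"

lemma stable_sub: "stable Z \<Longrightarrow> Z \<subseteq> carrier S"
  unfolding stable_def using additive_subgroup.a_subset by blast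

lemma next_fix_incl: assumes "stable Z" shows "Z \<subseteq> next_fix Z"
  using assms stable_sub[OF assms] S.additive_subgroup_minus_closed
  unfolding stable_def next_fix_def by blast

lemma stable_next_fix: assumes Z: "stable Z" shows "stable (next_fix Z)"
  unfolding stable_def
proof (intro conjI ballI)
  have aZ: "additive_subgroup Z S" using Z stable_def by blast
  show "additive_subgroup (next_fix Z) S"
  proof (rule additive_subgroup.intro, rule S.add.subgroupI)
    show "next_fix Z \<subseteq> carrier S" by (auto simp: next_fix_def)
    show "next_fix Z \<noteq> {}" using next_fix_incl[OF Z] additive_subgroup.zero_closed[OF aZ] by blast
    fix x assume x: "x \<in> next_fix Z"
    then have xS: "x \<in> carrier S" by (simp add: next_fix_def)
    have "ge h \<otimes>\<^bsub>S\<^esub> (\<ominus>\<^bsub>S\<^esub> x) \<ominus>\<^bsub>S\<^esub> \<ominus>\<^bsub>S\<^esub> x = \<ominus>\<^bsub>S\<^esub> (ge h \<otimes>\<^bsub>S\<^esub> x \<ominus>\<^bsub>S\<^esub> x)" if "h \<in> carrier G" for h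
      using that xS by (simp add: a_minus_def S.r_minus S.minus_add)
    then show "\<ominus>\<^bsub>S\<^esub> x \<in> next_fix Z"
      using x additive_subgroup.a_inv_closed[OF aZ] by (simp add: next_fix_def)
    fix y assume y: "y \<in> next_fix Z"
    then have yS: "y \<in> carrier S" by (simp add: next_fix_def)
    have "ge h \<otimes>\<^bsub>S\<^esub> (x \<oplus>\<^bsub>S\<^esub> y) \<ominus>\<^bsub>S\<^esub> (x \<oplus>\<^bsub>S\<^esub> y) = (ge h \<otimes>\<^bsub>S\<^esub> x \<ominus>\<^bsub>S\<^esub> x) \<oplus>\<^bsub>S\<^esub> (ge h \<otimes>\<^bsub>S\<^esub> y \<ominus>\<^bsub>S\<^esub> y)" if "h \<in> carrier G" for h
      using that xS yS S.minus_add_minus by (simp add: S.r_distr)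
    then show "x \<oplus>\<^bsub>S\<^esub> y \<in> next_fix Z"
      using x y additive_subgroup.a_closed[OF aZ] by (simp add: next_fix_def)
  qed
  fix k x assume k: "k \<in> carrier G" and x: "x \<in> next_fix Z"
  then have xS: "x \<in> carrier S" by (simp add: next_fix_def)
  have "ge h \<otimes>\<^bsub>S\<^esub> (ge k \<otimes>\<^bsub>S\<^esub> x) \<ominus>\<^bsub>S\<^esub> ge k \<otimes>\<^bsub>S\<^esub> x \<in> Z" if h: "h \<in> carrier G" for h
  proof -
    have "ge h \<otimes>\<^bsub>S\<^esub> (ge k \<otimes>\<^bsub>S\<^esub> x) = ge (h \<otimes> k) \<otimes>\<^bsub>S\<^esub> x"
      using h k xS by (simp flip: S.m_assoc add: ge_mult)
    moreover have "ge (h \<otimes> k) \<otimes>\<^bsub>S\<^esub> x \<ominus>\<^bsub>S\<^esub> x \<in> Z" "ge k \<otimes>\<^bsub>S\<^esub> x \<ominus>\<^bsub>S\<^esub> x \<in> Z"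
      using x h k by (auto simp: next_fix_def)
    ultimately show ?thesis
      using S.additive_subgroup_minus_trans[OF aZ _ xS] S.additive_subgroup_minus_sym[OF aZ _ xS] h k xS by simp
  qed
  then show "ge k \<otimes>\<^bsub>S\<^esub> x \<in> next_fix Z" using k xS by (simp add: next_fix_def)
qed

text \<open>On \<open>next_fix Z\<close> modulo \<open>Z\<close> each group element acts as the
  identity, so an arbitrary \<open>y\<close> acts as multiplication by its augmentation, which is
  zero on \<open>I\<close>. The set \<open>?M\<close> expresses this with a natural number
  \<open>m\<close> as a lift of the scalar.\<close>

lemma augmentation_next_fix:
  assumes Z: "stable Z" and U: "U \<in> \<U>" "ker U \<subseteq> Z" and x: "x \<in> next_fix Z" and y: "y \<in> I"
  shows "y \<otimes>\<^bsub>S\<^esub> x \<in> Z"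
proof -
  have aZ: "additive_subgroup Z S" using Z stable_def by blast
  have xS: "x \<in> carrier S" using x by (simp add: next_fix_def)
  note CG = carrier_in_\<U>
  let ?c = "\<lambda>y. y (carrier G) (carrier G)"
  have CC: "carrier G \<in> carrier (G Mod carrier G)"
    using coset_in[of \<one> "carrier G"] coset_join2[OF _ \<U>_subgroup[OF CG], of \<one>] by simp
  let ?M = "{y \<in> carrier S. \<exists>m::nat. ?c y = int m mod int p \<and> y \<otimes>\<^bsub>S\<^esub> x \<ominus>\<^bsub>S\<^esub> add_pow S m x \<in> Z}"
  have "y \<in> ?M"
  \<comment> \<open>Elements of this kernel lie both in \<open>ker (carrier G)\<close> and in
    \<open>ker U\<close>: they have augmentation zero and multiply \<open>x\<close> into
    \<open>Z\<close>.\<close>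
  proof (rule ge_span[OF inter_in_\<U>[OF U(1) CG]])
    show "?M \<subseteq> carrier S" by blast
    fix a b assume "a \<in> ?M" "b \<in> ?M"
    then obtain m n :: nat where a: "a \<in> carrier S" "?c a = int m mod int p" "a \<otimes>\<^bsub>S\<^esub> x \<ominus>\<^bsub>S\<^esub> add_pow S m x \<in> Z"
      and b: "b \<in> carrier S" "?c b = int n mod int p" "b \<otimes>\<^bsub>S\<^esub> x \<ominus>\<^bsub>S\<^esub> add_pow S n x \<in> Z" by blast
    have "(a \<oplus>\<^bsub>S\<^esub> b) \<otimes>\<^bsub>S\<^esub> x \<ominus>\<^bsub>S\<^esub> add_pow S (m + n) x =
        (a \<otimes>\<^bsub>S\<^esub> x \<ominus>\<^bsub>S\<^esub> add_pow S m x) \<oplus>\<^bsub>S\<^esub> (b \<otimes>\<^bsub>S\<^esub> x \<ominus>\<^bsub>S\<^esub> add_pow S n x)"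
      using a b xS by (simp add: S.l_distr S.add.nat_pow_mult[symmetric] S.minus_add_minus)
    then have "(a \<oplus>\<^bsub>S\<^esub> b) \<otimes>\<^bsub>S\<^esub> x \<ominus>\<^bsub>S\<^esub> add_pow S (m + n) x \<in> Z"
      using a b additive_subgroup.a_closed[OF aZ] by simp
    moreover have "?c (a \<oplus>\<^bsub>S\<^esub> b) = int (m + n) mod int p"
      using a b by (simp add: coeff_add[OF CG CC] mod_add_eq)
    ultimately show "a \<oplus>\<^bsub>S\<^esub> b \<in> ?M" using a(1) b(1) by blast
  next
    show "ker (U \<inter> carrier G) \<subseteq> ?M"
    proof
      fix a assume a: "a \<in> ker (U \<inter> carrier G)"
      then have aS: "a \<in> carrier S" by (simp add: ker_def)
      have "a \<in> ker (carrier G)" "a \<in> ker U"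
        using a ker_mono[OF inter_in_\<U>[OF U(1) CG] CG] ker_mono[OF inter_in_\<U>[OF U(1) CG] U(1)] by auto
      then have "?c a = 0" "a \<otimes>\<^bsub>S\<^esub> x \<in> Z"
        using in_ker_iff[OF CG aS] CC ideal.I_r_closed[OF ker_ideal[OF U(1)] _ xS] U(2) by auto
      then have "?c a = int 0 mod int p" "a \<otimes>\<^bsub>S\<^esub> x \<ominus>\<^bsub>S\<^esub> add_pow S (0::nat) x \<in> Z"
        using aS xS by (auto simp: a_minus_def)
      then show "a \<in> ?M" using aS by blast
    qed
  next
    fix h assume h: "h \<in> carrier G"
    have "?c (ge h) = int 1 mod int p"
      using ge_coeff[OF CG CC, of h] coset_join2[OF h \<U>_subgroup[OF CG] h] p_gt_1 by simp
    moreover have "ge h \<otimes>\<^bsub>S\<^esub> x \<ominus>\<^bsub>S\<^esub> add_pow S (1::nat) x \<in> Z"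
      using x h xS by (simp add: next_fix_def)
    ultimately show "ge h \<in> ?M" using h by blast
  qed (use y in \<open>simp add: augmentation_ideal_def\<close>)
  then obtain m :: nat where m: "?c y = int m mod int p" "y \<otimes>\<^bsub>S\<^esub> x \<ominus>\<^bsub>S\<^esub> add_pow S m x \<in> Z" by blast
  have "?c y = 0" using y by (simp add: augmentation_ideal_def residue_ring_def)
  then have "int m mod int p = 0" using m(1) by simp
  then have "p dvd m" by (simp add: mod_eq_0_iff_dvd)
  then obtain q where "m = p * q" by blast
  then have "add_pow S m x = add_pow S q (add_pow S p x)" using xS by (simp add: S.add.nat_pow_pow)
  then have "add_pow S m x = \<zero>\<^bsub>S\<^esub>" using char_p[OF xS] by simp
  then show ?thesis using m(2) xS y by (simp add: a_minus_def augmentation_ideal_def)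
qed

text \<open>The quotient of \<open>S\<close> by \<open>Z\<close> is a finite group on which
  \<open>G/U\<close> acts. It contains an element of order \<open>p\<close>, so its order is
  divisible by \<open>p\<close>, and the fixed point count yields a nonzero invariant class.\<close>

lemma next_fix_strict:
  assumes Z: "stable Z" and U: "U \<in> \<U>" "ker U \<subseteq> Z" and ne: "Z \<noteq> carrier S"
  shows "\<exists>x\<in>next_fix Z. x \<notin> Z"
proof -
  have aZ: "additive_subgroup Z S" using Z stable_def by blast
  have sZ: "subgroup Z (add_monoid S)" using aZ additive_subgroup.a_subgroup by blast
  let ?A = "add_monoid S"
  define Q where "Q = ?A Mod Z"
  have nZ: "Z \<lhd> ?A" using S.a_comm_group sZ comm_group.subgroup_imp_normal by blast
  interpret Q: group Q unfolding Q_def using normal.factorgroup_is_group[OF nZ] .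
  define cl where "cl x = Z #>\<^bsub>?A\<^esub> x" for x
  have EQ: "carrier Q = cl ` carrier S" by (auto simp: Q_def cl_def FactGroup_def RCOSETS_def)
  have cl_eq: "cl x = cl y \<longleftrightarrow> x \<ominus>\<^bsub>S\<^esub> y \<in> Z" if "x \<in> carrier S" "y \<in> carrier S" for x y
    using group.r_coset_eq_iff[OF S.add.is_group sZ] that by (simp add: cl_def a_minus_def a_inv_def)
  have fin: "finite (carrier Q)"
  proof -
    \<comment> \<open>A class modulo \<open>Z\<close> is determined by the component at
      \<open>U\<close> of any representative, which bounds the number of classes by the size of the
      finite group ring.\<close>
    have rep: "cl x = cl (SOME y. y \<in> carrier S \<and> y U = x U)" if x: "x \<in> carrier S" for x
    proof -
      let ?y = "SOME y. y \<in> carrier S \<and> y U = x U"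
      have "?y \<in> carrier S \<and> ?y U = x U" using someI[of "\<lambda>y. y \<in> carrier S \<and> y U = x U" x] x by blast
      then show ?thesis using cl_eq[OF x, of ?y] minus_in_ker_iff[OF x _ U(1), of ?y] U(2) by auto
    qed
    have "carrier Q \<subseteq> (\<lambda>a. cl (SOME y. y \<in> carrier S \<and> y U = a)) ` carrier (A U)"
    proof
      fix D assume "D \<in> carrier Q"
      then obtain x where x: "x \<in> carrier S" "D = cl x" unfolding EQ by blast
      show "D \<in> (\<lambda>a. cl (SOME y. y \<in> carrier S \<and> y U = a)) ` carrier (A U)"
        unfolding x(2) using rep[OF x(1)] S_component[OF x(1) U(1)] by (rule image_eqI[where x = "x U"])
    qed
    then show ?thesis
      using finite_group_ring.finite_A[OF finite_group_ring_quotient[OF U(1)]] finite_subset by blast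
  qed
  obtain x1 where x1: "x1 \<in> carrier S" "x1 \<notin> Z" using ne stable_sub[OF Z] by blast
  have cl_pow: "cl x [^]\<^bsub>Q\<^esub> (n::nat) = cl (add_pow S n x)" if "x \<in> carrier S" for x n
  proof (induction n)
    case 0
    then show ?case using group.coset_mult_one[OF S.add.is_group, of Z] stable_sub[OF Z] by (simp add: Q_def cl_def FactGroup_def)
  next
    case (Suc n)
    then show ?case using normal.rcos_sum[OF nZ, of "add_pow S n x" x] that by (simp add: Q_def cl_def FactGroup_def)
  qed
  have one: "\<one>\<^bsub>Q\<^esub> = cl \<zero>\<^bsub>S\<^esub>"
    using group.coset_mult_one[OF S.add.is_group, of Z] stable_sub[OF Z] by (simp add: Q_def cl_def FactGroup_def)
  have "cl x1 [^]\<^bsub>Q\<^esub> p = \<one>\<^bsub>Q\<^esub>" unfolding cl_pow[OF x1(1)] char_p[OF x1(1)] one ..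
  then have "group.ord Q (cl x1) dvd p" using Q.pow_eq_id[of "cl x1" p] x1(1) EQ by blast
  moreover have "group.ord Q (cl x1) \<noteq> 1"
  proof
    assume "group.ord Q (cl x1) = 1"
    then have "cl x1 = cl \<zero>\<^bsub>S\<^esub>" using Q.ord_eq_1[of "cl x1"] x1(1) EQ one by auto
    then show False using cl_eq[of x1 "\<zero>\<^bsub>S\<^esub>"] x1 by (simp add: a_minus_def)
  qed
  ultimately have "group.ord Q (cl x1) = p" using prime_p by (metis prime_nat_iff)
  then have pd: "p dvd card (carrier Q)"
    using Q.ord_dvd_group_order[of "cl x1"] x1(1) EQ by (auto simp: order_def)
  \<comment> \<open>The action on classes is defined through chosen representatives of both cosets;
    the next fact shows that the choice does not matter.\<close>
  define act where "act = (\<lambda>C D. cl (ge (SOME h. h \<in> carrier G \<and> C = U #> h) \<otimes>\<^bsub>S\<^esub> (SOME x. x \<in> carrier S \<and> D = cl x)))"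
  have act: "act (U #> h) (cl x) = cl (ge h \<otimes>\<^bsub>S\<^esub> x)" if h: "h \<in> carrier G" and x: "x \<in> carrier S" for h x
  proof -
    define k where "k = (SOME k. k \<in> carrier G \<and> U #> h = U #> k)"
    define y where "y = (SOME y. y \<in> carrier S \<and> cl x = cl y)"
    have k: "k \<in> carrier G" "U #> h = U #> k"
      unfolding k_def using someI[of "\<lambda>k. k \<in> carrier G \<and> U #> h = U #> k" h] h by auto
    have y: "y \<in> carrier S" "cl x = cl y"
      unfolding y_def using someI[of "\<lambda>y. y \<in> carrier S \<and> cl x = cl y" x] x by auto
    have "ge k \<ominus>\<^bsub>S\<^esub> ge h \<in> ker U" using ge_component_eq[OF k(1) h U(1)] k(2) by simp
    then have "(ge k \<ominus>\<^bsub>S\<^esub> ge h) \<otimes>\<^bsub>S\<^esub> y \<in> Z" using ideal.I_r_closed[OF ker_ideal[OF U(1)] _ y(1)] U(2) by blast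
    then have 1: "ge k \<otimes>\<^bsub>S\<^esub> y \<ominus>\<^bsub>S\<^esub> ge h \<otimes>\<^bsub>S\<^esub> y \<in> Z"
      using k h y by (simp add: a_minus_def S.l_distr S.l_minus)
    have "ge h \<otimes>\<^bsub>S\<^esub> (y \<ominus>\<^bsub>S\<^esub> x) \<in> Z"
      using cl_eq[OF y(1) x] y(2) Z h unfolding stable_def by auto
    then have 2: "ge h \<otimes>\<^bsub>S\<^esub> y \<ominus>\<^bsub>S\<^esub> ge h \<otimes>\<^bsub>S\<^esub> x \<in> Z"
      using h x y by (simp add: a_minus_def S.r_distr S.r_minus)
    have "ge k \<otimes>\<^bsub>S\<^esub> y \<ominus>\<^bsub>S\<^esub> ge h \<otimes>\<^bsub>S\<^esub> x \<in> Z"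
      using S.additive_subgroup_minus_trans[OF aZ _ _ _ 1 2] h k x y by simp
    then have "cl (ge k \<otimes>\<^bsub>S\<^esub> y) = cl (ge h \<otimes>\<^bsub>S\<^esub> x)" using cl_eq h k x y by simp
    then show ?thesis unfolding act_def k_def[symmetric] y_def[symmetric] .
  qed
  obtain n where n: "card (carrier (G Mod U)) = p ^ n" using card_cosets[OF U(1)] .
  have "\<exists>D\<in>carrier Q. D \<noteq> cl \<zero>\<^bsub>S\<^esub> \<and> (\<forall>C\<in>carrier (G Mod U). act C D = D)"
  proof (rule p_group_fixed_point[OF normal.factorgroup_is_group[OF \<U>_normal[OF U(1)]] n prime_p fin pd])
    show "act C D \<in> carrier Q" if "C \<in> carrier (G Mod U)" "D \<in> carrier Q" for C D
      using that act unfolding EQ by (auto elim!: coset_cases)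
    show "act \<one>\<^bsub>G Mod U\<^esub> D = D" if "D \<in> carrier Q" for D
      using that act[OF one_closed] unfolding EQ coset_one[OF U(1)] by (auto simp: ge_one)
    show "act (C \<otimes>\<^bsub>G Mod U\<^esub> C') D = act C (act C' D)"
      if C: "C \<in> carrier (G Mod U)" "C' \<in> carrier (G Mod U)" and D: "D \<in> carrier Q" for C C' D
    proof -
      obtain h where h: "h \<in> carrier G" "C = U #> h" using coset_cases[OF C(1)] .
      obtain k where k: "k \<in> carrier G" "C' = U #> k" using coset_cases[OF C(2)] .
      obtain x where x: "x \<in> carrier S" "D = cl x" using D EQ by blast
      have "ge (h \<otimes> k) \<otimes>\<^bsub>S\<^esub> x = ge h \<otimes>\<^bsub>S\<^esub> (ge k \<otimes>\<^bsub>S\<^esub> x)"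
        using h k x by (simp add: S.m_assoc flip: ge_mult)
      then show ?thesis using h k x U(1) by (simp add: coset_mult act)
    qed
    show "cl \<zero>\<^bsub>S\<^esub> \<in> carrier Q" using EQ by auto
    show "act C (cl \<zero>\<^bsub>S\<^esub>) = cl \<zero>\<^bsub>S\<^esub>" if C: "C \<in> carrier (G Mod U)" for C
    proof -
      obtain h where h: "h \<in> carrier G" "C = U #> h" using coset_cases[OF C(1)] .
      then show ?thesis using act[OF h(1), of "\<zero>\<^bsub>S\<^esub>"] by simp
    qed
  qed
  then obtain D where D: "D \<in> carrier Q" "D \<noteq> cl \<zero>\<^bsub>S\<^esub>" "\<And>C. C \<in> carrier (G Mod U) \<Longrightarrow> act C D = D" by blast
  obtain x where x: "x \<in> carrier S" "D = cl x" using D(1) EQ by blast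
  have "ge h \<otimes>\<^bsub>S\<^esub> x \<ominus>\<^bsub>S\<^esub> x \<in> Z" if "h \<in> carrier G" for h
    using D(3)[OF coset_in[OF that]] act[OF that x(1)] cl_eq[of "ge h \<otimes>\<^bsub>S\<^esub> x" x] that x by simp
  then have "x \<in> next_fix Z" using x by (simp add: next_fix_def)
  moreover have "x \<notin> Z" using D(2) x cl_eq[OF x(1) S_zero_closed] by (simp add: a_minus_def)
  ultimately show ?thesis by blast
qed

lemma stable_ker: "U \<in> \<U> \<Longrightarrow> stable (ker U)"
  unfolding stable_def using ker_ideal ideal.axioms(1) ideal.I_l_closed by fastforce

lemma stable_iterate:
  assumes U: "U \<in> \<U>"
  shows "stable ((next_fix ^^ k) (ker U)) \<and> ker U \<subseteq> (next_fix ^^ k) (ker U)"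
proof (induction k)
  case 0
  then show ?case using stable_ker[OF U] by simp
next
  case (Suc k)
  then show ?case using stable_next_fix next_fix_incl by simp blast
qed

text \<open>All members of the chain contain \<open>ker U\<close>, so a strict inclusion stays
  strict after projecting to the finite ring at \<open>U\<close>. There a strictly increasing chain
  cannot continue forever.\<close>

lemma next_fix_exhausts:
  assumes U: "U \<in> \<U>" shows "\<exists>k. (next_fix ^^ k) (ker U) = carrier S"
proof (rule ccontr)
  let ?Z = "\<lambda>k. (next_fix ^^ k) (ker U)"
  assume "\<nexists>k. ?Z k = carrier S"
  then have ne: "?Z k \<noteq> carrier S" for k by blast
  note st = stable_iterate[OF U]
  let ?B = "\<lambda>k. (\<lambda>x. x U) ` ?Z k"
  have BA: "?B k \<subseteq> carrier (A U)" for k using S_component[OF _ U] stable_sub st by blast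
  have fin: "finite (carrier (A U))" using finite_group_ring.finite_A[OF finite_group_ring_quotient[OF U]] .
  have strict: "?B k \<subset> ?B (Suc k)" for k
  proof -
    obtain x where x: "x \<in> ?Z (Suc k)" "x \<notin> ?Z k" using next_fix_strict[OF _ U _ ne] st by (metis funpow.simps(2) o_apply)
    have nex: "x U \<noteq> y U" if y: "y \<in> ?Z k" for y
    proof
      assume "x U = y U"
      moreover have xS: "x \<in> carrier S" and yS: "y \<in> carrier S" using x y st stable_sub by blast+
      ultimately have "x \<ominus>\<^bsub>S\<^esub> y \<in> ?Z k" using minus_in_ker_iff[OF _ _ U] st by blast
      then show False
        using S.additive_subgroup_minus_iff[OF _ xS yS] st[of k] x y unfolding stable_def by blast
    qed
    have "?Z k \<subseteq> ?Z (Suc k)" using next_fix_incl st by simp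
    then have sub: "?B k \<subseteq> ?B (Suc k)" by (rule image_mono)
    have in1: "x U \<in> ?B (Suc k)" using x(1) by (rule imageI)
    have notin: "x U \<notin> ?B k"
    proof
      assume "x U \<in> ?B k"
      then obtain y where y: "x U = y U" "y \<in> ?Z k" by (rule imageE)
      show False by (rule notE[OF nex[OF y(2)] y(1)])
    qed
    have "?B k \<noteq> ?B (Suc k)"
    proof
      assume "?B k = ?B (Suc k)"
      from in1[folded this] show False by (rule notE[OF notin])
    qed
    with sub show ?thesis by (rule psubsetI)
  qed
  have lt: "card (?B k) < card (?B (Suc k))" for k
    by (rule psubset_card_mono[OF finite_subset[OF BA fin] strict])
  have "k \<le> card (?B k)" for k
  proof (induction k)
    case (Suc k) then show ?case using lt[of k] by linarith
  qed simp
  from this[of "Suc (card (carrier (A U)))"] card_mono[OF fin BA, of "Suc (card (carrier (A U)))"]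
  show False by linarith
qed

text \<open>Each new factor from \<open>I\<close>, split off on the left, moves one step down the
  chain; after as many steps as it takes to reach \<open>S\<close>, the bottom \<open>ker U\<close>
  is attained.\<close>

lemma augmentation_nilpotent:
  assumes U: "U \<in> \<U>" shows "\<exists>k::nat. I [^]\<^bsub>ideals_set S\<^esub> k \<subseteq> ker U"
proof -
  let ?Z = "\<lambda>k. (next_fix ^^ k) (ker U)"
  obtain k where k: "?Z k = carrier S" using next_fix_exhausts[OF U] by blast
  note st = stable_iterate[OF U]
  have "I [^]\<^bsub>ideals_set S\<^esub> j \<subseteq> ?Z (k - j)" if "j \<le> k" for j
    using that
  proof (induction j)
    case 0
    then show ?case using k unfolding S.ideal_power_0 by simp
  next
    case (Suc j)
    have eq: "k - j = Suc (k - Suc j)" using Suc.prems by simp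
    have "I [^]\<^bsub>ideals_set S\<^esub> j \<subseteq> ?Z (k - j)" using Suc.IH Suc_leD[OF Suc.prems] .
    also have "?Z (k - j) = next_fix (?Z (k - Suc j))" unfolding eq by simp
    finally have IH: "I [^]\<^bsub>ideals_set S\<^esub> j \<subseteq> next_fix (?Z (k - Suc j))" .
    have "x \<in> ?Z (k - Suc j)" if "x \<in> I \<cdot>\<^bsub>S\<^esub> (I [^]\<^bsub>ideals_set S\<^esub> j)" for x
      using that
    proof (induction x rule: ideal_prod.induct)
      case (prod a b)
      show ?case
        by (rule augmentation_next_fix[OF conjunct1[OF st] U conjunct2[OF st] subsetD[OF IH prod(2)] prod(1)])
    next
      case (sum a b)
      have "additive_subgroup (?Z (k - Suc j)) S" using st[of "k - Suc j"] unfolding stable_def by (rule conjunct1[OF conjunct1])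
      then show ?case using sum(3,4) by (rule additive_subgroup.a_closed)
    qed
    then show ?case using S.ideal_power_Suc2[OF I_ideal, of j] by blast
  qed
  from this[of k] show ?thesis by auto
qed

end

section \<open>Powers of group elements\<close>

context ring
begin

lemma one_add_pow_psum:
  assumes t: "t \<in> carrier R"
  shows "(t \<oplus> \<one>) [^] m = psum t (\<lambda>i. add_pow R (m choose i) \<one>) (Suc m)"
proof (induction m)
  case 0
  show ?case using t by (simp add: psum_Suc)
next
  case (Suc m)
  let ?a = "\<lambda>i. add_pow R (m choose i) \<one>"
  let ?P = "psum t ?a (Suc m)"
  have a: "?a i \<in> carrier R" for i by simp
  have P: "?P \<in> carrier R" by (rule psum_closed[OF t a])
  have cn: "case_nat \<zero> ?a i \<in> carrier R" for i by (cases i) auto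
  have "(t \<oplus> \<one>) [^] Suc m = (t \<oplus> \<one>) \<otimes> ?P"
    using t Suc nat_pow_Suc2[of "t \<oplus> \<one>" m] by simp
  also have "\<dots> = t \<otimes> ?P \<oplus> \<zero> \<oplus> ?P" using t P by (simp add: l_distr)
  also have "t \<otimes> ?P \<oplus> \<zero> = psum t (case_nat \<zero> ?a) (Suc (Suc m))"
    using psum_shift[of t ?a "\<zero>" "Suc m", OF t a] by simp
  also have "?P = psum t ?a (Suc (Suc m))"
    using psum_Suc[of t ?a "Suc m", OF t a] t P by (simp add: binomial_eq_0)
  also have "psum t (case_nat \<zero> ?a) (Suc (Suc m)) \<oplus> psum t ?a (Suc (Suc m)) =
      psum t (\<lambda>i. case_nat \<zero> ?a i \<oplus> ?a i) (Suc (Suc m))"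
    by (rule psum_add[symmetric, OF t cn a])
  also have "\<dots> = psum t (\<lambda>i. add_pow R (Suc m choose i) \<one>) (Suc (Suc m))"
  proof (rule psum_cong[OF _ t])
    fix i
    show "case_nat \<zero> ?a i \<oplus> ?a i = add_pow R (Suc m choose i) \<one>"
      by (cases i) (simp_all add: add.nat_pow_mult)
  qed (use cn in auto)
  finally show ?case .
qed

text \<open>The inner binomial coefficients are multiples of \<open>p\<close> and vanish. Adding one
  is safe in a noncommutative ring, since one commutes with \<open>t\<close>.\<close>

lemma frobenius_add_one:
  assumes p: "prime (p::nat)" and char: "add_pow R p \<one> = \<zero>" and t: "t \<in> carrier R"
  shows "(t \<oplus> \<one>) [^] p = t [^] p \<oplus> \<one>"
proof -
  let ?a = "\<lambda>i. add_pow R (p choose i) \<one>"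
  have a: "?a i \<in> carrier R" for i by simp
  have zero: "?a i = \<zero>" if "0 < i" "i < p" for i
  proof -
    have "p dvd (p choose i)" using that p by (intro dvd_choose_prime) auto
    then obtain q where "p choose i = p * q" by blast
    moreover have "add_pow R (p * q) \<one> = add_pow R q (add_pow R p \<one>)" by (simp add: add.nat_pow_pow)
    ultimately show ?thesis using char by simp
  qed
  have "psum t ?a k = \<one>" if "0 < k" "k \<le> p" for k
    using that
  proof (induction k)
    case (Suc k)
    show ?case
    proof (cases "k = 0")
      case True
      then show ?thesis using psum_Suc[of t ?a 0, OF t a] t by simp
    next
      case False
      then show ?thesis using Suc psum_Suc[of t ?a k, OF t a] zero[of k] t by simp
    qed
  qed simp
  then have "psum t ?a p = \<one>" using p prime_gt_0_nat by blast
  then show ?thesis using one_add_pow_psum[OF t, of p] psum_Suc[of t ?a p, OF t a] t by (simp add: a_comm)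
qed

lemma frobenius_iter_add_one:
  assumes p: "prime (p::nat)" and char: "add_pow R p \<one> = \<zero>" and t: "t \<in> carrier R"
  shows "(t \<oplus> \<one>) [^] (p ^ n) = t [^] (p ^ n) \<oplus> \<one>"
proof (induction n)
  case (Suc n)
  have "(t \<oplus> \<one>) [^] (p ^ Suc n) = ((t \<oplus> \<one>) [^] (p ^ n)) [^] p"
    using t by (simp add: nat_pow_pow mult.commute)
  also have "\<dots> = (t [^] (p ^ n)) [^] p \<oplus> \<one>" unfolding Suc using t by (intro frobenius_add_one p char) simp
  finally show ?case using t by (simp add: nat_pow_pow mult.commute)
qed (use t in simp)

end

context pro_p_group_ring
begin

lemma ge_pow: "g \<in> carrier G \<Longrightarrow> ge g [^]\<^bsub>S\<^esub> (i::nat) = ge (g [^] i)"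
  by (induction i) (simp_all add: ge_one ge_mult)

text \<open>Frobenius for \<open>g = s + 1\<close>. The right side is kept as a difference of group
  elements, so that it lies in the kernel as soon as the power of \<open>g\<close> lies in the
  subgroup.\<close>

lemma ge_minus_one_pow:
  assumes g: "g \<in> carrier G"
  shows "(ge g \<ominus>\<^bsub>S\<^esub> \<one>\<^bsub>S\<^esub>) [^]\<^bsub>S\<^esub> (p ^ n) = ge (g [^] (p ^ n)) \<ominus>\<^bsub>S\<^esub> ge \<one>"
proof -
  let ?t = "ge g \<ominus>\<^bsub>S\<^esub> \<one>\<^bsub>S\<^esub>"
  have t: "?t \<in> carrier S" using g by simp
  have cancel: "(x \<ominus>\<^bsub>S\<^esub> y) \<oplus>\<^bsub>S\<^esub> y = x" "(x \<oplus>\<^bsub>S\<^esub> y) \<ominus>\<^bsub>S\<^esub> y = x" if "x \<in> carrier S" "y \<in> carrier S" for x y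
    using that by (simp_all add: a_minus_def S.a_assoc S.l_neg S.r_neg)
  have "ge (g [^] (p ^ n)) = (?t \<oplus>\<^bsub>S\<^esub> \<one>\<^bsub>S\<^esub>) [^]\<^bsub>S\<^esub> (p ^ n)"
    using g ge_pow[OF g, of "p ^ n"] cancel(1) by simp
  also have "\<dots> = ?t [^]\<^bsub>S\<^esub> (p ^ n) \<oplus>\<^bsub>S\<^esub> \<one>\<^bsub>S\<^esub>"
    using char_p[of "\<one>\<^bsub>S\<^esub>"] t by (intro S.frobenius_iter_add_one prime_p) auto
  finally have "ge (g [^] (p ^ n)) \<ominus>\<^bsub>S\<^esub> \<one>\<^bsub>S\<^esub> = ?t [^]\<^bsub>S\<^esub> (p ^ n)"
    using t by (simp only: cancel(2) S.nat_pow_closed S.one_closed)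
  then show ?thesis unfolding ge_one by simp
qed

lemma coeff_psum:
  assumes "t \<in> carrier S" "\<And>i. a i \<in> carrier S" "U \<in> \<U>" "C \<in> carrier (G Mod U)"
  shows "S.psum t a m U C = (\<Sum>i<m. (t [^]\<^bsub>S\<^esub> i \<otimes>\<^bsub>S\<^esub> a i) U C) mod int p"
proof (induction m)
  case 0
  then show ?case using assms by (simp add: coeff_zero)
next
  case (Suc m)
  then show ?case using S.psum_Suc[of t a m, OF assms(1,2)] coeff_add[OF assms(3,4)]
    by (simp add: mod_add_left_eq)
qed

end

context pro_p_group_ring_normal
begin

text \<open>Together the hypotheses say that each coset of \<open>NV\<close> contains exactly one of
  the powers of \<open>g\<close> below \<open>m\<close>. Spanning is then checked on group elements,
  and independence by evaluating at the coset of \<open>g [^] i \<otimes> n\<close>.\<close>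

lemma power_basis_ge:
  assumes V: "V \<in> \<U>" and g: "g \<in> carrier G"
    and indep: "\<And>i j n n'. \<lbrakk>i < m; j < m; n \<in> N; n' \<in> N; V #> (g [^] i \<otimes> n) = V #> (g [^] j \<otimes> n')\<rbrakk> \<Longrightarrow> i = (j::nat)"
    and cover: "\<And>c. c \<in> carrier G \<Longrightarrow> \<exists>j<m. \<exists>n\<in>N. V #> c = V #> (g [^] (j::nat) \<otimes> n)"
  shows "S.power_basis_mod supported (ker V) (ge g) m"
  unfolding S.power_basis_mod_def
proof (intro conjI ballI allI impI)
  note sub = subringE[OF supported_subring]
  have kV: "additive_subgroup (ker V) S" using ker_ideal[OF V] ideal.axioms(1) by blast
  fix x assume x: "x \<in> carrier S"
  let ?M = "{x \<in> carrier S. \<exists>a. (\<forall>i. a i \<in> supported) \<and> x \<ominus>\<^bsub>S\<^esub> S.psum (ge g) a m \<in> ker V}"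
  have "x \<in> ?M"
  proof (rule ge_span[OF V _ _ _ _ x])
    show "?M \<subseteq> carrier S" by blast
    fix x y assume "x \<in> ?M" "y \<in> ?M"
    then obtain a b where xa: "x \<in> carrier S" "\<And>i. a i \<in> supported" "x \<ominus>\<^bsub>S\<^esub> S.psum (ge g) a m \<in> ker V"
      and yb: "y \<in> carrier S" "\<And>i. b i \<in> supported" "y \<ominus>\<^bsub>S\<^esub> S.psum (ge g) b m \<in> ker V" by blast
    let ?c = "\<lambda>i. a i \<oplus>\<^bsub>S\<^esub> b i"
    have p: "S.psum (ge g) a m \<in> carrier S" "S.psum (ge g) b m \<in> carrier S"
      using S.psum_closed[of "ge g" a m, OF ge_closed[OF g] supported_carrier[OF xa(2)]]
        S.psum_closed[of "ge g" b m, OF ge_closed[OF g] supported_carrier[OF yb(2)]] by auto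
    have "S.psum (ge g) ?c m = S.psum (ge g) a m \<oplus>\<^bsub>S\<^esub> S.psum (ge g) b m"
      by (rule S.psum_add[OF ge_closed[OF g] supported_carrier[OF xa(2)] supported_carrier[OF yb(2)]])
    then have "(x \<oplus>\<^bsub>S\<^esub> y) \<ominus>\<^bsub>S\<^esub> S.psum (ge g) ?c m = (x \<ominus>\<^bsub>S\<^esub> S.psum (ge g) a m) \<oplus>\<^bsub>S\<^esub> (y \<ominus>\<^bsub>S\<^esub> S.psum (ge g) b m)"
      using S.minus_add_minus[OF xa(1) yb(1) p] by simp
    then have "(x \<oplus>\<^bsub>S\<^esub> y) \<ominus>\<^bsub>S\<^esub> S.psum (ge g) ?c m \<in> ker V"
      using additive_subgroup.a_closed[OF kV xa(3) yb(3)] by simp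
    moreover have "\<forall>i. ?c i \<in> supported" using sub(7) xa(2) yb(2) by blast
    moreover have "x \<oplus>\<^bsub>S\<^esub> y \<in> carrier S" using xa yb by simp
    ultimately show "x \<oplus>\<^bsub>S\<^esub> y \<in> ?M" by (intro CollectI conjI exI[of _ ?c])
  next
    have "S.psum (ge g) (\<lambda>_. \<zero>\<^bsub>S\<^esub>) m = \<zero>\<^bsub>S\<^esub>"
      unfolding S.psum_def using g by (intro S.add.finprod_one_eqI) simp
    then have zero: "x \<ominus>\<^bsub>S\<^esub> S.psum (ge g) (\<lambda>_. \<zero>\<^bsub>S\<^esub>) m \<in> ker V" if "x \<in> ker V" for x
      using that by (simp add: ker_def a_minus_def)
    show "ker V \<subseteq> ?M"
    proof
      fix x assume x: "x \<in> ker V"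
      have "x \<in> carrier S" using x by (simp add: ker_def)
      then show "x \<in> ?M" using zero[OF x] sub(2) by (intro CollectI conjI exI[of _ "\<lambda>_. \<zero>\<^bsub>S\<^esub>"] allI)
    qed
  next
    fix h assume h: "h \<in> carrier G"
    then obtain j n where j: "j < m" "n \<in> N" "V #> h = V #> (g [^] j \<otimes> n)" using cover[OF h] by blast
    let ?a = "\<lambda>i. if i = j then ge n else \<zero>\<^bsub>S\<^esub>"
    have aR: "?a i \<in> supported" for i using ge_supported[OF j(2)] sub(2) by simp
    have "S.psum (ge g) ?a k = (if j < k then ge (g [^] j \<otimes> n) else \<zero>\<^bsub>S\<^esub>)" for k
    proof (induction k)
      case (Suc k)
      have "S.psum (ge g) ?a (Suc k) = S.psum (ge g) ?a k \<oplus>\<^bsub>S\<^esub> ge (g [^] k) \<otimes>\<^bsub>S\<^esub> ?a k"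
        using S.psum_Suc[of "ge g" ?a k, OF ge_closed[OF g] supported_carrier[OF aR]] ge_pow[OF g] by simp
      moreover have "ge (g [^] j) \<otimes>\<^bsub>S\<^esub> ge n = ge (g [^] j \<otimes> n)" using g N_carrier[OF j(2)] by (intro ge_mult) auto
      moreover have "ge (g [^] k) \<in> carrier S" "ge (g [^] j \<otimes> n) \<in> carrier S" using g N_carrier[OF j(2)] by auto
      ultimately show ?case using Suc by (cases "k = j") auto
    qed simp
    then have "S.psum (ge g) ?a m = ge (g [^] j \<otimes> n)" using j(1) by simp
    moreover have "ge h \<ominus>\<^bsub>S\<^esub> ge (g [^] j \<otimes> n) \<in> ker V"
      using ge_component_eq[OF h _ V j(3)] g N_carrier[OF j(2)] by simp
    ultimately show "ge h \<in> ?M"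
      using aR ge_closed[OF h] by (intro CollectI conjI exI[of _ ?a] allI) (simp_all only:)
  qed
  then show "\<exists>a. (\<forall>i. a i \<in> supported) \<and> x \<ominus>\<^bsub>S\<^esub> S.psum (ge g) a m \<in> ker V" by blast
next
  fix b i assume b: "(\<forall>i. b i \<in> supported) \<and> S.psum (ge g) b m \<in> ker V" and i: "i < m"
  then have bs: "b j \<in> supported" for j by blast
  have bS: "b j \<in> carrier S" for j using supported_carrier[OF bs] .
  have "b i V C = 0" if C: "C \<in> carrier (G Mod V)" for C
  proof (rule ccontr)
    assume nz: "b i V C \<noteq> 0"
    obtain c where c: "c \<in> carrier G" "C = V #> c" using coset_cases[OF C] .
    obtain n where n: "n \<in> N" "C = V #> n" using supportedD[OF bs V c(1)] nz c(2) by auto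
    let ?x = "g [^] i \<otimes> n"
    have xG: "?x \<in> carrier G" using g N_carrier[OF n(1)] by simp
    \<comment> \<open>A nonzero contribution of another index \<open>j\<close> would, by the support
      condition, place the same coset of \<open>V\<close> among those represented by
      \<open>g [^] j\<close> times an element of \<open>N\<close>.\<close>
    have summ: "(ge g [^]\<^bsub>S\<^esub> j \<otimes>\<^bsub>S\<^esub> b j) V (V #> ?x) = (if j = i then b i V C else 0)" if j: "j < m" for j
    proof -
      let ?y = "inv (g [^] j) \<otimes> ?x"
      have yG: "?y \<in> carrier G" using g xG by simp
      have eq: "(ge g [^]\<^bsub>S\<^esub> j \<otimes>\<^bsub>S\<^esub> b j) V (V #> ?x) = b j V (V #> ?y)"
        unfolding ge_pow[OF g] using g xG bS V by (intro ge_mult_left) auto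
      show ?thesis
      proof (cases "j = i")
        case True
        have "?y = n" unfolding True using g N_carrier[OF n(1)] by (simp flip: m_assoc)
        then show ?thesis using eq True n(2) by simp
      next
        case False
        have "b j V (V #> ?y) = 0"
        proof (rule ccontr)
          assume "b j V (V #> ?y) \<noteq> 0"
          then obtain n' where n': "n' \<in> N" "V #> ?y = V #> n'" using supportedD[OF bs V yG] by blast
          then have "V #> ?x = V #> (g [^] j \<otimes> n')"
            using coset_cancel[OF V _ xG N_carrier[OF n'(1)], of "g [^] j"] g by simp
          then show False using indep[OF i j n(1) n'(1)] False by simp
        qed
        then show ?thesis using eq False by simp
      qed
    qed
    have "S.psum (ge g) b m V (V #> ?x) = (\<Sum>j<m. if j = i then b i V C else 0) mod int p"
      using coeff_psum[of "ge g" b V "V #> ?x" m, OF ge_closed[OF g] bS V coset_in[OF xG]] summ by simp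
    also have "\<dots> = b i V C" using i coeff_mod[OF bS V C] by simp
    finally have "S.psum (ge g) b m V (V #> ?x) \<noteq> 0" using nz by simp
    moreover have "S.psum (ge g) b m \<in> carrier S" by (rule S.psum_closed[OF ge_closed[OF g] bS])
    ultimately show False using b in_ker_iff[OF V] coset_in[OF xG] by blast
  qed
  then show "b i \<in> ker V" using in_ker_iff[OF V bS] by blast
qed

end

section \<open>The completed group ring of a normal subgroup\<close>

lemma group_ring_map_cong:
  assumes "\<And>h. h \<in> carrier H \<Longrightarrow> f h = f' h"
  shows "group_ring_map K H H' f = group_ring_map K H H' f'"
proof -
  have "{h \<in> carrier H. f h = h'} = {h \<in> carrier H. f' h = h'}" for h' using assms by auto
  then show ?thesis unfolding group_ring_map_def by simp
qed

lemma (in group_ring_pushforward) push_push: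
  assumes f': "group_ring_pushforward H' H'' f' p" and x: "x \<in> carrier D.A"
  shows "group_ring_map D.Fp H' H'' f' (push x) = group_ring_map D.Fp H H'' (\<lambda>h. f' (f h)) x"
proof -
  interpret P: group_ring_pushforward H' H'' f' p by (rule f')
  have "(\<lambda>h. f' (f h)) \<in> hom H H''"
    by (rule homI) auto
  then interpret C: group_ring_pushforward H H'' "\<lambda>h. f' (f h)" p
    by (intro group_ring_pushforward.intro group_hom.intro group_hom_axioms.intro) unfold_locales
  show ?thesis
  proof (rule P.E.A_eqI[OF P.push_closed[OF push_closed[OF x]] C.push_closed[OF x]])
    fix k assume k: "k \<in> carrier H''"
    let ?T = "{h' \<in> carrier H'. f' h' = k}" and ?S = "{h \<in> carrier H. f' (f h) = k}"
    have "P.push (push x) k = (\<Sum>h'\<in>?T. (\<Sum>h\<in>{h \<in> carrier H. f h = h'}. x h) mod int p) mod int p"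
      using k by (simp add: P.push_eq[OF push_closed[OF x]] push_eq[OF x])
    also have "\<dots> = (\<Sum>h'\<in>?T. \<Sum>h\<in>{h \<in> carrier H. f h = h'}. x h) mod int p"
      by (rule mod_sum_eq)
    also have "(\<Sum>h'\<in>?T. \<Sum>h\<in>{h \<in> carrier H. f h = h'}. x h) = (\<Sum>h'\<in>?T. \<Sum>h\<in>{h \<in> ?S. f h = h'}. x h)"
      by (intro sum.cong refl) auto
    also have "\<dots> = (\<Sum>h\<in>?S. x h)"
      by (rule sum.group) auto
    also have "\<dots> mod int p = C.push x k" using k by (simp add: C.push_eq[OF x])
    finally show "P.push (push x) k = C.push x k" .
  qed
qed

context pro_p_group_ring
begin

lemma proj_trans:
  assumes U: "U \<in> \<U>" "V \<in> \<U>" "W \<in> \<U>" "U \<subseteq> V" "V \<subseteq> W" and x: "x \<in> carrier (A U)"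
  shows "proj V W (proj U V x) = proj U W x"
proof -
  have "proj V W (proj U V x) = group_ring_map Fp (G Mod U) (G Mod W) (\<lambda>C. W <#> (V <#> C)) x"
    by (rule group_ring_pushforward.push_push[OF pushforward[OF U(1,2,4)] pushforward[OF U(2,3,5)] x])
  also have "\<dots> = proj U W x"
  proof (rule fun_cong[OF group_ring_map_cong])
    fix C assume "C \<in> carrier (G Mod U)"
    then obtain c where "c \<in> carrier G" "C = U #> c" by (rule coset_cases)
    then show "W <#> (V <#> C) = W <#> C" using U by (simp add: coset_coarsen')
  qed
  finally show ?thesis .
qed

lemma proj_refl:
  assumes U: "U \<in> \<U>" and x: "x \<in> carrier (A U)" shows "proj U U x = x"
proof -
  interpret P: group_ring_pushforward "G Mod U" "G Mod U" "\<lambda>C. U <#> C" p using pushforward[OF U U order_refl] .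
  show ?thesis
  proof (rule P.D.A_eqI[OF P.push_closed[OF x] x])
    fix C assume C: "C \<in> carrier (G Mod U)"
    have "U <#> D = D" if "D \<in> carrier (G Mod U)" for D
      using coset_cases[OF that] coset_coarsen'[OF U U order_refl] by metis
    then have "{D \<in> carrier (G Mod U). U <#> D = C} = {C}" using C by auto
    then show "proj U U x C = x C" using C P.D.coeff_range[OF x C] by (simp add: P.push_eq[OF x])
  qed
qed

section \<open>Topology of the pro-p group\<close>

lemma topological_group_T: "topological_group G T"
  using pro_p by (simp add: pro_p_group_def profinite_group_def)

lemma compact_T: "compact_space T"
  using pro_p by (simp add: pro_p_group_def profinite_group_def)

lemma mult_continuous: "continuous_map X T f \<Longrightarrow> continuous_map X T f' \<Longrightarrow> continuous_map X T (\<lambda>x. f x \<otimes> f' x)"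
proof -
  assume f: "continuous_map X T f" "continuous_map X T f'"
  have "continuous_map (prod_topology T T) T (\<lambda>(x, y). x \<otimes> y)"
    using topological_group_T by (simp add: topological_group_def)
  from continuous_map_compose[OF continuous_map_pairedI[OF f] this]
  show "continuous_map X T (\<lambda>x. f x \<otimes> f' x)" by (simp add: o_def)
qed

lemma inv_continuous: "continuous_map X T f \<Longrightarrow> continuous_map X T (\<lambda>x. inv (f x))"
proof -
  assume f: "continuous_map X T f"
  have "continuous_map T T (\<lambda>x. inv x)"
    using topological_group_T by (simp add: topological_group_def)
  from continuous_map_compose[OF f this] show "continuous_map X T (\<lambda>x. inv (f x))" by (simp add: o_def)
qed

lemma const_continuous: "c \<in> carrier G \<Longrightarrow> continuous_map X T (\<lambda>x. c)"
  by (simp add: topspace_T)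

lemma open_coset:
  assumes V: "openin T V" and c: "c \<in> carrier G" shows "openin T (V #> c)"
proof -
  have VG: "V \<subseteq> carrier G" using openin_subset[OF V] topspace_T by simp
  have "continuous_map T T (\<lambda>x. x \<otimes> inv c)"
    using c by (intro mult_continuous const_continuous) auto
  then have "openin T {x \<in> topspace T. x \<otimes> inv c \<in> V}" using V openin_continuous_map_preimage by blast
  moreover have "{x \<in> topspace T. x \<otimes> inv c \<in> V} = V #> c"
  proof
    show "{x \<in> topspace T. x \<otimes> inv c \<in> V} \<subseteq> V #> c"
    proof
      fix x assume "x \<in> {x \<in> topspace T. x \<otimes> inv c \<in> V}"
      then have x: "x \<in> carrier G" "x \<otimes> inv c \<in> V" by (auto simp: topspace_T)
      have "x = (x \<otimes> inv c) \<otimes> c" using x c by (simp add: m_assoc)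
      then show "x \<in> V #> c" using x(2) unfolding r_coset_def by blast
    qed
    show "V #> c \<subseteq> {x \<in> topspace T. x \<otimes> inv c \<in> V}"
      using VG c by (auto simp: r_coset_def topspace_T m_assoc)
  qed
  ultimately show ?thesis by simp
qed

text \<open>The subgroup is the union of the open translates \<open>O' #> h\<close> with
  \<open>h\<close> in \<open>H\<close>.\<close>

lemma open_subgroupI:
  assumes H: "subgroup H G" and O': "openin T O'" "\<one> \<in> O'" "O' \<subseteq> H" shows "openin T H"
proof (subst openin_subopen, intro ballI)
  fix h assume h: "h \<in> H"
  have hG: "h \<in> carrier G" using subgroup.mem_carrier[OF H h] .
  have "h \<in> O' #> h" unfolding r_coset_def using O'(2) hG by force
  moreover have "O' #> h \<subseteq> H" using O'(3) h subgroup.m_closed[OF H] by (auto simp: r_coset_def)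
  ultimately show "\<exists>T'. openin T T' \<and> h \<in> T' \<and> T' \<subseteq> H" using open_coset[OF O'(1) hG] by blast
qed

text \<open>The tube lemma for conjugation makes the normal core of an open subgroup open.\<close>

lemma \<U>_basis:
  assumes V: "openin T V" "\<one> \<in> V" shows "\<exists>U\<in>\<U>. U \<subseteq> V"
proof -
  obtain H where H: "subgroup H G" "openin T H" "H \<subseteq> V"
    using pro_p V unfolding pro_p_group_def profinite_group_def by blast
  let ?conj = "\<lambda>z. fst z \<otimes> snd z \<otimes> inv (fst z)"
  let ?W = "{z \<in> topspace (prod_topology T T). ?conj z \<in> H}"
  have "continuous_map (prod_topology T T) T ?conj"
    by (intro mult_continuous inv_continuous continuous_map_fst continuous_map_snd)
  then have "openin (prod_topology T T) ?W" using H(2) openin_continuous_map_preimage by blast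
  moreover have "topspace T \<times> {\<one>} \<subseteq> ?W" using subgroup.one_closed[OF H(1)] by (auto simp: topspace_T)
  \<comment> \<open>As \<open>B\<close> contains the whole group, all conjugates of elements of the
    neighbourhood \<open>C\<close> of one lie in \<open>H\<close>.\<close>
  ultimately obtain B C where BC: "openin T C" "topspace T \<subseteq> B" "\<one> \<in> C" "B \<times> C \<subseteq> ?W"
    using tube_lemma_left[of T T ?W "topspace T" \<one>] compact_T by (auto simp: compact_space_def topspace_T)
  \<comment> \<open>The normal core of \<open>H\<close>; it contains \<open>C\<close> and is
    therefore open.\<close>
  define K where "K = {x \<in> carrier G. \<forall>y\<in>carrier G. y \<otimes> x \<otimes> inv y \<in> H}"
  have K: "subgroup K G"
  proof (rule subgroupI)
    show "K \<noteq> {}" using subgroup.one_closed[OF H(1)] by (auto simp: K_def intro!: exI[of _ \<one>])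
    fix x assume x: "x \<in> K"
    have "y \<otimes> inv x \<otimes> inv y = inv (y \<otimes> x \<otimes> inv y)" if "y \<in> carrier G" for y
      using that x by (simp add: K_def inv_mult_group m_assoc)
    then show "inv x \<in> K" using x subgroup.m_inv_closed[OF H(1)] by (simp add: K_def)
    fix x' assume x': "x' \<in> K"
    have "y \<otimes> (x \<otimes> x') \<otimes> inv y = (y \<otimes> x \<otimes> inv y) \<otimes> (y \<otimes> x' \<otimes> inv y)" if y: "y \<in> carrier G" for y
    proof -
      have "(y \<otimes> x \<otimes> inv y) \<otimes> (y \<otimes> x' \<otimes> inv y) = y \<otimes> x \<otimes> (inv y \<otimes> y) \<otimes> x' \<otimes> inv y"
        using y x x' by (simp only: K_def mem_Collect_eq m_assoc m_closed inv_closed)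
      then show ?thesis using y x x' by (simp add: K_def m_assoc)
    qed
    then show "x \<otimes> x' \<in> K" using x x' subgroup.m_closed[OF H(1)] by (simp add: K_def)
  qed (auto simp: K_def)
  have "C \<subseteq> K"
  proof
    fix x assume x: "x \<in> C"
    then have xG: "x \<in> carrier G" using openin_subset[OF BC(1)] topspace_T by blast
    have "y \<otimes> x \<otimes> inv y \<in> H" if "y \<in> carrier G" for y
    proof -
      have "(y, x) \<in> B \<times> C" using BC(2) x that topspace_T by blast
      then have "(y, x) \<in> ?W" by (rule subsetD[OF BC(4)])
      then show ?thesis by simp
    qed
    then show "x \<in> K" using xG by (simp add: K_def)
  qed
  then have "openin T K" using open_subgroupI[OF K BC(1,3)] by blast
  moreover have "K \<lhd> G"
    unfolding normal_inv_iff
  proof (intro conjI K ballI)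
    fix z x assume z: "z \<in> carrier G" and x: "x \<in> K"
    have "y \<otimes> (z \<otimes> x \<otimes> inv z) \<otimes> inv y = (y \<otimes> z) \<otimes> x \<otimes> inv (y \<otimes> z)" if "y \<in> carrier G" for y
      using that z x by (simp add: K_def inv_mult_group m_assoc)
    then show "z \<otimes> x \<otimes> inv z \<in> K" using z x by (simp add: K_def)
  qed
  moreover have "K \<subseteq> H"
  proof
    fix x assume "x \<in> K"
    then have "x \<in> carrier G" "\<one> \<otimes> x \<otimes> inv \<one> \<in> H" unfolding K_def by blast+
    then show "x \<in> H" by simp
  qed
  ultimately have "K \<in> \<U> \<and> K \<subseteq> V" using H(3) by (auto simp: open_normal_subgroups_def)
  then show ?thesis by blast
qed

end

locale pro_p_group_ring_sub = pro_p_group_ring_normal +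
  assumes pro_p_N: "pro_p_group p (G\<lparr>carrier := N\<rparr>) (subtopology T N)"
begin

section \<open>Open subgroups of \<open>N\<close> cut out by those of the whole group\<close>

abbreviation GN where "GN \<equiv> G\<lparr>carrier := N\<rparr>"

sublocale NN: pro_p_group_ring GN p "subtopology T N"
  using subgroup.subgroup_is_group[OF N_subgroup is_group] prime_p pro_p_N
  by (intro pro_p_group_ring.intro pro_p_group_ring_axioms.intro)

lemma GN_coset: "W #>\<^bsub>GN\<^esub> n = W #> n"
  by (simp add: r_coset_def)

lemma inter_N: assumes "U \<in> \<U>" shows "N \<inter> U \<in> NN.\<U>"
proof -
  have "U \<inter> N \<lhd> GN" using normal_Int_subgroup[OF N_subgroup \<U>_normal[OF assms]] .
  moreover have "openin (subtopology T N) (U \<inter> N)" using \<U>_open[OF assms] by (auto simp: openin_subtopology)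
  ultimately show ?thesis by (simp add: open_normal_subgroups_def Int_commute)
qed

text \<open>Since \<open>N\<close> has the subspace topology, the traces of open normal subgroups of
  the whole group are cofinal in \<open>NN.\<U>\<close>. This lets an element of the inverse limit
  for \<open>N\<close> be recovered from its components at the traces.\<close>

lemma inter_N_refines: assumes W: "W \<in> NN.\<U>" shows "\<exists>U\<in>\<U>. N \<inter> U \<subseteq> W"
proof -
  obtain O' where O': "openin T O'" "W = O' \<inter> N" using NN.\<U>_open[OF W] by (auto simp: openin_subtopology)
  have "\<one> \<in> W" using subgroup.one_closed[OF NN.\<U>_subgroup[OF W]] by simp
  then obtain U where "U \<in> \<U>" "U \<subseteq> O'" using \<U>_basis[OF O'(1)] O'(2) by blast
  then show ?thesis using O'(2) by blast
qed

lemma inter_N_subgroup: "U \<in> \<U> \<Longrightarrow> subgroup (N \<inter> U) G"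
  using subgroups_Inter_pair N_subgroup \<U>_subgroup by blast

lemma inter_N_coarsen: "U \<in> \<U> \<Longrightarrow> n \<in> N \<Longrightarrow> U <#> ((N \<inter> U) #> n) = U #> n"
  using coset_coarsen inter_N_subgroup \<U>_subgroup N_carrier by simp

lemma inter_N_coset_eq_iff:
  assumes "U \<in> \<U>" "n \<in> N" "n' \<in> N" shows "(N \<inter> U) #> n = (N \<inter> U) #> n' \<longleftrightarrow> U #> n = U #> n'"
  using assms r_coset_eq_iff[OF inter_N_subgroup] r_coset_eq_iff[OF \<U>_subgroup] N_carrier
    subgroup.m_closed[OF N_subgroup] subgroup.m_inv_closed[OF N_subgroup] by simp

lemma N_coset_cases:
  assumes "D \<in> carrier (GN Mod W)" obtains n where "n \<in> N" "D = W #> n"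
  using NN.coset_cases[OF assms] by (auto simp: GN_coset)

lemma N_coset_in: "n \<in> N \<Longrightarrow> W #> n \<in> carrier (GN Mod W)"
  using NN.coset_in[of n W] by (simp add: GN_coset)

lemma pushforward_N:
  assumes U: "U \<in> \<U>"
  shows "group_ring_pushforward (GN Mod (N \<inter> U)) (G Mod U) (\<lambda>D. U <#> D) p"
proof -
  have "(\<lambda>D. U <#> D) \<in> hom (GN Mod (N \<inter> U)) (G Mod U)"
  proof (rule homI)
    show "U <#> D \<in> carrier (G Mod U)" if "D \<in> carrier (GN Mod (N \<inter> U))" for D
      using that U by (elim N_coset_cases) (simp add: inter_N_coarsen coset_in N_carrier)
    fix D E assume DE: "D \<in> carrier (GN Mod (N \<inter> U))" "E \<in> carrier (GN Mod (N \<inter> U))"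
    obtain n where n: "n \<in> N" "D = (N \<inter> U) #> n" using N_coset_cases[OF DE(1)] .
    obtain m where m: "m \<in> N" "E = (N \<inter> U) #> m" using N_coset_cases[OF DE(2)] .
    have "D \<otimes>\<^bsub>GN Mod (N \<inter> U)\<^esub> E = (N \<inter> U) #> (n \<otimes> m)"
      using NN.coset_mult[OF inter_N[OF U], of n m] n m by (simp add: GN_coset)
    then show "U <#> (D \<otimes>\<^bsub>GN Mod (N \<inter> U)\<^esub> E) = (U <#> D) \<otimes>\<^bsub>G Mod U\<^esub> (U <#> E)"
      using n m U subgroup.m_closed[OF N_subgroup] by (simp add: inter_N_coarsen coset_mult N_carrier)
  qed
  then show ?thesis
    by (intro group_ring_pushforward.intro group_hom.intro group_hom_axioms.intro
        finite_group_ring_quotient NN.finite_group_ring_quotient inter_N U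
        normal.factorgroup_is_group[OF \<U>_normal] normal.factorgroup_is_group[OF NN.\<U>_normal])
qed

section \<open>The image of the completed group ring of \<open>N\<close>\<close>

abbreviation emb where "emb \<equiv> completed_group_ring_embedding Fp G T N"

lemma emb_component:
  "U \<in> \<U> \<Longrightarrow> emb x U = group_ring_map Fp (GN Mod (N \<inter> U)) (G Mod U) (\<lambda>D. U <#> D) (x (N \<inter> U))"
  by (simp add: completed_group_ring_embedding_def)

lemma emb_extensional: "emb x \<in> extensional \<U>"
  by (simp add: completed_group_ring_embedding_def)

text \<open>The map from cosets of \<open>N \<inter> U\<close> in \<open>N\<close> to cosets of
  \<open>U\<close> is injective, so the fibre sum has a single term.\<close>

lemma emb_coeff:
  assumes x: "x \<in> carrier NN.S" and U: "U \<in> \<U>" and n: "n \<in> N"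
  shows "emb x U (U #> n) = x (N \<inter> U) ((N \<inter> U) #> n)"
proof -
  interpret P: group_ring_pushforward "GN Mod (N \<inter> U)" "G Mod U" "\<lambda>D. U <#> D" p using pushforward_N[OF U] .
  have xU: "x (N \<inter> U) \<in> carrier P.D.A" using NN.S_component[OF x inter_N[OF U]] .
  have "D = (N \<inter> U) #> n" if D: "D \<in> carrier (GN Mod (N \<inter> U))" "U <#> D = U #> n" for D
  proof -
    obtain m where m: "m \<in> N" "D = (N \<inter> U) #> m" using N_coset_cases[OF D(1)] .
    then show ?thesis using D(2) inter_N_coarsen[OF U m(1)] inter_N_coset_eq_iff[OF U m(1) n] by simp
  qed
  then have "{D \<in> carrier (GN Mod (N \<inter> U)). U <#> D = U #> n} = {(N \<inter> U) #> n}"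
    using inter_N_coarsen[OF U n] N_coset_in[OF n] by blast
  then have "emb x U (U #> n) = (\<Sum>D\<in>{(N \<inter> U) #> n}. x (N \<inter> U) D) mod int p"
    using P.push_eq[OF xU coset_in[OF N_carrier[OF n]]] by (simp only: emb_component[OF U])
  then show ?thesis using P.D.coeff_range[OF xU N_coset_in[OF n]] by simp
qed

lemma emb_coeff_zero:
  assumes x: "x \<in> carrier NN.S" and U: "U \<in> \<U>" and c: "c \<in> carrier G" "\<not> (\<exists>n\<in>N. U #> c = U #> n)"
  shows "emb x U (U #> c) = 0"
proof -
  interpret P: group_ring_pushforward "GN Mod (N \<inter> U)" "G Mod U" "\<lambda>D. U <#> D" p using pushforward_N[OF U] .
  have xU: "x (N \<inter> U) \<in> carrier P.D.A" using NN.S_component[OF x inter_N[OF U]] .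
  have "U <#> D \<noteq> U #> c" if D: "D \<in> carrier (GN Mod (N \<inter> U))" for D
    using N_coset_cases[OF D] inter_N_coarsen[OF U] c(2) by metis
  then have "{D \<in> carrier (GN Mod (N \<inter> U)). U <#> D = U #> c} = {}" by blast
  then show ?thesis
    using P.push_eq[OF xU coset_in[OF c(1)]] by (simp only: emb_component[OF U] sum.empty mod_0)
qed

lemma emb_closed: assumes x: "x \<in> carrier NN.S" shows "emb x \<in> carrier S"
proof (rule S_memI[OF emb_extensional])
  show "emb x U \<in> carrier (A U)" if U: "U \<in> \<U>" for U
    unfolding emb_component[OF U]
    by (rule group_ring_pushforward.push_closed[OF pushforward_N[OF U] NN.S_component[OF x inter_N[OF U]]])
  fix U V assume U: "U \<in> \<U>" "V \<in> \<U>" "U \<subseteq> V"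
  have xU: "x (N \<inter> U) \<in> carrier (NN.A (N \<inter> U))" using NN.S_component[OF x inter_N[OF U(1)]] .
  have sub: "N \<inter> U \<subseteq> N \<inter> V" using U by blast
  have "proj U V (emb x U) = group_ring_map Fp (GN Mod (N \<inter> U)) (G Mod V) (\<lambda>D. V <#> (U <#> D)) (x (N \<inter> U))"
    unfolding emb_component[OF U(1)]
    by (rule group_ring_pushforward.push_push[OF pushforward_N[OF U(1)] pushforward[OF U] xU])
  also have "\<dots> = group_ring_map Fp (GN Mod (N \<inter> U)) (G Mod V) (\<lambda>D. V <#> ((N \<inter> V) <#>\<^bsub>GN\<^esub> D)) (x (N \<inter> U))"
  proof (rule fun_cong[OF group_ring_map_cong])
    fix D assume "D \<in> carrier (GN Mod (N \<inter> U))"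
    then obtain n where n: "n \<in> N" "D = (N \<inter> U) #> n" by (rule N_coset_cases)
    have "(N \<inter> V) <#>\<^bsub>GN\<^esub> D = (N \<inter> V) #> n"
      using NN.coset_coarsen'[OF inter_N[OF U(1)] inter_N[OF U(2)] sub, of n] n by (simp add: GN_coset)
    then show "V <#> (U <#> D) = V <#> ((N \<inter> V) <#>\<^bsub>GN\<^esub> D)"
      using n U by (simp add: inter_N_coarsen coset_coarsen' N_carrier)
  qed
  also have "\<dots> = group_ring_map Fp (GN Mod (N \<inter> V)) (G Mod V) (\<lambda>D. V <#> D) (NN.proj (N \<inter> U) (N \<inter> V) (x (N \<inter> U)))"
    by (rule group_ring_pushforward.push_push[OF NN.pushforward[OF inter_N[OF U(1)] inter_N[OF U(2)] sub] pushforward_N[OF U(2)] xU, symmetric])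
  also have "\<dots> = emb x V"
    unfolding emb_component[OF U(2)] using NN.S_compat[OF x inter_N[OF U(1)] inter_N[OF U(2)] sub] by simp
  finally show "emb x V = proj U V (emb x U)" by simp
qed

lemma emb_supported: "x \<in> carrier NN.S \<Longrightarrow> emb x \<in> supported"
  using emb_closed emb_coeff_zero by (intro supportedI) blast+

text \<open>The candidate for the component at \<open>N \<inter> U\<close> of a preimage of
  \<open>y\<close>. It is indexed by \<open>U\<close> because different \<open>U\<close> may have
  the same trace on \<open>N\<close>.\<close>

definition restr :: "('a set \<Rightarrow> 'a set \<Rightarrow> int) \<Rightarrow> 'a set \<Rightarrow> 'a set \<Rightarrow> int" where
  "restr y U = (\<lambda>D\<in>carrier (GN Mod (N \<inter> U)). y U (U <#> D))"

lemma restr_coeff: "U \<in> \<U> \<Longrightarrow> n \<in> N \<Longrightarrow> restr y U ((N \<inter> U) #> n) = y U (U #> n)"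
  by (simp add: restr_def N_coset_in inter_N_coarsen)

lemma restr_closed: assumes y: "y \<in> carrier S" and U: "U \<in> \<U>" shows "restr y U \<in> carrier (NN.A (N \<inter> U))"
proof -
  have "restr y U D \<in> {0..int p - 1}" if D: "D \<in> carrier (GN Mod (N \<inter> U))" for D
  proof -
    obtain n where n: "n \<in> N" "D = (N \<inter> U) #> n" using N_coset_cases[OF D] .
    then show ?thesis using restr_coeff[OF U n(1)] coeff_range[OF y U coset_in[OF N_carrier[OF n(1)]]] by simp
  qed
  then show ?thesis
    unfolding finite_group_ring.carrier_A[OF NN.finite_group_ring_quotient[OF inter_N[OF U]]]
    by (auto simp: restr_def)
qed

text \<open>The cosets of \<open>U\<close> inside a coset of \<open>V\<close> that miss \<open>N\<close> do not contribute.\<close>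

lemma restr_compat:
  assumes y: "y \<in> supported" and U: "U \<in> \<U>" "V \<in> \<U>" "U \<subseteq> V"
  shows "NN.proj (N \<inter> U) (N \<inter> V) (restr y U) = restr y V"
proof -
  have yS: "y \<in> carrier S" using supported_carrier[OF y] .
  have sub: "N \<inter> U \<subseteq> N \<inter> V" using U by blast
  note rU = restr_closed[OF yS U(1)]
  interpret P: group_ring_pushforward "GN Mod (N \<inter> U)" "GN Mod (N \<inter> V)" "\<lambda>C. (N \<inter> V) <#>\<^bsub>GN\<^esub> C" p
    using NN.pushforward[OF inter_N[OF U(1)] inter_N[OF U(2)] sub] .
  interpret Q: group_ring_pushforward "G Mod U" "G Mod V" "\<lambda>C. V <#> C" p using pushforward[OF U] .
  show ?thesis
  proof (rule P.E.A_eqI[OF P.push_closed[OF rU] restr_closed[OF yS U(2)]])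
    fix D assume D: "D \<in> carrier (GN Mod (N \<inter> V))"
    then obtain n where n: "n \<in> N" "D = (N \<inter> V) #> n" by (rule N_coset_cases)
    have co: "(N \<inter> V) <#>\<^bsub>GN\<^esub> ((N \<inter> U) #> m) = (N \<inter> V) #> m" if "m \<in> N" for m
      using NN.coset_coarsen'[OF inter_N[OF U(1)] inter_N[OF U(2)] sub, of m] that by (simp add: GN_coset)
    let ?X = "{E \<in> carrier (GN Mod (N \<inter> U)). (N \<inter> V) <#>\<^bsub>GN\<^esub> E = D}"
    let ?Y = "{C \<in> carrier (G Mod U). V <#> C = V #> n}"
    have inj: "inj_on (\<lambda>E. U <#> E) ?X"
    proof (rule inj_onI)
      fix E E' assume "E \<in> ?X" "E' \<in> ?X" and eq: "U <#> E = U <#> E'"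
      then obtain m m' where m: "m \<in> N" "E = (N \<inter> U) #> m" "m' \<in> N" "E' = (N \<inter> U) #> m'"
        by (auto elim!: N_coset_cases)
      then show "E = E'" using eq U(1) by (simp add: inter_N_coarsen inter_N_coset_eq_iff)
    qed
    have img: "(\<lambda>E. U <#> E) ` ?X \<subseteq> ?Y"
    proof
      fix C assume "C \<in> (\<lambda>E. U <#> E) ` ?X"
      then obtain m where m: "m \<in> N" "C = U <#> ((N \<inter> U) #> m)" "(N \<inter> V) <#>\<^bsub>GN\<^esub> ((N \<inter> U) #> m) = D"
        by (auto elim!: N_coset_cases)
      then have "V #> m = V #> n" using co n inter_N_coset_eq_iff[OF U(2)] by simp
      then show "C \<in> ?Y" using m(1,2) U by (simp add: inter_N_coarsen coset_coarsen' N_carrier coset_in)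
    qed
    have zero: "y U C = 0" if C: "C \<in> ?Y - (\<lambda>E. U <#> E) ` ?X" for C
    proof (rule ccontr)
      assume nz: "y U C \<noteq> 0"
      obtain c where c: "c \<in> carrier G" "C = U #> c" using C coset_cases by blast
      then obtain m where m: "m \<in> N" "C = U #> m" using supportedD[OF y U(1) c(1)] nz by auto
      have "V #> m = V #> n" using C m U by (simp add: coset_coarsen' N_carrier)
      then have "(N \<inter> U) #> m \<in> ?X" using co[OF m(1)] n m(1) inter_N_coset_eq_iff[OF U(2)] by (simp add: N_coset_in)
      moreover have "C = U <#> ((N \<inter> U) #> m)" using inter_N_coarsen[OF U(1) m(1)] m(2) by simp
      ultimately show False using C by blast
    qed
    have "(\<Sum>E\<in>?X. restr y U E) = (\<Sum>E\<in>?X. y U (U <#> E))" by (intro sum.cong) (auto simp: restr_def)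
    also have "\<dots> = (\<Sum>C\<in>(\<lambda>E. U <#> E) ` ?X. y U C)" using sum.reindex[OF inj, of "y U"] by simp
    also have "\<dots> = (\<Sum>C\<in>?Y. y U C)"
      using finite_cosets[OF U(1)] zero by (intro sum.mono_neutral_left img) auto
    finally have "(\<Sum>E\<in>?X. restr y U E) mod int p = y V (V #> n)"
      using Q.push_eq[OF S_component[OF yS U(1)] coset_in[OF N_carrier[OF n(1)]]] S_compat[OF yS U] by simp
    then show "NN.proj (N \<inter> U) (N \<inter> V) (restr y U) D = restr y V D"
      using P.push_eq[OF rU D] restr_coeff[OF U(2) n(1)] n(2) by simp
  qed
qed

text \<open>A preimage needs components at all open normal subgroups \<open>W\<close> of
  \<open>N\<close>, not just at traces. They are obtained by projecting from some trace inside
  \<open>W\<close>; by \<open>restr_compat\<close> the result does not depend on the trace.\<close>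

lemma supported_in_emb: assumes y: "y \<in> supported" shows "y \<in> emb ` carrier NN.S"
proof -
  have yS: "y \<in> carrier S" using supported_carrier[OF y] .
  have "\<forall>W\<in>NN.\<U>. \<exists>U. U \<in> \<U> \<and> N \<inter> U \<subseteq> W" using inter_N_refines by blast
  then obtain u where u: "\<And>W. W \<in> NN.\<U> \<Longrightarrow> u W \<in> \<U>" "\<And>W. W \<in> NN.\<U> \<Longrightarrow> N \<inter> u W \<subseteq> W" by metis
  define z where "z = (\<lambda>W\<in>NN.\<U>. NN.proj (N \<inter> u W) W (restr y (u W)))"
  have indep: "z W = NN.proj (N \<inter> U) W (restr y U)" if W: "W \<in> NN.\<U>" and U: "U \<in> \<U>" "N \<inter> U \<subseteq> W" for U W
  proof -
    \<comment> \<open>Two choices of the subgroup are compared through their intersection.\<close>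
    let ?V = "U \<inter> u W"
    have V: "?V \<in> \<U>" using inter_in_\<U>[OF U(1) u(1)[OF W]] .
    have *: "NN.proj (N \<inter> ?V) W (restr y ?V) = NN.proj (N \<inter> U') W (restr y U')"
      if U': "U' \<in> \<U>" "N \<inter> U' \<subseteq> W" "?V \<subseteq> U'" for U'
    proof -
      have "N \<inter> ?V \<subseteq> N \<inter> U'" using U'(3) by blast
      then show ?thesis
        using NN.proj_trans[OF inter_N[OF V] inter_N[OF U'(1)] W _ U'(2) restr_closed[OF yS V]]
          restr_compat[OF y V U'(1,3)] by simp
    qed
    show ?thesis using *[OF U] *[OF u(1)[OF W] u(2)[OF W]] W by (simp add: z_def)
  qed
  have zS: "z \<in> carrier NN.S"
  proof (rule NN.S_memI)
    show "z \<in> extensional NN.\<U>" by (simp add: z_def)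
    show "z W \<in> carrier (NN.A W)" if W: "W \<in> NN.\<U>" for W
      using group_ring_pushforward.push_closed[OF NN.pushforward[OF inter_N[OF u(1)[OF W]] W u(2)[OF W]] restr_closed[OF yS u(1)[OF W]]] W
      by (simp add: z_def)
    fix W W' assume W: "W \<in> NN.\<U>" "W' \<in> NN.\<U>" "W \<subseteq> W'"
    have "z W' = NN.proj (N \<inter> u W) W' (restr y (u W))"
      using indep[OF W(2) u(1)[OF W(1)]] u(2)[OF W(1)] W(3) by blast
    also have "\<dots> = NN.proj W W' (NN.proj (N \<inter> u W) W (restr y (u W)))"
      by (rule NN.proj_trans[OF inter_N[OF u(1)[OF W(1)]] W(1,2) u(2)[OF W(1)] W(3) restr_closed[OF yS u(1)[OF W(1)]], symmetric])
    finally show "z W' = NN.proj W W' (z W)" using W(1) by (simp add: z_def)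
  qed
  have zU: "z (N \<inter> U) = restr y U" if U: "U \<in> \<U>" for U
    using indep[OF inter_N[OF U] U order_refl] NN.proj_refl[OF inter_N[OF U] restr_closed[OF yS U]] by simp
  have "emb z = y"
  proof (rule S_eq_coeffI[OF emb_closed[OF zS] yS])
    fix U c assume U: "U \<in> \<U>" and c: "c \<in> carrier G"
    show "emb z U (U #> c) = y U (U #> c)"
    proof (cases "\<exists>n\<in>N. U #> c = U #> n")
      case True
      then obtain n where n: "n \<in> N" "U #> c = U #> n" by blast
      then show ?thesis using emb_coeff[OF zS U n(1)] zU[OF U] restr_coeff[OF U n(1)] by simp
    next
      case False
      then show ?thesis using emb_coeff_zero[OF zS U c] supportedD[OF y U c] by auto
    qed
  qed
  then show ?thesis using zS by blast
qed

lemma completed_subgroup_ring_eq: "completed_subgroup_ring Fp G T N = S\<lparr>carrier := supported\<rparr>"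
proof -
  have "emb ` carrier NN.S = supported" using emb_supported supported_in_emb by blast
  then show ?thesis unfolding completed_subgroup_ring_def by simp
qed

end

section \<open>The quotient by the normal subgroup\<close>

context pro_p_group_ring
begin

lemma coset_pow:
  assumes "U \<in> \<U>" "c \<in> carrier G" shows "(U #> c) [^]\<^bsub>G Mod U\<^esub> (n::nat) = U #> (c [^] n)"
  by (induction n) (use assms in \<open>simp_all add: coset_one coset_mult\<close>)

lemma p_power_in:
  assumes U: "U \<in> \<U>" and c: "c \<in> carrier G" shows "\<exists>e::nat. c [^] (p ^ e) \<in> U"
proof -
  interpret Q: group "G Mod U" using normal.factorgroup_is_group[OF \<U>_normal[OF U]] .
  obtain e where e: "card (carrier (G Mod U)) = p ^ e" using card_cosets[OF U] .
  have "(U #> c) [^]\<^bsub>G Mod U\<^esub> (p ^ e) = \<one>\<^bsub>G Mod U\<^esub>"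
    using Q.pow_order_eq_1[OF coset_in[OF c]] e by (simp add: order_def)
  then have "U #> (c [^] (p ^ e)) = U #> \<one>" using coset_pow[OF U c] coset_one[OF U] by simp
  then show ?thesis using coset_eq_iff[OF U, of "c [^] (p ^ e)" \<one>] c by auto
qed

lemma coset_one_iff: "U \<in> \<U> \<Longrightarrow> c \<in> carrier G \<Longrightarrow> U #> c = U #> \<one> \<longleftrightarrow> c \<in> U"
  using coset_eq_iff[of U c \<one>] by simp

end

context pro_p_group_ring_normal
begin

section \<open>Quotient topology and the density of the powers of \<open>g\<close>\<close>

abbreviation TQ where "TQ \<equiv> quotient_group_topology G T N"

lemma topspace_TQ: "topspace TQ = carrier (G Mod N)"
proof
  show "topspace TQ \<subseteq> carrier (G Mod N)"
    using openin_topspace[of TQ] unfolding openin_quotient_group_topology by blast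
  have "{x \<in> topspace T. N #> x \<in> carrier (G Mod N)} = topspace T"
    using coset_in topspace_T by auto
  then have "openin TQ (carrier (G Mod N))" unfolding openin_quotient_group_topology by simp
  then show "carrier (G Mod N) \<subseteq> topspace TQ" by (rule openin_subset)
qed

lemma coset_N_mult: "c \<in> carrier G \<Longrightarrow> d \<in> carrier G \<Longrightarrow> (N #> c) \<otimes>\<^bsub>G Mod N\<^esub> (N #> d) = N #> (c \<otimes> d)"
  using normal.rcos_sum[OF N_normal] by (simp add: FactGroup_def)

text \<open>The quotient map is open: the preimage of the image is \<open>NVc\<close>, which is a
  union of cosets of \<open>V\<close> because \<open>V\<close> is normal.\<close>

lemma open_image_coset:
  assumes V: "V \<in> \<U>" and c: "c \<in> carrier G" shows "openin TQ {N #> x | x. x \<in> V #> c}"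
  unfolding openin_quotient_group_topology
proof
  have VG: "V #> c \<subseteq> carrier G" using \<U>_subset[OF V] c r_coset_subset_G by blast
  then show "{N #> x | x. x \<in> V #> c} \<subseteq> carrier (G Mod N)" using coset_in by blast
  show "openin T {x \<in> topspace T. N #> x \<in> {N #> x | x. x \<in> V #> c}}" (is "openin T ?O")
  proof (subst openin_subopen, intro ballI)
    fix x assume "x \<in> ?O"
    then obtain y where x: "x \<in> carrier G" and y: "y \<in> V #> c" "N #> x = N #> y" by (auto simp: topspace_T)
    have yG: "y \<in> carrier G" using y VG by blast
    obtain n where n: "n \<in> N" "x = n \<otimes> y"
      using y(2) rcos_self[OF x N_subgroup] unfolding r_coset_def by blast
    have "V #> x \<subseteq> ?O"
    proof
      fix z assume "z \<in> V #> x"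
      then obtain v where v: "v \<in> V" "z = v \<otimes> x" by (auto simp: r_coset_def)
      have vG: "v \<in> carrier G" and nG: "n \<in> carrier G" using v n \<U>_subset[OF V] N_carrier by auto
      \<comment> \<open>Normality of \<open>V\<close> moves \<open>v\<close> past \<open>n\<close>;
        afterwards \<open>n\<close> stands on the left, where the coset of \<open>N\<close> absorbs
        it.\<close>
      let ?v = "inv n \<otimes> v \<otimes> n"
      have v': "?v \<in> V" using normal.inv_op_closed1[OF \<U>_normal[OF V] nG v(1)] .
      have "z = n \<otimes> (?v \<otimes> y)" using v n vG nG yG by (simp add: m_assoc) (simp flip: m_assoc)
      then have "N #> z = N #> (?v \<otimes> y)"
        using n(1) nG vG yG r_coset_eq_iff[OF N_subgroup, of z "?v \<otimes> y"] by (simp add: m_assoc inv_mult_group) (simp flip: m_assoc)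
      moreover have "?v \<otimes> y \<in> V #> c"
      proof -
        obtain w where w: "w \<in> V" "y = w \<otimes> c" using y(1) by (auto simp: r_coset_def)
        have "?v \<otimes> y = (?v \<otimes> w) \<otimes> c" using w vG nG c \<U>_subset[OF V] by (simp add: m_assoc subset_eq)
        moreover have "?v \<otimes> w \<in> V" using v' w(1) subgroup.m_closed[OF \<U>_subgroup[OF V]] by blast
        ultimately show ?thesis unfolding r_coset_def by blast
      qed
      moreover have "z \<in> topspace T" using v vG x by (simp add: topspace_T)
      ultimately show "z \<in> ?O" by blast
    qed
    moreover have "x \<in> V #> x" using rcos_self[OF x \<U>_subgroup[OF V]] .
    ultimately show "\<exists>T'. openin T T' \<and> x \<in> T' \<and> T' \<subseteq> ?O" using open_coset[OF \<U>_open[OF V] x] by blast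
  qed
qed

text \<open>The image of \<open>V #> c\<close> in the quotient is open and meets the dense subgroup
  generated by the class of \<open>g\<close>; this gives a power of \<open>g\<close> in the same
  coset of \<open>NV\<close>. Nonnegative exponents suffice because \<open>g\<close> has finite
  order modulo \<open>V\<close>.\<close>

lemma dense_cover:
  assumes gen: "topologically_generates (G Mod N) TQ {N #> g}" and g: "g \<in> carrier G"
    and V: "V \<in> \<U>" and c: "c \<in> carrier G"
  shows "\<exists>j::nat. \<exists>n\<in>N. V #> c = V #> (g [^] j \<otimes> n)"
proof -
  \<comment> \<open>The representative \<open>x\<close> decouples the two quotients: it represents
    \<open>D\<close> modulo \<open>N\<close> and a nonnegative power of \<open>g\<close> modulo
    \<open>V\<close>.\<close>
  let ?P = "\<lambda>D. \<exists>(j::nat) x. x \<in> carrier G \<and> D = N #> x \<and> V #> x = V #> (g [^] j)"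
  interpret Q: group "G Mod N" using normal.factorgroup_is_group[OF N_normal] .
  have P: "?P D" if "D \<in> generate (G Mod N) {N #> g}" for D
    using that
  proof (induction D rule: generate.induct)
    case one
    have "\<one>\<^bsub>G Mod N\<^esub> = N #> \<one>" using subgroup.subset[OF N_subgroup] by (simp add: FactGroup_def)
    then show ?case by (intro exI[of _ "0::nat"] exI[of _ \<one>]) simp
  next
    case (incl D)
    then show ?case using g by (intro exI[of _ "1::nat"] exI[of _ g]) simp
  next
    case (inv D)
    \<comment> \<open>Modulo \<open>V\<close> the inverse of \<open>g\<close> is its power with
      exponent \<open>p ^ e - 1\<close>.\<close>
    obtain e where e: "g [^] (p ^ e) \<in> V" using p_power_in[OF V g] by blast
    have "p ^ e = Suc (p ^ e - 1)" using p_gt_1 by simp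
    then have "g [^] (p ^ e - 1) \<otimes> g = g [^] (p ^ e)" using g by (metis nat_pow_Suc)
    moreover have "V #> (g [^] (p ^ e)) = V #> \<one>" using coset_one_iff[OF V] e g by simp
    ultimately have "(V #> g [^] (p ^ e - 1)) \<otimes>\<^bsub>G Mod V\<^esub> (V #> g) \<otimes>\<^bsub>G Mod V\<^esub> (V #> inv g) = (V #> \<one>) \<otimes>\<^bsub>G Mod V\<^esub> (V #> inv g)"
      using coset_mult[OF V, of "g [^] (p ^ e - 1)" g] g by simp
    then have "V #> inv g = V #> g [^] (p ^ e - 1)" using g V by (simp add: coset_mult m_assoc)
    moreover have "inv\<^bsub>G Mod N\<^esub> (N #> g) = N #> inv g"
    proof (rule Q.inv_equality)
      show "(N #> inv g) \<otimes>\<^bsub>G Mod N\<^esub> (N #> g) = \<one>\<^bsub>G Mod N\<^esub>"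
        using coset_N_mult[of "inv g" g] g subgroup.subset[OF N_subgroup] by (simp add: FactGroup_def)
    qed (use g coset_in in auto)
    ultimately show ?case using inv g by (intro exI[of _ "p ^ e - 1"] exI[of _ "inv g"]) auto
  next
    case (eng D E)
    then obtain i j x y where xy: "x \<in> carrier G" "D = N #> x" "V #> x = V #> (g [^] (i::nat))"
      "y \<in> carrier G" "E = N #> y" "V #> y = V #> (g [^] (j::nat))" by blast
    have "V #> (x \<otimes> y) = V #> (g [^] (i + j))"
      using xy coset_mult[OF V, of x y] coset_mult[OF V, of "g [^] i" "g [^] j"] g by (simp add: nat_pow_mult)
    then show ?case using xy coset_N_mult by (intro exI[of _ "i + j"] exI[of _ "x \<otimes> y"]) auto
  qed
  define O' where "O' = {N #> x | x. x \<in> V #> c}"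
  have "N #> c \<in> O'" using rcos_self[OF c \<U>_subgroup[OF V]] unfolding O'_def by blast
  moreover have "openin TQ O'" using open_image_coset[OF V c] by (simp only: O'_def)
  moreover have "N #> c \<in> Abstract_Topology.closure_of TQ (generate (G Mod N) {N #> g})"
    using gen coset_in[OF c] unfolding topologically_generates_def by blast
  ultimately have "\<exists>D\<in>generate (G Mod N) {N #> g}. D \<in> O'"
    unfolding in_closure_of by blast
  then obtain D where D: "D \<in> generate (G Mod N) {N #> g}" "D \<in> O'" by blast
  obtain y where y: "y \<in> V #> c" "D = N #> y" using D(2) unfolding O'_def by blast
  have yG: "y \<in> carrier G" using y(1) r_coset_subset_G[OF \<U>_subset[OF V] c] by blast
  have Vy: "V #> y = V #> c" using repr_independence[OF y(1) c \<U>_subgroup[OF V]] by simp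
  obtain j x where x: "x \<in> carrier G" "D = N #> x" "V #> x = V #> (g [^] (j::nat))" using P[OF D(1)] by blast
  obtain n where n: "n \<in> N" "y = n \<otimes> x"
    using rcos_self[OF yG N_subgroup] y(2) x(2) unfolding r_coset_def by blast
  have nG: "n \<in> carrier G" using N_carrier[OF n(1)] .
  have "V #> c = (V #> n) \<otimes>\<^bsub>G Mod V\<^esub> (V #> x)" using coset_mult[OF V nG x(1)] n Vy by simp
  also have "\<dots> = V #> (n \<otimes> g [^] j)" using coset_mult[OF V nG, of "g [^] j"] x(3) g by simp
  \<comment> \<open>The factor from \<open>N\<close> is moved to the right of the power by
    conjugation, in keeping with coefficients on the right.\<close>
  also have "n \<otimes> g [^] j = g [^] j \<otimes> (inv (g [^] j) \<otimes> n \<otimes> g [^] j)"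
    using nG g by (simp add: m_assoc) (simp flip: m_assoc)
  finally have "V #> c = V #> (g [^] j \<otimes> (inv (g [^] j) \<otimes> n \<otimes> g [^] j))" .
  moreover have "inv (g [^] j) \<otimes> n \<otimes> g [^] j \<in> N"
    using normal.inv_op_closed1[OF N_normal _ n(1), of "g [^] j"] g by simp
  ultimately show ?thesis by (intro exI bexI)
qed

text \<open>The witness is the preimage of \<open>p\<^sup>n\<int>\<^sub>p\<close>.\<close>

lemma p_adic_subgroups:
  assumes iso: "isomorphic_topological_groups (G Mod N) TQ (padic_int_group p) (padic_int_topology p)"
    and gen: "topologically_generates (G Mod N) TQ {N #> g}" and g: "g \<in> carrier G"
  shows "\<exists>V\<in>\<U>. N \<subseteq> V \<and> (\<forall>j::nat. g [^] j \<in> V \<longleftrightarrow> p ^ n dvd j)"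
proof -
  let ?Z = "padic_int_group p"
  obtain f where f: "f \<in> iso (G Mod N) ?Z" "homeomorphic_map TQ (padic_int_topology p) f"
    using iso unfolding isomorphic_topological_groups_def by blast
  have fh: "f \<in> hom (G Mod N) ?Z" and fs: "f ` carrier (G Mod N) = carrier ?Z"
    using f(1) unfolding iso_def bij_betw_def by auto
  \<comment> \<open>The residue modulo \<open>p ^ k\<close> of the image of \<open>x\<close> in the
    p-adic integers.\<close>
  define \<phi> where "\<phi> k x = f (N #> x) k" for k x
  have range: "\<phi> k x \<in> {0..<int p ^ k}" if "x \<in> carrier G" for k x
    using hom_in_carrier[OF fh coset_in[OF that]] by (simp add: \<phi>_def padic_int_group_def)
  have step: "\<phi> (Suc k) x mod int p ^ k = \<phi> k x" if "x \<in> carrier G" for k x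
    using hom_in_carrier[OF fh coset_in[OF that]] by (simp add: \<phi>_def padic_int_group_def)
  have mult: "\<phi> k (x \<otimes> y) = (\<phi> k x + \<phi> k y) mod int p ^ k" if "x \<in> carrier G" "y \<in> carrier G" for k x y
    using hom_mult[OF fh coset_in[OF that(1)] coset_in[OF that(2)]] coset_N_mult[OF that]
    by (simp add: \<phi>_def padic_int_group_def)
  have modeq: "\<phi> k x mod int p ^ k = \<phi> k x" if "x \<in> carrier G" for k x using range[OF that, of k] by simp
  have one: "\<phi> k \<one> = 0" for k
  proof -
    have "(\<phi> k \<one> + \<phi> k \<one>) mod int p ^ k = (\<phi> k \<one> + 0) mod int p ^ k" using mult[of \<one> \<one> k] modeq[of \<one> k] by simp
    then have "\<phi> k \<one> mod int p ^ k = 0 mod int p ^ k" by (simp add: mod_eq_dvd_iff)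
    then show ?thesis using modeq[of \<one> k] by simp
  qed
  have on_N: "\<phi> k n = 0" if "n \<in> N" for k n
  proof -
    have "N #> n = N #> \<one>" using that coset_join2[OF N_carrier[OF that] N_subgroup that] coset_mult_one[of N] subgroup.subset[OF N_subgroup] by simp
    then show ?thesis using one[of k] by (simp add: \<phi>_def)
  qed
  define V where "V k = {x \<in> carrier G. \<phi> k x = 0}" for k
  have inv0: "\<phi> k (inv x) = 0" if "x \<in> V k" for k x
  proof -
    have "(\<phi> k x + \<phi> k (inv x)) mod int p ^ k = 0" using mult[of x "inv x" k] one[of k] that by (simp add: V_def)
    then show ?thesis using that modeq[of "inv x" k] by (simp add: V_def)
  qed
  have V: "V k \<in> \<U>" for k
  proof -
    have sub: "subgroup (V k) G"
    proof (rule subgroupI)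
      show "V k \<noteq> {}" using one[of k] by (auto simp: V_def intro!: exI[of _ \<one>])
      show "inv x \<in> V k" if "x \<in> V k" for x using that inv0[OF that] by (simp add: V_def)
      show "x \<otimes> y \<in> V k" if "x \<in> V k" "y \<in> V k" for x y using that mult[of x y k] by (simp add: V_def)
    qed (auto simp: V_def)
    moreover have "y \<otimes> x \<otimes> inv y \<in> V k" if "y \<in> carrier G" "x \<in> V k" for x y
    proof -
      have x: "x \<in> carrier G" "\<phi> k x = 0" using that(2) by (auto simp: V_def)
      have "\<phi> k (y \<otimes> x \<otimes> inv y) = (\<phi> k y + \<phi> k (inv y)) mod int p ^ k"
        using mult[of "y \<otimes> x" "inv y" k] mult[of y x k] x that(1) modeq[of y k] by simp
      also have "\<dots> = 0" using mult[of y "inv y" k] one[of k] that(1) by simp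
      finally show ?thesis using x that(1) by (simp add: V_def)
    qed
    ultimately have normal: "V k \<lhd> G" unfolding normal_inv_iff by blast
    have "openin (padic_int_topology p) {a \<in> topspace (padic_int_topology p). a k = 0}"
    proof -
      have "continuous_map (product_topology (\<lambda>_. discrete_topology UNIV) UNIV) (discrete_topology UNIV) (\<lambda>a::nat \<Rightarrow> int. a k)"
        by (rule continuous_map_product_projection) simp
      then have "continuous_map (padic_int_topology p) (discrete_topology UNIV) (\<lambda>a. a k)"
        unfolding padic_int_topology_def by (rule continuous_map_from_subtopology)
      then show ?thesis using openin_continuous_map_preimage[of _ "discrete_topology UNIV" _ "{0}"] by auto
    qed
    moreover have "continuous_map TQ (padic_int_topology p) f" using f(2) homeomorphic_imp_continuous_map by blast
    ultimately have "openin TQ {D \<in> topspace TQ. f D \<in> {a \<in> topspace (padic_int_topology p). a k = 0}}"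
      by (rule openin_continuous_map_preimage[rotated])
    then have "openin T {x \<in> topspace T. N #> x \<in> {D \<in> topspace TQ. f D \<in> {a \<in> topspace (padic_int_topology p). a k = 0}}}"
      unfolding openin_quotient_group_topology by blast
    moreover have "{x \<in> topspace T. N #> x \<in> {D \<in> topspace TQ. f D \<in> {a \<in> topspace (padic_int_topology p). a k = 0}}} = V k"
    proof -
      have "f (N #> x) \<in> topspace (padic_int_topology p)" if "x \<in> carrier G" for x
        using hom_in_carrier[OF fh coset_in[OF that]] by (simp add: padic_int_topology_def)
      then show ?thesis using coset_in by (auto simp: V_def \<phi>_def topspace_T topspace_TQ)
    qed
    ultimately show ?thesis using normal by (simp add: open_normal_subgroups_def)
  qed
  have NV: "N \<subseteq> V k" for k using on_N N_carrier by (auto simp: V_def)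
  have pow: "\<phi> k (g [^] (j::nat)) = (int j * \<phi> k g) mod int p ^ k" for j k
  proof (induction j)
    case 0
    then show ?case using one[of k] by simp
  next
    case (Suc j)
    then show ?case using mult[of "g [^] j" g k] g by (simp add: mod_add_right_eq distrib_right add.commute)
  qed
  \<comment> \<open>Otherwise \<open>V 1\<close>, which contains \<open>N\<close>, would also
    contain \<open>g\<close> and by density the whole group, although the map to the p-adic integers
    is onto.\<close>
  have "\<phi> 1 g \<noteq> 0"
  proof
    assume "\<phi> 1 g = 0"
    then have gV: "g \<in> V 1" using g by (simp add: V_def)
    have "c \<in> V 1" if c: "c \<in> carrier G" for c
    proof -
      obtain j n where jn: "n \<in> N" "V 1 #> c = V 1 #> (g [^] (j::nat) \<otimes> n)" using dense_cover[OF gen g V c] by blast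
      have "\<phi> 1 (g [^] j) = 0" using pow[of 1 j] \<open>\<phi> 1 g = 0\<close> by simp
      then have "g [^] j \<otimes> n \<in> V 1"
        using subgroup.m_closed[OF \<U>_subgroup[OF V], of "g [^] j" 1 n] jn(1) NV g by (auto simp: V_def)
      then have "V 1 #> c = V 1 #> \<one>" using coset_one_iff[OF V, of "g [^] j \<otimes> n" 1] jn g N_carrier by simp
      then show ?thesis using coset_one_iff[OF V c] by simp
    qed
    then have zero: "\<phi> 1 c = 0" if "c \<in> carrier G" for c using that by (auto simp: V_def)
    \<comment> \<open>The p-adic integer 1; the reduction matters at \<open>k = 0\<close>, where the
      only residue is 0.\<close>
    have "1 mod int p ^ k \<in> {0..<int p ^ k}" for k using p_gt_1 by simp
    moreover have "1 mod int p ^ Suc k mod int p ^ k = 1 mod int p ^ k" for k by (rule mod_mod_cancel) simp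
    ultimately have "(\<lambda>k. 1 mod int p ^ k) \<in> carrier ?Z" unfolding padic_int_group_def by simp
    then have "(\<lambda>k. 1 mod int p ^ k) \<in> f ` carrier (G Mod N)" using fs by simp
    then obtain D where D: "(\<lambda>k. 1 mod int p ^ k) = f D" "D \<in> carrier (G Mod N)" by (rule imageE)
    obtain c where c: "c \<in> carrier G" "D = N #> c" using coset_cases[OF D(2)] .
    have "\<phi> 1 c = 1" using fun_cong[OF D(1), of 1] c(2) p_gt_1 by (simp add: \<phi>_def)
    then show False using zero[OF c(1)] by simp
  qed
  then have g1: "\<not> int p dvd \<phi> 1 g"
    using range[OF g, of 1] zdvd_not_zless[of "\<phi> 1 g" "int p"] by auto
  \<comment> \<open>The image of \<open>g\<close> stays nonzero modulo \<open>p\<close> at every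
    level, so it is a unit modulo \<open>p ^ n\<close>, and a multiple of it by \<open>j\<close>
    vanishes there only if \<open>p ^ n\<close> divides \<open>j\<close>.\<close>
  have red: "\<phi> (Suc k) g mod int p = \<phi> 1 g" for k
  proof (induction k)
    case 0
    then show ?case using modeq[OF g, of 1] by simp
  next
    case (Suc k)
    have "\<phi> (Suc (Suc k)) g mod int p = (\<phi> (Suc (Suc k)) g mod int p ^ Suc k) mod int p"
      by (simp add: mod_mod_cancel)
    then show ?case using step[OF g, of "Suc k"] Suc by simp
  qed
  have "p ^ n dvd j" if j: "g [^] j \<in> V n" for j :: nat
  proof (cases n)
    case (Suc k)
    have "int p ^ n dvd int j * \<phi> n g" using j pow[of n j] by (simp add: V_def mod_eq_0_iff_dvd)
    moreover have "\<not> int p dvd \<phi> n g" using red[of k] g1 Suc by (metis dvd_mod_iff dvd_refl)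
    then have "coprime (int p ^ n) (\<phi> n g)"
      using prime_p prime_imp_coprime[of "int p"] by simp
    ultimately have "int p ^ n dvd int j" using coprime_dvd_mult_left_iff by blast
    then show ?thesis by (metis int_dvd_int_iff of_nat_power)
  qed simp
  moreover have "g [^] j \<in> V n" if "p ^ n dvd j" for j :: nat
  proof -
    have "int p ^ n dvd int j * \<phi> n g" using that by (metis dvd_mult2 int_dvd_int_iff of_nat_power)
    then show ?thesis using pow[of n j] g by (simp add: V_def)
  qed
  ultimately have "N \<subseteq> V n \<and> (\<forall>j::nat. g [^] j \<in> V n \<longleftrightarrow> p ^ n dvd j)" using NV by blast
  then show ?thesis using V by (intro bexI)
qed

text \<open>Intersecting \<open>U\<close> with a subgroup \<open>V'\<close> that contains
  \<open>N\<close> makes the order of \<open>g\<close> the same modulo the intersection and modulo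
  its product with \<open>N\<close>: the power \<open>m\<close> already lies in the intersection,
  and smaller positive powers are not even in \<open>V'\<close>.\<close>

lemma good_basis:
  assumes iso: "isomorphic_topological_groups (G Mod N) TQ (padic_int_group p) (padic_int_topology p)"
    and gen: "topologically_generates (G Mod N) TQ {N #> g}" and g: "g \<in> carrier G" and U: "U \<in> \<U>"
  shows "\<exists>V\<in>\<U>. V \<subseteq> U \<and> (\<exists>m>k. (ge g \<ominus>\<^bsub>S\<^esub> \<one>\<^bsub>S\<^esub>) [^]\<^bsub>S\<^esub> (m::nat) \<in> ker V \<and>
    S.power_basis_mod supported (ker V) (ge g \<ominus>\<^bsub>S\<^esub> \<one>\<^bsub>S\<^esub>) m)"
proof -
  obtain e where e: "g [^] (p ^ e) \<in> U" using p_power_in[OF U g] by blast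
  \<comment> \<open>The bound \<open>e\<close> puts \<open>g [^] (p ^ n)\<close> into
    \<open>U\<close>, and \<open>k\<close> makes \<open>p ^ n\<close> exceed
    \<open>k\<close>.\<close>
  define n where "n = max e k"
  define m where "m = p ^ n"
  have "k < 2 ^ k" by (rule less_exp)
  also have "\<dots> \<le> p ^ k" using p_gt_1 by (intro power_mono) auto
  also have "\<dots> \<le> m" unfolding m_def n_def using p_gt_1 by (intro power_increasing) auto
  finally have mk: "k < m" .
  obtain V' where V': "V' \<in> \<U>" "N \<subseteq> V'" "\<And>j::nat. g [^] j \<in> V' \<longleftrightarrow> m dvd j"
    using p_adic_subgroups[OF iso gen g, of n] unfolding m_def by blast
  let ?V = "U \<inter> V'"
  have V: "?V \<in> \<U>" using inter_in_\<U>[OF U V'(1)] .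
  have "p ^ n = p ^ e * p ^ (n - e)" by (simp add: n_def flip: power_add)
  then have "g [^] m = (g [^] (p ^ e)) [^] (p ^ (n - e))" using g by (simp add: m_def nat_pow_pow)
  moreover have "x [^] (i::nat) \<in> U" if "x \<in> U" for x i
    using that subgroup.one_closed[OF \<U>_subgroup[OF U]] subgroup.m_closed[OF \<U>_subgroup[OF U]] by (induction i) auto
  ultimately have "g [^] m \<in> U" using e by simp
  then have gm: "g [^] m \<in> ?V" using V'(3)[of m] by simp
  then have Vgm: "?V #> (g [^] m) = ?V #> \<one>" using coset_one_iff[OF V] g by simp
  have sm: "(ge g \<ominus>\<^bsub>S\<^esub> \<one>\<^bsub>S\<^esub>) [^]\<^bsub>S\<^esub> m \<in> ker ?V"
    unfolding m_def ge_minus_one_pow[OF g] using Vgm g by (intro ge_component_eq V) (auto simp: m_def)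
  have red: "?V #> (g [^] (j::nat)) = ?V #> (g [^] (j mod m))" for j
  proof -
    have "?V #> (g [^] (m * i)) = ?V #> \<one>" for i
    proof (induction i)
      case (Suc i)
      have "?V #> (g [^] (m * Suc i)) = (?V #> (g [^] m)) \<otimes>\<^bsub>G Mod ?V\<^esub> (?V #> (g [^] (m * i)))"
        using g coset_mult[OF V, of "g [^] m" "g [^] (m * i)"] by (simp add: nat_pow_mult)
      then show ?case unfolding Suc Vgm using coset_mult[OF V, of \<one> \<one>] by simp
    qed simp
    then have "?V #> (g [^] (m * (j div m) + j mod m)) = (?V #> \<one>) \<otimes>\<^bsub>G Mod ?V\<^esub> (?V #> (g [^] (j mod m)))"
      using g coset_mult[OF V, of "g [^] (m * (j div m))" "g [^] (j mod m)"] by (simp add: nat_pow_mult)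
    then show ?thesis using g coset_mult[OF V, of \<one> "g [^] (j mod m)"] by simp
  qed
  have pbg: "S.power_basis_mod supported (ker ?V) (ge g) m"
  proof (rule power_basis_ge[OF V g])
    fix c assume c: "c \<in> carrier G"
    obtain j n' where jn: "n' \<in> N" "?V #> c = ?V #> (g [^] (j::nat) \<otimes> n')" using dense_cover[OF gen g V c] by blast
    have nG: "n' \<in> carrier G" using N_carrier[OF jn(1)] .
    have "?V #> (g [^] j \<otimes> n') = ?V #> (g [^] (j mod m) \<otimes> n')"
      using coset_mult[OF V, of "g [^] j" n'] coset_mult[OF V, of "g [^] (j mod m)" n'] red[of j] g nG by simp
    then have "?V #> c = ?V #> (g [^] (j mod m) \<otimes> n')" using jn(2) by simp
    moreover have "j mod m < m" using mk by simp
    ultimately show "\<exists>j<m. \<exists>n\<in>N. ?V #> c = ?V #> (g [^] j \<otimes> n)" using jn(1) by blast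
  next
    have le: "i = j" if ij: "i \<le> j" "j < m" and n: "n \<in> N" "n' \<in> N"
      and eq: "?V #> (g [^] i \<otimes> n) = ?V #> (g [^] j \<otimes> n')" for i j :: nat and n n'
    proof -
      have nG: "n \<in> carrier G" "n' \<in> carrier G" using n N_carrier by auto
      \<comment> \<open>The cosets are compared modulo \<open>V'\<close>, where elements of
        \<open>N\<close> disappear and only powers of \<open>g\<close> remain. The assumption
        \<open>i \<le> j\<close> keeps the difference of exponents natural.\<close>
      have "V' <#> (?V #> (g [^] i \<otimes> n)) = V' <#> (?V #> (g [^] j \<otimes> n'))" using eq by simp
      then have "V' #> (g [^] i \<otimes> n) = V' #> (g [^] j \<otimes> n')"
        using coset_coarsen'[OF V V'(1)] g nG by simp
      moreover have "V' #> (x \<otimes> y) = V' #> x" if "x \<in> carrier G" "y \<in> N" for x y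
      proof -
        have "V' #> y = V' #> \<one>" using coset_one_iff[OF V'(1)] V'(2) that(2) N_carrier by blast
        then show ?thesis
          using coset_mult[OF V'(1) that(1), of y] coset_mult[OF V'(1) that(1), of \<one>] that N_carrier by simp
      qed
      ultimately have eq': "V' #> (g [^] i) = V' #> (g [^] j)" using n g by simp
      have "g [^] j = g [^] (j - i) \<otimes> g [^] i" using ij(1) g by (simp add: nat_pow_mult)
      then have "g [^] (j - i) = g [^] j \<otimes> inv (g [^] i)" using g by (simp add: m_assoc)
      then have "g [^] (j - i) \<in> V'"
        using coset_eq_iff[OF V'(1), of "g [^] j" "g [^] i"] eq' g by simp
      then have "m dvd j - i" using V'(3) by simp
      then have "j - i = 0" using ij(2) dvd_imp_le[of m "j - i"] by linarith
      then show "i = j" using ij(1) by simp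
    qed
    fix i j n n' assume "i < m" "j < m" "n \<in> N" "n' \<in> N" "?V #> (g [^] i \<otimes> n) = ?V #> (g [^] j \<otimes> n')"
    then show "i = (j::nat)" using le[of i j n n'] le[of j i n' n] by (metis nat_le_linear)
  qed
  have gS: "ge g \<in> carrier S" using g by simp
  \<comment> \<open>The basis of powers of \<open>g\<close> becomes one of powers of
    \<open>s\<close> by translating through minus one, which commutes with everything and maps the
    subring to itself.\<close>
  have "S.power_basis_mod supported (ker ?V) (ge g \<oplus>\<^bsub>S\<^esub> \<ominus>\<^bsub>S\<^esub> \<one>\<^bsub>S\<^esub>) m"
  proof (rule S.power_basis_mod_translate[OF supported_subring ker_ideal[OF V] gS _ _ _ _ pbg])
    show "\<ominus>\<^bsub>S\<^esub> \<one>\<^bsub>S\<^esub> \<otimes>\<^bsub>S\<^esub> r \<in> supported" if "r \<in> supported" for r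
      using subringE(5)[OF supported_subring that] supported_carrier[OF that] by (simp add: S.l_minus)
    show "\<ominus>\<^bsub>S\<^esub> (\<ominus>\<^bsub>S\<^esub> \<one>\<^bsub>S\<^esub>) \<otimes>\<^bsub>S\<^esub> r \<in> supported" if "r \<in> supported" for r
      using that supported_carrier[OF that] by simp
    show "\<ominus>\<^bsub>S\<^esub> \<one>\<^bsub>S\<^esub> \<otimes>\<^bsub>S\<^esub> ge g = ge g \<otimes>\<^bsub>S\<^esub> \<ominus>\<^bsub>S\<^esub> \<one>\<^bsub>S\<^esub>" using gS by (simp add: S.l_minus S.r_minus)
  qed simp
  then have "S.power_basis_mod supported (ker ?V) (ge g \<ominus>\<^bsub>S\<^esub> \<one>\<^bsub>S\<^esub>) m" by (simp add: a_minus_def)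
  then show ?thesis using V sm mk by blast
qed

lemma skew_generator_S:
  assumes iso: "isomorphic_topological_groups (G Mod N) TQ (padic_int_group p) (padic_int_topology p)"
    and gen: "topologically_generates (G Mod N) TQ {N #> g}" and g: "g \<in> carrier G"
  shows "skew_generator S (ker ` \<U>) supported I (ge g) (ge (inv g))"
proof (intro skew_generator.intro linear_topological_ring_S skew_generator_axioms.intro)
  show "subring supported S" by (rule supported_subring)
  show "S.cl supported \<subseteq> supported" by (rule supported_closed)
  show "ideal I S" by (rule I_ideal)
  show "\<exists>k::nat. I [^]\<^bsub>ideals_set S\<^esub> k \<subseteq> K" if "K \<in> ker ` \<U>" for K
    using that augmentation_nilpotent by auto
  show "ge g \<in> carrier S" "ge (inv g) \<in> carrier S" using g by auto
  show "ge g \<otimes>\<^bsub>S\<^esub> ge (inv g) = \<one>\<^bsub>S\<^esub>" "ge (inv g) \<otimes>\<^bsub>S\<^esub> ge g = \<one>\<^bsub>S\<^esub>"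
    using g by (simp_all add: ge_mult ge_one)
  show "ge (inv g) \<otimes>\<^bsub>S\<^esub> r \<otimes>\<^bsub>S\<^esub> ge g \<in> supported" if "r \<in> supported" for r
    using supported_conj[OF that g] .
  show "ge g \<otimes>\<^bsub>S\<^esub> r \<otimes>\<^bsub>S\<^esub> ge (inv g) \<in> supported" if "r \<in> supported" for r
    using supported_conj[OF that, of "inv g"] g by simp
  show "ge g \<ominus>\<^bsub>S\<^esub> \<one>\<^bsub>S\<^esub> \<in> I" using ge_minus_ge_in_I[OF g one_closed] by (simp add: ge_one)
  show "\<exists>L\<in>ker ` \<U>. L \<subseteq> K \<and> (\<exists>m>n. (ge g \<ominus>\<^bsub>S\<^esub> \<one>\<^bsub>S\<^esub>) [^]\<^bsub>S\<^esub> m \<in> L \<and>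
      S.power_basis_mod supported L (ge g \<ominus>\<^bsub>S\<^esub> \<one>\<^bsub>S\<^esub>) m)" if K: "K \<in> ker ` \<U>" for K n
  proof -
    obtain U where U: "U \<in> \<U>" "K = ker U" using K by blast
    obtain V where V: "V \<in> \<U>" "V \<subseteq> U" "\<exists>m>n. (ge g \<ominus>\<^bsub>S\<^esub> \<one>\<^bsub>S\<^esub>) [^]\<^bsub>S\<^esub> m \<in> ker V \<and>
      S.power_basis_mod supported (ker V) (ge g \<ominus>\<^bsub>S\<^esub> \<one>\<^bsub>S\<^esub>) m"
      using good_basis[OF iso gen g U(1), of n] by blast
    have "ker V \<subseteq> K" using ker_mono[OF V(1) U(1) V(2)] U(2) by simp
    then show ?thesis using V(1,3) by (intro bexI[of _ "ker V"] conjI imageI)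
  qed
qed

end

theorem proposition4p1:
  fixes p :: nat and G :: "'a monoid" and T :: "'a topology" and N :: "'a set" and g :: 'a
  assumes "prime p"
    and "pro_p_group p G T"
    and "N \<lhd> G" and "closedin T N"
    and "free_pro_p_group_countable_rank p (G\<lparr>carrier := N\<rparr>) (subtopology T N)"
    and "isomorphic_topological_groups
           (G Mod N) (quotient_group_topology G T N)
           (padic_int_group p) (padic_int_topology p)"
    and "g \<in> carrier G"
    and "topologically_generates (G Mod N) (quotient_group_topology G T N) {g <#\<^bsub>G\<^esub> N}"
  shows
    "let Fp = residue_ring (int p);
         S = completed_group_ring Fp G T;
         I = augmentation_power Fp G T;
         R = completed_subgroup_ring Fp G T N;
         TR = filtration_topology R (\<lambda>k. carrier R \<inter> I k);
         \<sigma> = (\<lambda>x. group_element Fp G T (inv\<^bsub>G\<^esub> g) \<otimes>\<^bsub>S\<^esub> x \<otimes>\<^bsub>S\<^esub> group_element Fp G T g);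
         \<delta> = skew_derivation R \<sigma>
     in skew_power_series_ring_exists R TR \<sigma> \<delta> \<and>
        isomorphic_topological_rings
          S (filtration_topology S I)
          (skew_power_series_ring R TR \<sigma> \<delta>) (skew_power_series_topology TR)"
proof -
  interpret G: group G using assms(3) normal.axioms(2) normal_def by blast
  interpret pro_p_group_ring_sub G p T N
    using assms(1-3,5) G.is_group unfolding free_pro_p_group_countable_rank_def
    by (intro pro_p_group_ring_sub.intro pro_p_group_ring_normal.intro pro_p_group_ring.intro
        pro_p_group_ring_axioms.intro pro_p_group_ring_normal_axioms.intro pro_p_group_ring_sub_axioms.intro) auto
  have "g <#\<^bsub>G\<^esub> N = N #>\<^bsub>G\<^esub> g" using normal.coset_eq[OF assms(3)] assms(7) by auto
  then interpret sk: skew_generator S "ker ` \<U>" supported I "ge g" "ge (inv\<^bsub>G\<^esub> g)"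
    using skew_generator_S assms(6-8) by simp
  have pow: "augmentation_power Fp G T = sk.F"
  proof
    fix k
    show "augmentation_power Fp G T k = sk.F k"
      unfolding augmentation_power_def sk.F_def sk.Ipow_def by (rule closure_of_eq_cl[OF sk.Ipow_subset[unfolded sk.Ipow_def]])
  qed
  have sg: "(\<lambda>x. group_element Fp G T (inv\<^bsub>G\<^esub> g) \<otimes>\<^bsub>S\<^esub> x \<otimes>\<^bsub>S\<^esub> group_element Fp G T g) = sk.sg"
    by (rule ext) (subst sk.sg_def, unfold ge_def, rule refl)
  show ?thesis
    unfolding Let_def pow sg completed_subgroup_ring_eq
    using sk.skew_power_series_isomorphism
    unfolding sk.FR.T_def sk.FS.T_def sk.ddl_def by simp
qed

end
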